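(* Let the parametric model be an exponential family $$\mathcal{M} = \Bigl\{g(x;\theta) = \exp\Bigl(\sum_{i=1}^p \theta^i \xi_i(x) -\Psi(\theta)\Bigr)\ \Big|\ \theta\in\Theta\Bigr\},\qquad \Psi(\theta)=\log\int\exp\Bigl(\sum_{i=1}^p\theta^i\xi_i(x)\Bigr)d\mu .$$ Let $X_1,\dots,X_n$ be an i.i.d. sample from the true density $g(x)$, let $\theta_*$ be the parameter of the information projection of $g$ on $\mathcal M$, and let $\hat\theta$ be the maximum likelihood estimator. With the notation, Einstein summation convention and standing assumptions given in the context, the estimation risk $R[g(x;\theta_* )\,|\,g(x;\hat\theta)]=E\bigl[D[g(x;\theta_* )\,|\,g(x;\hat\theta)]\bigr]$ satisfies, as $n\to\infty$ (model fixed), $$ \begin{aligned} R[g(x;\theta_* )\,|\,g(x;\hat{\theta}) ] &= \frac{1}{2n}\, \mathrm{tr} \bigl(\tilde{G}^{-1}G \bigr) \\ &\quad+\frac{1}{24n^2}\Bigl[-8\,\tilde{g}^{uk}\tilde{g}^{ls}\tilde{g}^{mt}\kappa_{kst}\kappa^*_{lmu}\\ &\qquad+9\,\tilde{g}^{ko}\tilde{g}^{lu}\tilde{g}^{sv}\tilde{g}^{tw}\tilde{g}^{hm}\kappa^*_{lmo}\kappa^*_{sth} (g_{ku}g_{vw}+g_{kv}g_{uw}+g_{kw}g_{uv})\\ &\qquad-3\,\tilde{g}^{kw}\tilde{g}^{ls}\tilde{g}^{mu}\tilde{g}^{tv}\kappa^*_{lmtw} (g_{ks}g_{uv}+g_{ku}g_{sv}+g_{kv}g_{su})\Bigr]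 + O(n^{-3}). \end{aligned} $$
   Context: **Setting.** The $g(x;\theta)$, $\theta=(\theta^1,\dots,\theta^p)\in\Theta$, are probability densities with respect to a reference measure $d\mu$ on a measurable space. The true distribution has density $g(x)$ with respect to $d\mu$ (not necessarily in $\mathcal M$). $X_1,\dots,X_n$ are i.i.d. from $g(x)$; $X$ is a generic such variable. $E[\cdot]$ is expectation under $g(x)$; $E_{\theta_*}[\cdot]$ is expectation under $g(x;\theta_* )$. The Kullback–Leibler divergence is $D[g_1(x)\,|\,g_2(x)]=\int g_1(x)\log\bigl(g_1(x)/g_2(x)\bigr)d\mu$. The information projection $g(x;\theta_* )$ is given by $\theta_*=\arg\min_{\theta\in\Theta}D[g(x)\,|\,g(x;\theta)]$, which solves $E[\partial_{\theta^i}\log g(X;\theta)]=0$, $i=1,\dots,p$; equivalently $\eta_i^*:=\partial\Psi(\theta_* )/\partial\theta^i=E_{\theta_*}[\xi_i]=E[\xi_i]$. The MLE $\hat\theta$ maximizes $\sum_{a=1}^n\log g(X_a;\theta)$, i.e. solves $\partial\Psi(\hat\theta)/\partial\theta^i=n^{-1}\sum_{a=1}^n\xi_i(X_a)$, $i=1,\dots,p$. **Notation** (indices run over $1,\dots,p$; repeated indices are summed, Einstein convention): - $G=(g_{ij})$, $g_{ij}=E[(\xi_i-\eta_i^* )(\xi_j-\eta_j^* )]$; - $\tilde G=(\tilde g_{ij})$, $\tilde g_{ij}=\dfrac{\partial^2\Psi(\theta_* )}{\partial\theta^i\partial\theta^j}=E_{\theta_*}[(\xi_i-\eta_i^* )(\xi_j-\eta_j^*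 )]$, positive definite, with $\tilde G^{-1}=(\tilde g^{ij})$; - $\kappa_{ijk}=E[(\xi_i-\eta_i^* )(\xi_j-\eta_j^* )(\xi_k-\eta_k^* )]$; - $\kappa^*_{ijk}=E_{\theta_*}[(\xi_i-\eta_i^* )(\xi_j-\eta_j^* )(\xi_k-\eta_k^* )]=\dfrac{\partial^3\Psi(\theta_* )}{\partial\theta^i\partial\theta^j\partial\theta^k}$; - $\kappa^*_{ijkl}=\dfrac{\partial^4\Psi(\theta_* )}{\partial\theta^i\partial\theta^j\partial\theta^k\partial\theta^l}$, the fourth-order joint cumulant of $\xi_i,\xi_j,\xi_k,\xi_l$ under $g(x;\theta_* )$, i.e. $E_{\theta_*}[\bar\xi_i\bar\xi_j\bar\xi_k\bar\xi_l]-E_{\theta_*}[\bar\xi_i\bar\xi_j]E_{\theta_*}[\bar\xi_k\bar\xi_l]-E_{\theta_*}[\bar\xi_i\bar\xi_k]E_{\theta_*}[\bar\xi_j\bar\xi_l]-E_{\theta_*}[\bar\xi_i\bar\xi_l]E_{\theta_*}[\bar\xi_j\bar\xi_k]$ with $\bar\xi_i=\xi_i-\eta_i^*$. **Standing assumptions.** (1) The divergence may be Taylor-expanded in $\hat\theta$ around $\theta_*$ and the expectation taken termwise: $$R[g(x;\theta_* )|g(x;\hat\theta)]=\tfrac12\tilde g_{ij}E[(\hat\theta^i-\theta_*^i)(\hat\theta^j-\theta_*^j)]-\sum_{t\ge3}\tfrac1{t!}\tau_{i_1\dots i_t}E[(\hat\theta^{i_1}-\theta_*^{i_1})\cdots(\hat\theta^{i_t}-\theta_*^{i_t})],$$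 with $\tau_{i_1\dots i_t}=-\partial^t\Psi(\theta_* )/\partial\theta^{i_1}\cdots\partial\theta^{i_t}$ for $t\ge 3$. (2) Moment condition. Put $\bar e_i(\theta)=\frac1n\sum_{a=1}^n\partial_{\theta^i}\log g(X_a;\theta)=\frac1n\sum_{a=1}^n\xi_i(X_a)-\partial_{\theta^i}\Psi(\theta)$, $\bar\theta^s=\hat\theta^s-\theta_*^s$, $\bar e^s=\tilde g^{sj}\bar e_j(\theta_* )$, and $D^s_{jklm}=\frac1{24}\sum_i\tilde g^{is}\,\frac{\partial^4\bar e_i}{\partial\theta^j\partial\theta^k\partial\theta^l\partial\theta^m}(\tilde\theta_{ijklm})$, where $\tilde\theta_{ijklm}$ is the point on the segment from $\theta_*$ to $\hat\theta$ appearing in the fourth-order Taylor remainder of $\bar e_i(\hat\theta)$ around $\theta_*$. The joint moments, of every order needed ("suitably high order"), of the variables $\sqrt n\,\bar\theta^s,\ \sqrt n\,\bar e^s,\ D^s_{jklm}$ ($1\le j,k,l,m,s\le p$) are bounded in $n$. *)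

theory Defs
  imports "HOL-Probability.Probability" "HOL-Library.Landau_Symbols"
begin

definition partial_deriv :: "'p::finite \<Rightarrow> (real^'p \<Rightarrow> real) \<Rightarrow> real^'p \<Rightarrow> real" where
  "partial_deriv i f \<theta> = deriv (\<lambda>t. f (\<theta> + t *\<^sub>R axis i 1)) 0"

fun partial_derivs :: "'p::finite list \<Rightarrow> (real^'p \<Rightarrow> real) \<Rightarrow> real^'p \<Rightarrow> real" where
  "partial_derivs [] f = f"
| "partial_derivs (i # is) f = partial_deriv i (partial_derivs is f)"

text \<open>The divergence is only used where the second density is strictly positive. Where
  the first density vanishes the integrand is 0, as it should be.\<close>

definition KL_div :: "'a measure \<Rightarrow> ('a \<Rightarrow> real) \<Rightarrow> ('a \<Rightarrow> real) \<Rightarrow> real" where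
  "KL_div \<mu> g1 g2 = (\<integral>x. g1 x * ln (g1 x / g2 x) \<partial>\<mu>)"

definition prob_density :: "'a measure \<Rightarrow> ('a \<Rightarrow> real) \<Rightarrow> bool" where
  "prob_density \<mu> g \<longleftrightarrow>
     g \<in> borel_measurable \<mu> \<and> (\<forall>x\<in>space \<mu>. 0 \<le> g x) \<and> prob_space (density \<mu> (\<lambda>x. ennreal (g x)))"

definition expect :: "'a measure \<Rightarrow> ('a \<Rightarrow> real) \<Rightarrow> ('a \<Rightarrow> real) \<Rightarrow> real" where
  "expect \<mu> g f = (\<integral>x. f x \<partial>density \<mu> (\<lambda>x. ennreal (g x)))"

definition log_partition :: "'a measure \<Rightarrow> ('p::finite \<Rightarrow> 'a \<Rightarrow> real) \<Rightarrow> real^'p \<Rightarrow> real" where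
  "log_partition \<mu> \<xi> \<theta> = ln (\<integral>x. exp (\<Sum>i\<in>UNIV. \<theta> $ i * \<xi> i x) \<partial>\<mu>)"

definition expfam :: "'a measure \<Rightarrow> ('p::finite \<Rightarrow> 'a \<Rightarrow> real) \<Rightarrow> real^'p \<Rightarrow> 'a \<Rightarrow> real" where
  "expfam \<mu> \<xi> \<theta> x = exp ((\<Sum>i\<in>UNIV. \<theta> $ i * \<xi> i x) - log_partition \<mu> \<xi> \<theta>)"

text \<open>Requiring \<^term>\<open>prob_density \<mu> (expfam \<mu> \<xi> \<theta>)\<close> forces the integral defining the
  log partition function to be finite and positive. The parameter set is taken to be open,
  so that partial derivatives with respect to the parameter make sense on it.\<close>

definition exponential_family ::
  "'a measure \<Rightarrow> ('p::finite \<Rightarrow> 'a \<Rightarrow> real) \<Rightarrow> (real^'p) set \<Rightarrow> bool" where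
  "exponential_family \<mu> \<xi> \<Theta> \<longleftrightarrow>
     (\<forall>i. \<xi> i \<in> borel_measurable \<mu>) \<and> open \<Theta> \<and> (\<forall>\<theta>\<in>\<Theta>. prob_density \<mu> (expfam \<mu> \<xi> \<theta>))"

text \<open>The integrability clause says that the divergences being minimised are finite; without
  it the integral in \<^const>\<open>KL_div\<close> would silently be 0.\<close>

definition information_projection ::
  "'a measure \<Rightarrow> ('p::finite \<Rightarrow> 'a \<Rightarrow> real) \<Rightarrow> (real^'p) set \<Rightarrow> ('a \<Rightarrow> real) \<Rightarrow> real^'p \<Rightarrow> bool" where
  "information_projection \<mu> \<xi> \<Theta> g \<theta>\<^sub>s \<longleftrightarrow>
     (\<forall>\<theta>\<in>\<Theta>. integrable \<mu> (\<lambda>x. g x * ln (g x / expfam \<mu> \<xi> \<theta> x))) \<and>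
     \<theta>\<^sub>s \<in> \<Theta> \<and> (\<forall>\<theta>\<in>\<Theta>. KL_div \<mu> g (expfam \<mu> \<xi> \<theta>\<^sub>s) \<le> KL_div \<mu> g (expfam \<mu> \<xi> \<theta>))"

definition is_mle ::
  "'a measure \<Rightarrow> ('p::finite \<Rightarrow> 'a \<Rightarrow> real) \<Rightarrow> (real^'p) set \<Rightarrow> nat \<Rightarrow> (nat \<Rightarrow> 'a) \<Rightarrow> real^'p \<Rightarrow> bool" where
  "is_mle \<mu> \<xi> \<Theta> n x \<theta> \<longleftrightarrow>
     \<theta> \<in> \<Theta> \<and>
     (\<forall>\<theta>'\<in>\<Theta>. (\<Sum>a<n. ln (expfam \<mu> \<xi> \<theta>' (x a))) \<le> (\<Sum>a<n. ln (expfam \<mu> \<xi> \<theta> (x a))))"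

definition eta_star :: "'a measure \<Rightarrow> ('p::finite \<Rightarrow> 'a \<Rightarrow> real) \<Rightarrow> real^'p \<Rightarrow> 'p \<Rightarrow> real" where
  "eta_star \<mu> \<xi> \<theta>\<^sub>s i = partial_deriv i (log_partition \<mu> \<xi>) \<theta>\<^sub>s"

definition cov_true ::
  "'a measure \<Rightarrow> ('p::finite \<Rightarrow> 'a \<Rightarrow> real) \<Rightarrow> ('a \<Rightarrow> real) \<Rightarrow> real^'p \<Rightarrow> real^'p^'p" where
  "cov_true \<mu> \<xi> g \<theta>\<^sub>s = (\<chi> i j. expect \<mu> g
     (\<lambda>x. (\<xi> i x - eta_star \<mu> \<xi> \<theta>\<^sub>s i) * (\<xi> j x - eta_star \<mu> \<xi> \<theta>\<^sub>s j)))"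

definition cov_model :: "'a measure \<Rightarrow> ('p::finite \<Rightarrow> 'a \<Rightarrow> real) \<Rightarrow> real^'p \<Rightarrow> real^'p^'p" where
  "cov_model \<mu> \<xi> \<theta>\<^sub>s = (\<chi> i j. partial_derivs [i, j] (log_partition \<mu> \<xi>) \<theta>\<^sub>s)"

definition kappa3 ::
  "'a measure \<Rightarrow> ('p::finite \<Rightarrow> 'a \<Rightarrow> real) \<Rightarrow> ('a \<Rightarrow> real) \<Rightarrow> real^'p \<Rightarrow> 'p \<Rightarrow> 'p \<Rightarrow> 'p \<Rightarrow> real" where
  "kappa3 \<mu> \<xi> g \<theta>\<^sub>s i j k = expect \<mu> g
     (\<lambda>x. (\<xi> i x - eta_star \<mu> \<xi> \<theta>\<^sub>s i) * (\<xi> j x - eta_star \<mu> \<xi> \<theta>\<^sub>s j) * (\<xi> k x - eta_star \<mu> \<xi> \<theta>\<^sub>s k))"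

definition kappa3_star ::
  "'a measure \<Rightarrow> ('p::finite \<Rightarrow> 'a \<Rightarrow> real) \<Rightarrow> real^'p \<Rightarrow> 'p \<Rightarrow> 'p \<Rightarrow> 'p \<Rightarrow> real" where
  "kappa3_star \<mu> \<xi> \<theta>\<^sub>s = kappa3 \<mu> \<xi> (expfam \<mu> \<xi> \<theta>\<^sub>s) \<theta>\<^sub>s"

definition kappa4_star ::
  "'a measure \<Rightarrow> ('p::finite \<Rightarrow> 'a \<Rightarrow> real) \<Rightarrow> real^'p \<Rightarrow> 'p \<Rightarrow> 'p \<Rightarrow> 'p \<Rightarrow> 'p \<Rightarrow> real" where
  "kappa4_star \<mu> \<xi> \<theta>\<^sub>s i j k l = partial_derivs [i, j, k, l] (log_partition \<mu> \<xi>) \<theta>\<^sub>s"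

text \<open>The observations are \<open>X 0, X 1, \<dots>\<close> on a probability space \<open>M\<close>, and
  \<open>\<theta>\<^sub>h n\<close> is the maximum likelihood estimator based on the first \<open>n\<close> of them, which is only
  required to exist for large \<open>n\<close>.\<close>

definition estimation_setting ::
  "'a measure \<Rightarrow> ('p::finite \<Rightarrow> 'a \<Rightarrow> real) \<Rightarrow> (real^'p) set \<Rightarrow> ('a \<Rightarrow> real) \<Rightarrow> real^'p \<Rightarrow>
   'w measure \<Rightarrow> (nat \<Rightarrow> 'w \<Rightarrow> 'a) \<Rightarrow> (nat \<Rightarrow> 'w \<Rightarrow> real^'p) \<Rightarrow> bool" where
  "estimation_setting \<mu> \<xi> \<Theta> g \<theta>\<^sub>s M X \<theta>\<^sub>h \<longleftrightarrow>
     exponential_family \<mu> \<xi> \<Theta> \<and>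
     prob_density \<mu> g \<and>
     information_projection \<mu> \<xi> \<Theta> g \<theta>\<^sub>s \<and>
     (\<forall>v. v \<noteq> 0 \<longrightarrow> v \<bullet> (cov_model \<mu> \<xi> \<theta>\<^sub>s *v v) > 0) \<and>
     prob_space M \<and>
     prob_space.indep_vars M (\<lambda>_. \<mu>) X UNIV \<and>
     (\<forall>a. distributed M \<mu> (X a) (\<lambda>x. ennreal (g x))) \<and>
     (\<forall>n. \<theta>\<^sub>h n \<in> borel_measurable M) \<and>
     (\<forall>\<^sub>F n in sequentially. AE \<omega> in M. is_mle \<mu> \<xi> \<Theta> n (\<lambda>a. X a \<omega>) (\<theta>\<^sub>h n \<omega>))"

definition risk ::
  "'a measure \<Rightarrow> ('p::finite \<Rightarrow> 'a \<Rightarrow> real) \<Rightarrow> real^'p \<Rightarrow> 'w measure \<Rightarrow>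
   (nat \<Rightarrow> 'w \<Rightarrow> real^'p) \<Rightarrow> nat \<Rightarrow> real" where
  "risk \<mu> \<xi> \<theta>\<^sub>s M \<theta>\<^sub>h n = (\<integral>\<omega>. KL_div \<mu> (expfam \<mu> \<xi> \<theta>\<^sub>s) (expfam \<mu> \<xi> (\<theta>\<^sub>h n \<omega>)) \<partial>M)"

text \<open>Multi-indices of order \<open>t\<close> are lists of length \<open>t\<close>.\<close>

definition taylor_term ::
  "'a measure \<Rightarrow> ('p::finite \<Rightarrow> 'a \<Rightarrow> real) \<Rightarrow> real^'p \<Rightarrow> 'w measure \<Rightarrow>
   (nat \<Rightarrow> 'w \<Rightarrow> real^'p) \<Rightarrow> nat \<Rightarrow> nat \<Rightarrow> real" where
  "taylor_term \<mu> \<xi> \<theta>\<^sub>s M \<theta>\<^sub>h n t =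
     1 / fact t * (\<Sum>is | length is = t. (- partial_derivs is (log_partition \<mu> \<xi>) \<theta>\<^sub>s) *
       (\<integral>\<omega>. (\<Prod>i\<leftarrow>is. \<theta>\<^sub>h n \<omega> $ i - \<theta>\<^sub>s $ i) \<partial>M))"

definition termwise_expansion ::
  "'a measure \<Rightarrow> ('p::finite \<Rightarrow> 'a \<Rightarrow> real) \<Rightarrow> real^'p \<Rightarrow> 'w measure \<Rightarrow>
   (nat \<Rightarrow> 'w \<Rightarrow> real^'p) \<Rightarrow> bool" where
  "termwise_expansion \<mu> \<xi> \<theta>\<^sub>s M \<theta>\<^sub>h \<longleftrightarrow> (\<forall>\<^sub>F n in sequentially.
     integrable M (\<lambda>\<omega>. KL_div \<mu> (expfam \<mu> \<xi> \<theta>\<^sub>s) (expfam \<mu> \<xi> (\<theta>\<^sub>h n \<omega>))) \<and>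
     (\<forall>is. integrable M (\<lambda>\<omega>. \<Prod>i\<leftarrow>is. \<theta>\<^sub>h n \<omega> $ i - \<theta>\<^sub>s $ i)) \<and>
     summable (\<lambda>t. taylor_term \<mu> \<xi> \<theta>\<^sub>s M \<theta>\<^sub>h n (t + 3)) \<and>
     risk \<mu> \<xi> \<theta>\<^sub>s M \<theta>\<^sub>h n =
       1 / 2 * (\<Sum>(i, j)\<in>UNIV. cov_model \<mu> \<xi> \<theta>\<^sub>s $ i $ j *
         (\<integral>\<omega>. (\<theta>\<^sub>h n \<omega> $ i - \<theta>\<^sub>s $ i) * (\<theta>\<^sub>h n \<omega> $ j - \<theta>\<^sub>s $ j) \<partial>M))
       - (\<Sum>t. taylor_term \<mu> \<xi> \<theta>\<^sub>s M \<theta>\<^sub>h n (t + 3)))"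

definition mean_score ::
  "'a measure \<Rightarrow> ('p::finite \<Rightarrow> 'a \<Rightarrow> real) \<Rightarrow> nat \<Rightarrow> (nat \<Rightarrow> 'a) \<Rightarrow> 'p \<Rightarrow> real^'p \<Rightarrow> real" where
  "mean_score \<mu> \<xi> n x i \<theta> =
     1 / real n * (\<Sum>a<n. partial_deriv i (\<lambda>\<theta>'. ln (expfam \<mu> \<xi> \<theta>' (x a))) \<theta>)"

definition score_taylor_point ::
  "'a measure \<Rightarrow> ('p::finite \<Rightarrow> 'a \<Rightarrow> real) \<Rightarrow> real^'p \<Rightarrow> nat \<Rightarrow> (nat \<Rightarrow> 'a) \<Rightarrow> real^'p \<Rightarrow>
   ('p \<Rightarrow> 'p \<Rightarrow> 'p \<Rightarrow> 'p \<Rightarrow> 'p \<Rightarrow> real^'p) \<Rightarrow> bool" where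
  "score_taylor_point \<mu> \<xi> \<theta>\<^sub>s n x \<theta> \<theta>\<^sub>t \<longleftrightarrow>
     (\<forall>i j k l m. \<theta>\<^sub>t i j k l m \<in> closed_segment \<theta>\<^sub>s \<theta>) \<and>
     (\<forall>i. mean_score \<mu> \<xi> n x i \<theta> =
        (\<Sum>t\<le>3. 1 / fact t * (\<Sum>js | length js = t.
           partial_derivs js (mean_score \<mu> \<xi> n x i) \<theta>\<^sub>s * (\<Prod>j\<leftarrow>js. \<theta> $ j - \<theta>\<^sub>s $ j)))
        + 1 / 24 * (\<Sum>(j, k, l, m)\<in>UNIV.
           partial_derivs [j, k, l, m] (mean_score \<mu> \<xi> n x i) (\<theta>\<^sub>t i j k l m) *
           ((\<theta> $ j - \<theta>\<^sub>s $ j) * (\<theta> $ k - \<theta>\<^sub>s $ k) * (\<theta> $ l - \<theta>\<^sub>s $ l) * (\<theta> $ m - \<theta>\<^sub>s $ m))))"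

datatype 'p moment_index = Par 'p | Score 'p | Remainder 'p 'p 'p 'p 'p

text \<open>In \<^term>\<open>Remainder s j k l m\<close> the first index is the upper one.\<close>

fun moment_var ::
  "'a measure \<Rightarrow> ('p::finite \<Rightarrow> 'a \<Rightarrow> real) \<Rightarrow> real^'p \<Rightarrow> nat \<Rightarrow> (nat \<Rightarrow> 'a) \<Rightarrow> real^'p \<Rightarrow>
   ('p \<Rightarrow> 'p \<Rightarrow> 'p \<Rightarrow> 'p \<Rightarrow> 'p \<Rightarrow> real^'p) \<Rightarrow> 'p moment_index \<Rightarrow> real" where
  "moment_var \<mu> \<xi> \<theta>\<^sub>s n x \<theta> \<theta>\<^sub>t (Par s) = sqrt (real n) * (\<theta> $ s - \<theta>\<^sub>s $ s)"
| "moment_var \<mu> \<xi> \<theta>\<^sub>s n x \<theta> \<theta>\<^sub>t (Score s) =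
     sqrt (real n) * (\<Sum>j\<in>UNIV. matrix_inv (cov_model \<mu> \<xi> \<theta>\<^sub>s) $ s $ j * mean_score \<mu> \<xi> n x j \<theta>\<^sub>s)"
| "moment_var \<mu> \<xi> \<theta>\<^sub>s n x \<theta> \<theta>\<^sub>t (Remainder s j k l m) =
     1 / 24 * (\<Sum>i\<in>UNIV. matrix_inv (cov_model \<mu> \<xi> \<theta>\<^sub>s) $ i $ s *
       partial_derivs [j, k, l, m] (mean_score \<mu> \<xi> n x i) (\<theta>\<^sub>t i j k l m))"

definition moment_condition ::
  "nat \<Rightarrow> 'a measure \<Rightarrow> ('p::finite \<Rightarrow> 'a \<Rightarrow> real) \<Rightarrow> real^'p \<Rightarrow> 'w measure \<Rightarrow> (nat \<Rightarrow> 'w \<Rightarrow> 'a) \<Rightarrow>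
   (nat \<Rightarrow> 'w \<Rightarrow> real^'p) \<Rightarrow> (nat \<Rightarrow> 'w \<Rightarrow> 'p \<Rightarrow> 'p \<Rightarrow> 'p \<Rightarrow> 'p \<Rightarrow> 'p \<Rightarrow> real^'p) \<Rightarrow> bool" where
  "moment_condition K \<mu> \<xi> \<theta>\<^sub>s M X \<theta>\<^sub>h \<theta>\<^sub>t \<longleftrightarrow>
     (\<forall>\<^sub>F n in sequentially. AE \<omega> in M.
        score_taylor_point \<mu> \<xi> \<theta>\<^sub>s n (\<lambda>a. X a \<omega>) (\<theta>\<^sub>h n \<omega>) (\<theta>\<^sub>t n \<omega>)) \<and>
     (\<forall>vs. length vs \<le> K \<longrightarrow> (\<exists>C. \<forall>\<^sub>F n in sequentially.
        integrable M (\<lambda>\<omega>. \<Prod>v\<leftarrow>vs. moment_var \<mu> \<xi> \<theta>\<^sub>s n (\<lambda>a. X a \<omega>) (\<theta>\<^sub>h n \<omega>) (\<theta>\<^sub>t n \<omega>) v) \<and>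
        \<bar>\<integral>\<omega>. (\<Prod>v\<leftarrow>vs. moment_var \<mu> \<xi> \<theta>\<^sub>s n (\<lambda>a. X a \<omega>) (\<theta>\<^sub>h n \<omega>) (\<theta>\<^sub>t n \<omega>) v) \<partial>M\<bar> \<le> C))"

end

theory Submission
  imports Defs
begin

text \<open>Put \<open>h = \<theta>\<^sub>h n - \<theta>\<^sub>s\<close>, let \<open>z\<close> be the mean score at the projection \<open>\<theta>\<^sub>s\<close>, and let \<open>y = H z\<close> where
  \<open>H\<close> is the inverse of the Hessian \<open>G\<close> of the log partition function. The likelihood equation says
  that \<open>z\<close> is the change of the gradient of the log partition function from \<open>\<theta>\<^sub>s\<close> to \<open>\<theta>\<^sub>h n\<close>, so near
  the projection both \<open>y\<close> and the divergence \<open>D\<close> are smooth functions of \<open>h\<close>. Comparing their Taylor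
  expansions gives \<open>D = P y + r y + O(|h|^6)\<close>, where \<open>P\<close> is an explicit polynomial with terms of
  degree two, three and four and \<open>r\<close> is some homogeneous polynomial of degree five
  (\<open>main_part_expansion\<close>).

  The comparison extends to all \<open>h\<close>. By the definition of the estimator the likelihood at
  \<open>\<theta>\<^sub>h n\<close> is at least that at \<open>\<theta>\<^sub>s\<close>, which says \<open>0 \<le> D \<le> h \<bullet> z\<close>. Where \<open>|h|\<close> is bounded below this
  makes every term at most a multiple of \<open>|h|^6 + |y|^6\<close> (\<open>global_remainder\<close>). The moment condition
  with \<open>K = 6\<close> makes the expectation of this bound \<open>O(n\<^sup>-\<^sup>3)\<close>.

  The score \<open>z\<close> is the mean of independent observations which are centred, because \<open>\<theta>\<^sub>s\<close> minimises the
  divergence from \<open>g\<close> over an open set (\<open>information_projection_mean\<close>). Its joint moments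
  follow by adding one observation at a time. Those of degree two and three are the moments of one
  observation divided by \<open>n\<close> and \<open>n\<^sup>2\<close>; those of degree four are the sum over the three pairings of
  covariances divided by \<open>n\<^sup>2\<close>, up to \<open>O(n\<^sup>-\<^sup>3)\<close>; those of degree five are \<open>O(n\<^sup>-\<^sup>3)\<close>
  (\<open>sum_moment_2\<close> to \<open>sum_moment_5\<close>). Inserting them into \<open>P\<close> gives the stated expansion; the
  polynomial \<open>r\<close> disappears in the error.

  The analytic input is that the log partition function is smooth on the open parameter set and
  that its third derivatives are the third central moments of the model
  (\<open>log_partition_smooth\<close>, \<open>kappa3_star_partial_derivs\<close>). Both come from
  differentiating the integrals of monomials against the exponential weight
  (\<open>raw_has_partials\<close>).\<close>

section \<open>Homogeneous polynomials and graded expansions at the origin\<close>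

text \<open>Homogeneous polynomials are generated from monomials, so that moment bounds can be proved for
  monomials and carried over by linearity.\<close>

inductive homogeneous :: "nat \<Rightarrow> (real^'p \<Rightarrow> real) \<Rightarrow> bool" where
  monomial: "homogeneous (length is) (\<lambda>h. c * (\<Prod>i\<leftarrow>is. h $ i))"
| add: "homogeneous k f \<Longrightarrow> homogeneous k g \<Longrightarrow> homogeneous k (\<lambda>h. f h + g h)"

lemma homogeneous_zero: "homogeneous k (\<lambda>h. 0)"
  using homogeneous.monomial[of "replicate k undefined" 0] by simp

lemma homogeneous_sum:
  "(\<And>a. a \<in> A \<Longrightarrow> homogeneous k (f a)) \<Longrightarrow> homogeneous k (\<lambda>h. \<Sum>a\<in>A. f a h)"
  by (induction A rule: infinite_finite_induct) (simp_all add: homogeneous_zero homogeneous.add)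

lemma homogeneous_mult:
  assumes "homogeneous j f" "homogeneous k g"
  shows "homogeneous (j + k) (\<lambda>h. f h * g h)"
  using assms(1)
proof induction
  case (monomial "is" c)
  from assms(2) show ?case
  proof induction
    case (monomial js d)
    show ?case
      using homogeneous.monomial[of "is @ js" "c * d"] by (simp add: algebra_simps)
  next
    case (add k f g)
    then show ?case using homogeneous.add[OF add.IH] by (simp add: algebra_simps)
  qed
next
  case (add k f g)
  then show ?case using homogeneous.add[OF add.IH] by (simp add: algebra_simps)
qed

lemma homogeneous_const: "homogeneous 0 (\<lambda>h. c)"
  using homogeneous.monomial[of "[]" c] by simp

lemma homogeneous_cmult: "homogeneous k f \<Longrightarrow> homogeneous k (\<lambda>h. c * f h)"
  using homogeneous_mult[OF homogeneous_const[of c], of k f] by simp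

lemma homogeneous_coord: "homogeneous 1 (\<lambda>h. h $ i)"
  using homogeneous.monomial[of "[i]" 1] by simp

lemma homogeneous_coord_products:
  "homogeneous 2 (\<lambda>h. h $ i * h $ j)"
  "homogeneous 3 (\<lambda>h. h $ i * h $ j * h $ k)"
  "homogeneous 4 (\<lambda>h. h $ i * h $ j * h $ k * h $ l)"
  using homogeneous.monomial[of "[i, j]" 1] homogeneous.monomial[of "[i, j, k]" 1]
    homogeneous.monomial[of "[i, j, k, l]" 1]
  by (simp_all add: eval_nat_numeral mult.assoc)

lemma homogeneous_bound:
  "homogeneous k f \<Longrightarrow> \<exists>C\<ge>0. \<forall>h. \<bar>f h\<bar> \<le> C * norm h ^ k"
proof (induction rule: homogeneous.induct)
  case (monomial "is" c)
  have "\<bar>\<Prod>i\<leftarrow>is. h $ i\<bar> \<le> norm h ^ length is" for h :: "real^'a"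
    by (induction "is") (auto simp: abs_mult intro!: mult_mono component_le_norm_cart)
  then show ?case
    by (intro exI[of _ "\<bar>c\<bar>"]) (auto simp: abs_mult intro!: mult_left_mono)
next
  case (add k f g)
  then obtain C C' where "C \<ge> 0" "C' \<ge> 0" "\<And>h. \<bar>f h\<bar> \<le> C * norm h ^ k" "\<And>h. \<bar>g h\<bar> \<le> C' * norm h ^ k"
    by blast
  then show ?case
    by (intro exI[of _ "C + C'"]) (auto simp: distrib_right intro: order.trans[OF abs_triangle_ineq] add_mono)
qed

text \<open>The filter is the full neighbourhood filter, so the bound includes the origin itself; the
  maximum likelihood estimate may well coincide with the projection.\<close>

abbreviation vanishing :: "nat \<Rightarrow> ('a::real_normed_vector \<Rightarrow> real) \<Rightarrow> bool" where
  "vanishing k f \<equiv> f \<in> O[nhds 0](\<lambda>h. norm h ^ k)"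

lemma homogeneous_vanishing: "homogeneous k f \<Longrightarrow> vanishing k f"
proof -
  assume "homogeneous k f"
  then obtain C where "\<And>h. \<bar>f h\<bar> \<le> C * norm h ^ k" using homogeneous_bound by blast
  then show ?thesis by (intro bigoI[of _ C] always_eventually allI) simp
qed

lemma vanishing_mono:
  fixes f :: "'a::real_normed_vector \<Rightarrow> real"
  assumes "k \<le> m" "vanishing m f"
  shows "vanishing k f"
proof (rule landau_o.big.trans[OF assms(2)])
  have "eventually (\<lambda>h::'a. norm h < 1) (nhds 0)"
    using eventually_nhds_ball[of 1 "0::'a"] by simp
  then show "(\<lambda>h::'a. norm h ^ m) \<in> O[nhds 0](\<lambda>h. norm h ^ k)"
    by (intro bigoI[of _ 1], elim eventually_mono) (simp add: power_decreasing assms)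
qed

lemma vanishing_mult:
  fixes f g :: "'a::real_normed_vector \<Rightarrow> real"
  shows "vanishing j f \<Longrightarrow> vanishing k g \<Longrightarrow> vanishing (j + k) (\<lambda>h. f h * g h)"
  using landau_o.big.mult[of f "nhds 0" "\<lambda>h. norm h ^ j" g "\<lambda>h. norm h ^ k"] by (simp add: power_add)

text \<open>Functions with a homogeneous leading term of degree \<open>k\<close>, possibly zero, and an error of
  the next order. Terms of degree five never have to be computed: their mean is already negligible
  because the leading term is a polynomial, and odd moments gain an additional half power of the
  sample size. The grading is what records that a leading polynomial exists.\<close>

definition graded :: "nat \<Rightarrow> (real^'p \<Rightarrow> real) \<Rightarrow> bool" where
  "graded k f \<longleftrightarrow> (\<exists>r. homogeneous k r \<and> vanishing (Suc k) (\<lambda>h. f h - r h))"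

lemma graded_vanishing: "graded k f \<Longrightarrow> vanishing k f"
proof -
  assume "graded k f"
  then obtain r where r: "homogeneous k r" "vanishing (Suc k) (\<lambda>h. f h - r h)"
    by (auto simp: graded_def)
  have "vanishing k (\<lambda>h. r h + (f h - r h))"
    by (intro sum_in_bigo homogeneous_vanishing[OF r(1)] vanishing_mono[OF _ r(2)]) simp
  then show ?thesis by simp
qed

lemma homogeneous_graded: "homogeneous k f \<Longrightarrow> graded k f"
  unfolding graded_def by (intro exI[of _ f]) auto

lemma vanishing_graded: "vanishing (Suc k) f \<Longrightarrow> graded k f"
  unfolding graded_def by (intro exI[of _ "\<lambda>_. 0"]) (auto intro: homogeneous_zero)

lemma graded_mono: "k \<le> m \<Longrightarrow> graded m f \<Longrightarrow> graded k f"
  by (cases "k = m") (simp, rule vanishing_graded, rule vanishing_mono[OF _ graded_vanishing, of _ m], simp_all)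

lemma graded_add: "graded k f \<Longrightarrow> graded k g \<Longrightarrow> graded k (\<lambda>h. f h + g h)"
proof -
  assume "graded k f" "graded k g"
  then obtain r s where "homogeneous k r" "vanishing (Suc k) (\<lambda>h. f h - r h)"
     "homogeneous k s" "vanishing (Suc k) (\<lambda>h. g h - s h)"
    by (auto simp: graded_def)
  then show ?thesis unfolding graded_def
    using sum_in_bigo(1)[of "\<lambda>h. f h - r h" "nhds 0" _ "\<lambda>h. g h - s h"]
    by (intro exI[of _ "\<lambda>h. r h + s h"] conjI homogeneous.add) (auto simp: algebra_simps)
qed

lemma graded_mult: "graded j f \<Longrightarrow> graded k g \<Longrightarrow> graded (j + k) (\<lambda>h. f h * g h)"
proof -
  assume f: "graded j f" and g: "graded k g"
  then obtain r s where r: "homogeneous j r" "vanishing (Suc j) (\<lambda>h. f h - r h)"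
     and s: "homogeneous k s" "vanishing (Suc k) (\<lambda>h. g h - s h)"
    by (auto simp: graded_def)
  have "vanishing (Suc (j + k)) (\<lambda>h. (f h - r h) * g h)"
    using vanishing_mult[OF r(2) graded_vanishing[OF g]] by simp
  moreover have "vanishing (Suc (j + k)) (\<lambda>h. r h * (g h - s h))"
    using vanishing_mult[OF homogeneous_vanishing[OF r(1)] s(2)] by simp
  ultimately have "vanishing (Suc (j + k)) (\<lambda>h. (f h - r h) * g h + r h * (g h - s h))"
    by (rule sum_in_bigo)
  then show ?thesis unfolding graded_def
    by (intro exI[of _ "\<lambda>h. r h * s h"] conjI homogeneous_mult r s) (simp add: algebra_simps)
qed

lemma graded_cmult: "graded k f \<Longrightarrow> graded k (\<lambda>h. c * f h)"
  using graded_mult[OF homogeneous_graded[OF homogeneous_const[of c]], of k f] by simp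

lemma graded_minus: "graded k f \<Longrightarrow> graded k (\<lambda>h. - f h)"
  using graded_cmult[of k f "-1"] by simp

lemma graded_diff: "graded k f \<Longrightarrow> graded k g \<Longrightarrow> graded k (\<lambda>h. f h - g h)"
  using graded_add[OF _ graded_minus, of k f g] by simp

lemma graded_sum: "(\<And>a. a \<in> A \<Longrightarrow> graded k (f a)) \<Longrightarrow> graded k (\<lambda>h. \<Sum>a\<in>A. f a h)"
  by (induction A rule: infinite_finite_induct)
    (simp_all add: graded_add homogeneous_graded homogeneous_zero)

text \<open>Replacing the argument by one that agrees with it to first order changes a homogeneous
  polynomial only in higher degree. This lets expansions in the parameter error be restated in the
  rescaled score, so that the expansion of the estimator in the score never has to be inverted.\<close>

lemma homogeneous_perturb:
  fixes y :: "real^'p \<Rightarrow> real^'p"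
  assumes y: "\<And>i. graded 2 (\<lambda>h. y h $ i - h $ i)" and f: "homogeneous k f"
  shows "graded (Suc k) (\<lambda>h. f (y h) - f h)"
  using f
proof induction
  case (monomial "is" c)
  have y1: "graded 1 (\<lambda>h. y h $ i)" for i
    using graded_add[OF graded_mono[OF _ y, of 1] homogeneous_graded[OF homogeneous_coord], of i i] by simp
  have prod: "graded (length is) (\<lambda>h. \<Prod>i\<leftarrow>is. y h $ i)" for "is"
  proof (induction "is")
    case (Cons i "is")
    then show ?case using graded_mult[OF y1 Cons.IH] by simp
  qed (simp add: homogeneous_graded homogeneous_const)
  have "graded (Suc (length is)) (\<lambda>h. (\<Prod>i\<leftarrow>is. y h $ i) - (\<Prod>i\<leftarrow>is. h $ i))"
  proof (induction "is")
    case Nil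
    show ?case by (simp add: homogeneous_graded homogeneous_zero)
  next
    case (Cons i "is")
    have "graded (Suc (length (i # is))) (\<lambda>h. (y h $ i - h $ i) * (\<Prod>i\<leftarrow>is. y h $ i)
        + h $ i * ((\<Prod>i\<leftarrow>is. y h $ i) - (\<Prod>i\<leftarrow>is. h $ i)))"
      using graded_mult[OF y prod] graded_mult[OF homogeneous_graded[OF homogeneous_coord] Cons.IH]
      by (intro graded_add) auto
    then show ?case by (simp add: algebra_simps)
  qed
  from graded_cmult[OF this, of c] show ?case by (simp add: algebra_simps)
next
  case (add k f g)
  then show ?case using graded_add[OF add.IH] by (simp add: algebra_simps)
qed

section \<open>The divergence as a polynomial in the rescaled score\<close>

text \<open>\<open>G\<close>, \<open>t3\<close> and \<open>t4\<close> stand for the second, third and fourth derivatives of the log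
  partition function at the projection, and \<open>H\<close> for the inverse of \<open>G\<close>.\<close>

locale divergence_expansion =
  fixes G H :: "real^'p^'p" and t3 :: "'p \<Rightarrow> 'p \<Rightarrow> 'p \<Rightarrow> real" and t4 :: "'p \<Rightarrow> 'p \<Rightarrow> 'p \<Rightarrow> 'p \<Rightarrow> real"
  assumes HG: "H ** G = mat 1" and GH: "G ** H = mat 1"
    and G_sym: "G $ i $ j = G $ j $ i"
    and t3_sym: "t3 i j k = t3 j i k" "t3 i j k = t3 i k j"
begin

definition form2 :: "real^'p \<Rightarrow> real^'p \<Rightarrow> real" where
  "form2 a b = (\<Sum>i\<in>UNIV. \<Sum>j\<in>UNIV. G $ i $ j * (a $ i * b $ j))"

definition form3 :: "real^'p \<Rightarrow> real^'p \<Rightarrow> real^'p \<Rightarrow> real" where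
  "form3 a b c = (\<Sum>i\<in>UNIV. \<Sum>j\<in>UNIV. \<Sum>k\<in>UNIV. t3 i j k * (a $ i * b $ j * c $ k))"

definition form4 :: "real^'p \<Rightarrow> real" where
  "form4 a = (\<Sum>i\<in>UNIV. \<Sum>j\<in>UNIV. \<Sum>k\<in>UNIV. \<Sum>l\<in>UNIV. t4 i j k l * (a $ i * a $ j * a $ k * a $ l))"

text \<open>Together with \<open>grad4\<close> below: up to the factors 2 and 6, the quadratic and cubic terms in the
  expansion of the gradient of the log partition function.\<close>

definition grad3 :: "real^'p \<Rightarrow> real^'p" where
  "grad3 a = (\<chi> i. \<Sum>j\<in>UNIV. \<Sum>k\<in>UNIV. t3 j k i * (a $ j * a $ k))"

definition grad4 :: "real^'p \<Rightarrow> real^'p" where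
  "grad4 a = (\<chi> i. \<Sum>j\<in>UNIV. \<Sum>k\<in>UNIV. \<Sum>l\<in>UNIV. t4 j k l i * (a $ j * a $ k * a $ l))"

definition grad3_sq :: "real^'p \<Rightarrow> real" where
  "grad3_sq a = (\<Sum>i\<in>UNIV. \<Sum>j\<in>UNIV. H $ i $ j * (grad3 a $ i * grad3 a $ j))"

text \<open>The divergence as a function of the rescaled score \<open>y\<close>, through degree four.\<close>

definition main_part :: "real^'p \<Rightarrow> real" where
  "main_part y = 1/2 * form2 y y - 1/3 * form3 y y y + 3/8 * grad3_sq y - 1/8 * form4 y"

lemma form2_inner: "form2 a b = a \<bullet> (G *v b)"
  by (simp add: form2_def inner_vec_def matrix_vector_mult_def sum_distrib_left mult_ac)

lemma grad3_sq_inner: "grad3_sq a = grad3 a \<bullet> (H *v grad3 a)"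
  by (simp add: grad3_sq_def inner_vec_def matrix_vector_mult_def sum_distrib_left mult_ac)

lemma form2_graded:
  assumes "\<And>i. graded j (\<lambda>h. a h $ i)" "\<And>i. graded k (\<lambda>h. b h $ i)"
  shows "graded (j + k) (\<lambda>h. form2 (a h) (b h))"
  unfolding form2_def by (intro graded_sum graded_cmult graded_mult assms)

lemma form3_graded:
  assumes "\<And>i. graded j (\<lambda>h. a h $ i)" "\<And>i. graded k (\<lambda>h. b h $ i)" "\<And>i. graded l (\<lambda>h. c h $ i)"
  shows "graded (j + k + l) (\<lambda>h. form3 (a h) (b h) (c h))"
  unfolding form3_def by (intro graded_sum graded_cmult graded_mult assms)

lemma form3_add:
  "form3 (a + a') b c = form3 a b c + form3 a' b c"
  "form3 a (b + b') c = form3 a b c + form3 a b' c"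
  "form3 a b (c + c') = form3 a b c + form3 a b c'"
  by (simp_all add: form3_def algebra_simps sum.distrib)

lemma form4_grad4: "form4 a = a \<bullet> grad4 a"
proof -
  have "a \<bullet> grad4 a = (\<Sum>l\<in>UNIV. \<Sum>i\<in>UNIV. \<Sum>j\<in>UNIV. \<Sum>k\<in>UNIV. t4 i j k l * (a $ i * a $ j * a $ k * a $ l))"
    by (simp add: grad4_def inner_vec_def sum_distrib_left mult_ac)
  also have "\<dots> = (\<Sum>i\<in>UNIV. \<Sum>l\<in>UNIV. \<Sum>j\<in>UNIV. \<Sum>k\<in>UNIV. t4 i j k l * (a $ i * a $ j * a $ k * a $ l))"
    by (rule sum.swap)
  also have "\<dots> = (\<Sum>i\<in>UNIV. \<Sum>j\<in>UNIV. \<Sum>l\<in>UNIV. \<Sum>k\<in>UNIV. t4 i j k l * (a $ i * a $ j * a $ k * a $ l))"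
    by (rule sum.cong[OF refl], rule sum.swap)
  also have "\<dots> = form4 a"
    unfolding form4_def by (rule sum.cong[OF refl], rule sum.cong[OF refl], rule sum.swap)
  finally show ?thesis by simp
qed

lemma form3_grad3: "form3 a a b = b \<bullet> grad3 a"
proof -
  have "b \<bullet> grad3 a = (\<Sum>k\<in>UNIV. \<Sum>i\<in>UNIV. \<Sum>j\<in>UNIV. t3 i j k * (a $ i * a $ j * b $ k))"
    by (simp add: grad3_def inner_vec_def sum_distrib_left mult_ac)
  also have "\<dots> = (\<Sum>i\<in>UNIV. \<Sum>k\<in>UNIV. \<Sum>j\<in>UNIV. t3 i j k * (a $ i * a $ j * b $ k))"
    by (rule sum.swap)
  also have "\<dots> = form3 a a b"
    unfolding form3_def by (rule sum.cong[OF refl], rule sum.swap)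
  finally show ?thesis by simp
qed

lemma grad3_homogeneous: "homogeneous 2 (\<lambda>h. grad3 h $ i)"
  unfolding grad3_def vec_lambda_beta by (intro homogeneous_sum homogeneous_cmult homogeneous_coord_products)

lemma grad4_homogeneous: "homogeneous 3 (\<lambda>h. grad4 h $ i)"
  unfolding grad4_def vec_lambda_beta by (intro homogeneous_sum homogeneous_cmult homogeneous_coord_products)

lemma matrix_mult_homogeneous:
  "(\<And>i. homogeneous k (\<lambda>h. v h $ i)) \<Longrightarrow> homogeneous k (\<lambda>h. (A *v v h) $ i)"
  by (auto simp: matrix_vector_mult_def intro!: homogeneous_sum homogeneous_cmult)

lemma grad3_sq_homogeneous: "homogeneous 4 grad3_sq"
proof -
  have "homogeneous 4 (\<lambda>h. grad3 h $ j * grad3 h $ k)" for j k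
    using homogeneous_mult[OF grad3_homogeneous grad3_homogeneous] by simp
  then show ?thesis
    unfolding grad3_sq_def[abs_def] by (auto intro!: homogeneous_sum homogeneous_cmult)
qed

lemma form4_homogeneous: "homogeneous 4 form4"
  unfolding form4_def[abs_def] by (intro homogeneous_sum homogeneous_cmult homogeneous_coord_products)

text \<open>Write \<open>y = h + u + w\<close> with \<open>u\<close> quadratic in \<open>h\<close> and \<open>w\<close> of degree three. Expanding the main
  part in \<open>h\<close>, the quadratic form produces half the cubic form and an eighth of the squared
  quadratic gradient; the coefficients \<open>-1/3\<close>, \<open>3/8\<close> and \<open>-1/8\<close> are those that turn the cubic
  coefficient into \<open>1/6\<close>, cancel the squared gradient (\<open>1/8 - 1/2 + 3/8 = 0\<close>) and turn the
  quartic coefficient into \<open>1/24\<close>. Everything else has degree at least five.\<close>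

theorem main_part_expansion:
  fixes z :: "real^'p \<Rightarrow> real^'p" and D :: "real^'p \<Rightarrow> real"
  assumes z: "\<And>i. graded 4 (\<lambda>h. z h $ i - ((G *v h) $ i + 1/2 * grad3 h $ i + 1/6 * grad4 h $ i))"
    and D: "graded 5 (\<lambda>h. D h - (1/2 * form2 h h + 1/6 * form3 h h h + 1/24 * form4 h))"
  shows "\<And>i. graded 2 (\<lambda>h. (H *v z h) $ i - h $ i)"
    and "graded 5 (\<lambda>h. D h - main_part (H *v z h))"
proof -
  define y where "y h = H *v z h" for h
  define T where "T h = H *v grad3 h" for h
  define Q where "Q h = H *v grad4 h" for h
  define u where "u h = (1/2) *\<^sub>R T h" for h
  define w where "w h = y h - h - u h" for h
  define r where "r h = y h - h - u h - (1/6) *\<^sub>R Q h" for h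
  have HGv: "H *v (G *v v) = v" and GHv: "G *v (H *v v) = v" for v
    by (simp_all add: matrix_vector_mul_assoc HG GH)
  have r_eq: "r h $ i = (\<Sum>j\<in>UNIV. H $ i $ j *
      (z h $ j - ((G *v h) $ j + 1/2 * grad3 h $ j + 1/6 * grad4 h $ j)))" for h i
  proof -
    have "r h = H *v (z h - (G *v h + (1/2) *\<^sub>R grad3 h + (1/6) *\<^sub>R grad4 h))"
      by (simp add: r_def y_def u_def T_def Q_def HGv matrix_vector_mult_diff_distrib
        matrix_vector_right_distrib matrix_vector_mult_scaleR algebra_simps)
    then show ?thesis by (simp add: matrix_vector_mult_def)
  qed
  have h_g: "graded 1 (\<lambda>h. h $ i)" for i :: 'p
    by (intro homogeneous_graded homogeneous_coord)
  have T_g: "graded 2 (\<lambda>h. T h $ i)" for i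
    unfolding T_def by (intro homogeneous_graded matrix_mult_homogeneous grad3_homogeneous)
  have Q_g: "graded 3 (\<lambda>h. Q h $ i)" for i
    unfolding Q_def by (intro homogeneous_graded matrix_mult_homogeneous grad4_homogeneous)
  have r_g: "graded 4 (\<lambda>h. r h $ i)" for i
    unfolding r_eq by (intro graded_sum graded_cmult z)
  have u_g: "graded 2 (\<lambda>h. u h $ i)" for i
    using graded_cmult[OF T_g, of "1/2"] by (simp add: u_def)
  have w_eq: "w h = (1/6) *\<^sub>R Q h + r h" for h
    by (simp add: w_def r_def)
  have w_g: "graded 3 (\<lambda>h. w h $ i)" for i
    using graded_add[OF graded_cmult[OF Q_g, of "1/6"] graded_mono[OF _ r_g, of 3]] by (simp add: w_eq)
  \<comment> \<open>The cubic form is expanded around \<open>h\<close> with the total correction \<open>v\<close>, since only the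
    part of its linear term that comes from \<open>u\<close> has degree below five.\<close>
  define v where "v h = u h + w h" for h
  have v_g: "graded 2 (\<lambda>h. v h $ i)" for i
    using graded_add[OF u_g graded_mono[OF _ w_g, of 2]] by (simp add: v_def)
  have y_v: "y h = h + v h" for h
    by (simp add: v_def w_def)
  show y_g: "graded 2 (\<lambda>h. (H *v z h) $ i - h $ i)" for i
    using v_g[of i] unfolding y_def[symmetric] y_v by simp
  have f2_sym: "form2 a b = form2 b a" for a b
    proof -
    have "form2 a b = (\<Sum>j\<in>UNIV. \<Sum>i\<in>UNIV. G $ i $ j * (a $ i * b $ j))"
      unfolding form2_def by (rule sum.swap)
    also have "\<dots> = form2 b a"
      unfolding form2_def by (intro sum.cong refl, subst G_sym) simp
    finally show ?thesis .
  qed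
  have f2_add: "form2 (a + b) c = form2 a c + form2 b c" "form2 c (a + b) = form2 c a + form2 c b"
    "form2 (x *\<^sub>R a) c = x * form2 a c" "form2 c (x *\<^sub>R a) = x * form2 c a" for a b c x
    by (simp_all add: form2_inner inner_left_distrib inner_right_distrib matrix_vector_right_distrib
        matrix_vector_mult_scaleR)
  have hT: "form2 a (T h) = a \<bullet> grad3 h" and hQ: "form2 a (Q h) = a \<bullet> grad4 h" for a h
    by (simp_all add: form2_inner T_def Q_def GHv)
  have TT: "form2 (T h) (T h) = grad3_sq h" for h
    by (simp only: hT grad3_sq_inner) (simp add: T_def inner_commute)
  have part2: "1/2 * form2 (y h) (y h) = 1/2 * form2 h h + 1/2 * form3 h h h + 1/6 * form4 h + 1/8 * grad3_sq h
      + (form2 h (r h) + form2 (u h) (w h) + 1/2 * form2 (w h) (w h))" for h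
  proof -
    have "form2 h (u h) = 1/2 * form3 h h h"
      by (simp add: u_def f2_add hT form3_grad3)
    moreover have "form2 h (w h) = 1/6 * form4 h + form2 h (r h)"
      by (simp add: w_eq f2_add hQ form4_grad4)
    moreover have "form2 (u h) (u h) = 1/4 * grad3_sq h"
      by (simp add: u_def f2_add TT)
    moreover have "form2 (y h) (y h) = form2 h h + 2 * form2 h (u h) + 2 * form2 h (w h)
        + form2 (u h) (u h) + 2 * form2 (u h) (w h) + form2 (w h) (w h)"
      unfolding y_v v_def by (simp add: f2_add f2_sym[of "u h" h] f2_sym[of "w h" h] f2_sym[of "w h" "u h"])
    ultimately show ?thesis by (simp only:) (simp add: algebra_simps)
  qed
  have f3_sym1: "form3 a b c = form3 b a c" for a b c
    proof -
    have "form3 a b c = (\<Sum>j\<in>UNIV. \<Sum>i\<in>UNIV. \<Sum>k\<in>UNIV. t3 i j k * (a $ i * b $ j * c $ k))"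
      unfolding form3_def by (rule sum.swap)
    also have "\<dots> = form3 b a c"
      unfolding form3_def by (intro sum.cong refl, subst t3_sym(1)) simp
    finally show ?thesis .
  qed
  have f3_sym2: "form3 a b c = form3 a c b" for a b c
    proof -
    have "form3 a b c = (\<Sum>i\<in>UNIV. \<Sum>k\<in>UNIV. \<Sum>j\<in>UNIV. t3 i j k * (a $ i * b $ j * c $ k))"
      unfolding form3_def by (rule sum.cong[OF refl], rule sum.swap)
    also have "\<dots> = form3 a c b"
      unfolding form3_def by (intro sum.cong refl, subst t3_sym(2)) simp
    finally show ?thesis .
  qed
  have part3: "form3 (y h) (y h) (y h) = form3 h h h + 3/2 * grad3_sq h
      + (3 * form3 h h (w h) + 3 * form3 h (v h) (v h) + form3 (v h) (v h) (v h))" for h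
  proof -
    have hhu: "form3 h h (u h) = 1/2 * grad3_sq h"
      by (simp add: form3_grad3 hT[symmetric] u_def f2_add TT)
    have "form3 h h (v h) = form3 h h (u h) + form3 h h (w h)"
      by (simp add: v_def form3_add)
    moreover have "form3 (y h) (y h) (y h) = form3 h h h + 3 * form3 h h (v h)
        + 3 * form3 h (v h) (v h) + form3 (v h) (v h) (v h)"
    proof -
      have "form3 h (v h) h = form3 h h (v h)" "form3 (v h) h h = form3 h h (v h)"
        "form3 (v h) h (v h) = form3 h (v h) (v h)" "form3 (v h) (v h) h = form3 h (v h) (v h)"
        by (simp_all only: f3_sym2[of h "v h" h] f3_sym1[of "v h" h h] f3_sym1[of "v h" h "v h"]
            f3_sym2[of "v h" "v h" h])
      then show ?thesis unfolding y_v by (simp add: form3_add)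
    qed
    ultimately show ?thesis by (simp add: hhu)
  qed
  have perturb: "graded 5 (\<lambda>h. f (y h) - f h)" if "homogeneous 4 f" for f
    using homogeneous_perturb[OF _ that, of y] y_g unfolding y_def by simp
  have "graded 5 (\<lambda>h. (D h - (1/2 * form2 h h + 1/6 * form3 h h h + 1/24 * form4 h))
      - (form2 h (r h) + form2 (u h) (w h) + 1/2 * form2 (w h) (w h))
      + 1/3 * (3 * form3 h h (w h) + 3 * form3 h (v h) (v h) + form3 (v h) (v h) (v h))
      - 3/8 * (grad3_sq (y h) - grad3_sq h) + 1/8 * (form4 (y h) - form4 h))"
  proof (intro D perturb[OF grad3_sq_homogeneous] perturb[OF form4_homogeneous]
      graded_add graded_diff graded_cmult)
    show "graded 5 (\<lambda>h. form2 h (r h))"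
      using form2_graded[OF h_g r_g] by simp
    show "graded 5 (\<lambda>h. form2 (u h) (w h))"
      using form2_graded[OF u_g w_g] by simp
    show "graded 5 (\<lambda>h. form2 (w h) (w h))"
      by (rule graded_mono[OF _ form2_graded[OF w_g w_g]]) simp
    show "graded 5 (\<lambda>h. form3 h h (w h))"
      using form3_graded[OF h_g h_g w_g] by simp
    show "graded 5 (\<lambda>h. form3 h (v h) (v h))"
      using form3_graded[OF h_g v_g v_g] by (simp add: eval_nat_numeral)
    show "graded 5 (\<lambda>h. form3 (v h) (v h) (v h))"
      by (rule graded_mono[OF _ form3_graded[OF v_g v_g v_g]]) simp
  qed
  then show "graded 5 (\<lambda>h. D h - main_part (H *v z h))"
    unfolding y_def[symmetric] main_part_def part2 part3 by (rule back_subst[of "graded 5"]) (simp add: fun_eq_iff algebra_simps)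
qed

end

section \<open>Iterated partial derivatives and Taylor expansion\<close>

lemma sum_lists_length_0: "(\<Sum>is | length is = 0. f is) = f []"
proof -
  have "{is. length is = 0} = {[]}" by auto
  then show ?thesis by simp
qed

lemma sum_lists_length_Suc:
  fixes f :: "'p::finite list \<Rightarrow> 'b::comm_monoid_add"
  shows "(\<Sum>is | length is = Suc k. f is) = (\<Sum>i\<in>UNIV. \<Sum>is | length is = k. f (i # is))"
proof -
  have eq: "{is :: 'p list. length is = Suc k} = (\<lambda>(i, is). i # is) ` (UNIV \<times> {is. length is = k})"
    by (auto simp: length_Suc_conv image_iff)
  show ?thesis
    unfolding eq sum.cartesian_product
    by (subst sum.reindex) (auto simp: inj_on_def intro!: sum.cong)
qed

definition has_partials :: "(real^'p \<Rightarrow> real) \<Rightarrow> ('p \<Rightarrow> real) \<Rightarrow> real^'p \<Rightarrow> bool" where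
  "has_partials f d \<theta> \<longleftrightarrow> (f has_derivative (\<lambda>h. \<Sum>j\<in>UNIV. h $ j * d j)) (at \<theta>)"

lemma has_partials_along_line:
  assumes "has_partials f d (\<theta> + t *\<^sub>R h)"
  shows "((\<lambda>t. f (\<theta> + t *\<^sub>R h)) has_field_derivative (\<Sum>j\<in>UNIV. h $ j * d j)) (at t)"
proof -
  have "((\<lambda>t. \<theta> + t *\<^sub>R h) has_derivative (\<lambda>s. s *\<^sub>R h)) (at t)"
    by (auto intro!: derivative_eq_intros)
  from has_derivative_compose[OF this assms[unfolded has_partials_def]] show ?thesis
    by (rule has_derivative_imp_has_field_derivative) (simp add: sum_distrib_left mult_ac)
qed

lemma has_partials_partial_deriv:
  assumes "has_partials f d \<theta>"
  shows "partial_deriv i f \<theta> = d i"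
proof -
  have "((\<lambda>t. f (\<theta> + t *\<^sub>R axis i 1)) has_field_derivative (\<Sum>j\<in>UNIV. axis i 1 $ j * d j)) (at 0)"
    by (rule has_partials_along_line) (simp add: assms)
  moreover have "(\<Sum>j\<in>UNIV. axis i 1 $ j * d j) = d i"
    by (simp add: axis_def if_distrib[of "\<lambda>x. x * _"] cong: if_cong)
  ultimately show ?thesis
    unfolding partial_deriv_def by (simp add: DERIV_imp_deriv)
qed

lemma has_partials_cong_open:
  assumes "open S" "\<theta> \<in> S" "\<And>\<theta>. \<theta> \<in> S \<Longrightarrow> f \<theta> = g \<theta>" "has_partials f d \<theta>"
  shows "has_partials g d \<theta>"
  using assms(4) unfolding has_partials_def
  by (rule has_derivative_transform_within_open[OF _ assms(1,2)]) (simp add: assms(3))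

text \<open>Smoothness is phrased through iterated partial derivatives, the form in which the cumulants
  are given; total differentiability at each stage is what makes derivatives along lines available.\<close>

definition smooth_on :: "(real^'p::finite) set \<Rightarrow> (real^'p \<Rightarrow> real) \<Rightarrow> bool" where
  "smooth_on S f \<longleftrightarrow>
    (\<forall>is. \<forall>\<theta>\<in>S. has_partials (partial_derivs is f) (\<lambda>j. partial_derivs (j # is) f \<theta>) \<theta>)"

lemma partial_derivs_append: "partial_derivs (is @ js) f = partial_derivs is (partial_derivs js f)"
  by (induction "is") auto

lemma smooth_on_partial_derivs: "smooth_on S f \<Longrightarrow> smooth_on S (partial_derivs js f)"
  unfolding smooth_on_def
proof (intro allI ballI)
  fix "is" \<theta>
  assume f: "\<forall>is. \<forall>\<theta>\<in>S. has_partials (partial_derivs is f) (\<lambda>j. partial_derivs (j # is) f \<theta>) \<theta>" "\<theta> \<in> S"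
  show "has_partials (partial_derivs is (partial_derivs js f))
      (\<lambda>j. partial_derivs (j # is) (partial_derivs js f) \<theta>) \<theta>"
    using f(1)[rule_format, OF f(2), of "is @ js"] by (simp add: partial_derivs_append)
qed

text \<open>Taylor's theorem along the segment from \<open>\<theta>\<close> to \<open>\<theta> + h\<close>; the constant does not depend on \<open>h\<close>
  because the derivatives of order \<open>n\<close> are bounded on a compact ball around \<open>\<theta>\<close>.\<close>

lemma smooth_on_taylor:
  fixes f :: "real^'p::finite \<Rightarrow> real"
  assumes "open S" "\<theta> \<in> S" "smooth_on S f" "0 < n"
  shows "vanishing n (\<lambda>h. f (\<theta> + h) -
    (\<Sum>k<n. (\<Sum>is | length is = k. partial_derivs is f \<theta> * (\<Prod>i\<leftarrow>is. h $ i)) / fact k))"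
proof -
  obtain \<delta> where \<delta>: "\<delta> > 0" "cball \<theta> \<delta> \<subseteq> S"
    using assms(1,2) open_contains_cball by blast
  have deriv: "has_partials (partial_derivs is f) (\<lambda>j. partial_derivs (j # is) f \<theta>') \<theta>'"
    if "\<theta>' \<in> cball \<theta> \<delta>" for "is" \<theta>'
    using assms(3) that \<delta>(2) unfolding smooth_on_def by blast
  have "\<exists>B. \<forall>\<theta>'\<in>cball \<theta> \<delta>. \<bar>partial_derivs is f \<theta>'\<bar> \<le> B" for "is"
  proof -
    have "continuous_on (cball \<theta> \<delta>) (partial_derivs is f)"
      using deriv[of _ "is"] unfolding has_partials_def
      by (intro continuous_at_imp_continuous_on ballI has_derivative_continuous) blast
    then have "compact (partial_derivs is f ` cball \<theta> \<delta>)"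
      by (rule compact_continuous_image) simp
    then show ?thesis
      by (auto dest!: compact_imp_bounded simp: bounded_iff)
  qed
  then obtain B where B: "\<And>is \<theta>'. \<theta>' \<in> cball \<theta> \<delta> \<Longrightarrow> \<bar>partial_derivs is f \<theta>'\<bar> \<le> B is"
    by metis
  define C where "C = (\<Sum>is :: 'p list | length is = n. \<bar>B is\<bar>)"
  have mono: "\<bar>\<Prod>i\<leftarrow>is. h $ i\<bar> \<le> norm h ^ length is" for h :: "real^'p" and "is"
    by (induction "is") (auto simp: abs_mult intro!: mult_mono component_le_norm_cart)
  have bound: "\<bar>f (\<theta> + h) - (\<Sum>k<n. (\<Sum>is | length is = k. partial_derivs is f \<theta> * (\<Prod>i\<leftarrow>is. h $ i)) / fact k)\<bar>
      \<le> C * norm h ^ n" if h: "norm h < \<delta>" for h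
  proof -
    define \<phi> where "\<phi> k t = (\<Sum>is | length is = k. partial_derivs is f (\<theta> + t *\<^sub>R h) * (\<Prod>i\<leftarrow>is. h $ i))"
      for k t
    have in_ball: "\<theta> + t *\<^sub>R h \<in> cball \<theta> \<delta>" if "0 \<le> t" "t \<le> 1" for t
    proof -
      have "\<bar>t\<bar> * norm h \<le> 1 * \<delta>" using that h by (intro mult_mono) auto
      then show ?thesis by (simp add: dist_norm)
    qed
    have "DERIV (\<phi> k) t :> \<phi> (Suc k) t" if t: "0 \<le> t" "t \<le> 1" for k t
    proof -
      have "DERIV (\<phi> k) t :> (\<Sum>is | length is = k. (\<Sum>j\<in>UNIV. h $ j * partial_derivs (j # is) f (\<theta> + t *\<^sub>R h))
          * (\<Prod>i\<leftarrow>is. h $ i))"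
        unfolding \<phi>_def
        by (intro DERIV_sum DERIV_cmult_right has_partials_along_line deriv in_ball t)
      also have "(\<Sum>is | length is = k. (\<Sum>j\<in>UNIV. h $ j * partial_derivs (j # is) f (\<theta> + t *\<^sub>R h))
          * (\<Prod>i\<leftarrow>is. h $ i)) = \<phi> (Suc k) t"
      proof -
        have "(\<Sum>is | length is = k. \<Sum>j\<in>UNIV. h $ j * partial_derivs (j # is) f (\<theta> + t *\<^sub>R h) * (\<Prod>i\<leftarrow>is. h $ i))
            = (\<Sum>j\<in>UNIV. \<Sum>is | length is = k. h $ j * partial_derivs (j # is) f (\<theta> + t *\<^sub>R h) * (\<Prod>i\<leftarrow>is. h $ i))"
          by (rule sum.swap)
        also have "\<dots> = (\<Sum>j\<in>UNIV. \<Sum>is | length is = k. partial_derivs (j # is) f (\<theta> + t *\<^sub>R h) * (\<Prod>i\<leftarrow>j # is. h $ i))"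
          by (intro sum.cong refl) (simp only: list.map prod_list.Cons mult_ac)
        finally show ?thesis
          unfolding \<phi>_def sum_lists_length_Suc sum_distrib_right .
      qed
      finally show ?thesis .
    qed
    then have "\<exists>t>0. t < 1 \<and> \<phi> 0 1 = (\<Sum>k<n. \<phi> k 0 / fact k * 1 ^ k) + \<phi> n t / fact n * 1 ^ n"
      using assms(4) by (intro Maclaurin) auto
    then obtain t where t: "0 < t" "t < 1"
      "\<phi> 0 1 = (\<Sum>k<n. \<phi> k 0 / fact k * 1 ^ k) + \<phi> n t / fact n * 1 ^ n"
      by blast
    have "\<bar>\<phi> n t\<bar> \<le> (\<Sum>is :: 'p list | length is = n. \<bar>B is\<bar> * norm h ^ n)"
    proof -
      have "\<bar>partial_derivs is f (\<theta> + t *\<^sub>R h) * (\<Prod>i\<leftarrow>is. h $ i)\<bar> \<le> \<bar>B is\<bar> * norm h ^ n"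
        if "length is = n" for "is"
        unfolding abs_mult using mono[of h "is"] B[OF in_ball, of t "is"] t that
        by (intro mult_mono) auto
      then show ?thesis
        unfolding \<phi>_def by (intro order.trans[OF sum_abs] sum_mono) auto
    qed
    also have "\<dots> = C * norm h ^ n" by (simp add: C_def sum_distrib_right)
    finally have "\<bar>\<phi> n t\<bar> / fact n \<le> C * norm h ^ n / fact n"
      by (intro divide_right_mono) auto
    also have "\<dots> \<le> C * norm h ^ n"
    proof -
      have "0 \<le> C" by (simp add: C_def sum_nonneg)
      then have "C * norm h ^ n / fact n \<le> C * norm h ^ n / 1"
        by (intro divide_left_mono) auto
      then show ?thesis by simp
    qed
    finally show ?thesis
      using t(3) by (simp add: \<phi>_def[of _ 0] \<phi>_def[of _ 1] sum_lists_length_0 abs_divide)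
  qed
  have "\<forall>\<^sub>F h :: real^'p in nhds 0. norm h < \<delta>"
    using eventually_nhds_ball[OF \<delta>(1), of "0 :: real^'p"] by simp
  then show ?thesis
    by (intro bigoI[of _ C]) (elim eventually_mono, simp add: bound)
qed

section \<open>Smoothness of the log partition function\<close>

lemma exp_remainder_bound: "\<bar>exp u - 1 - u\<bar> \<le> u\<^sup>2 * exp \<bar>u\<bar>" for u :: real
proof -
  obtain t where t: "\<bar>t\<bar> \<le> \<bar>u\<bar>" "exp u = (\<Sum>m<2. u ^ m / fact m) + exp t / fact 2 * u ^ 2"
    using Maclaurin_exp_le[of u 2] by blast
  have "exp t \<le> exp \<bar>u\<bar>" using t(1) by simp
  moreover have "\<bar>exp u - 1 - u\<bar> = exp t / 2 * u\<^sup>2"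
    by (subst t(2)) (simp add: eval_nat_numeral)
  moreover have "exp t / 2 \<le> exp \<bar>u\<bar>"
    using \<open>exp t \<le> exp \<bar>u\<bar>\<close> exp_ge_zero[of t] by linarith
  then have "exp t / 2 * u\<^sup>2 \<le> exp \<bar>u\<bar> * u\<^sup>2"
    by (rule mult_right_mono) simp
  ultimately show ?thesis by (simp add: mult.commute)
qed

lemma power_le_exp:
  fixes r a :: real
  assumes "0 \<le> r" "0 < a"
  shows "r ^ k \<le> (real (Suc k) / a) ^ k * exp (a * r)"
proof -
  have "a * r / real (Suc k) \<le> exp (a * r / real (Suc k))"
    using exp_ge_add_one_self[of "a * r / real (Suc k)"] by linarith
  then have "(a * r / real (Suc k)) ^ k \<le> exp (a * r / real (Suc k)) ^ k"
    using assms by (intro power_mono) auto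
  also have "\<dots> = exp (real k * (a * r / real (Suc k)))"
    by (rule exp_of_nat_mult[symmetric])
  also have "\<dots> \<le> exp (a * r)"
    using assms by (simp add: field_simps)
  finally have "(real (Suc k) / a) ^ k * (a * r / real (Suc k)) ^ k \<le> (real (Suc k) / a) ^ k * exp (a * r)"
    using assms by (intro mult_left_mono) auto
  moreover have "(real (Suc k) / a) ^ k * (a * r / real (Suc k)) ^ k = r ^ k"
    using assms by (simp add: power_mult_distrib[symmetric])
  ultimately show ?thesis by simp
qed

lemma finite_index_max:
  fixes f :: "'p::finite \<Rightarrow> real"
  obtains i where "\<And>j. f j \<le> f i"
proof -
  have "Max (range f) \<in> range f" by (intro Max_in) auto
  then obtain i where i: "Max (range f) = f i" by blast
  have "f j \<le> f i" for j unfolding i[symmetric] by (rule Max_ge) auto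
  then show ?thesis by (rule that)
qed

locale exp_family =
  fixes \<mu> :: "'a measure" and \<xi> :: "'p::finite \<Rightarrow> 'a \<Rightarrow> real" and \<Theta> :: "(real^'p) set"
  assumes family: "exponential_family \<mu> \<xi> \<Theta>"
begin

lemma open_Theta: "open \<Theta>"
  and xi_measurable[measurable]: "\<xi> i \<in> borel_measurable \<mu>"
  and density: "\<theta> \<in> \<Theta> \<Longrightarrow> prob_density \<mu> (expfam \<mu> \<xi> \<theta>)"
  using family by (auto simp: exponential_family_def)

definition weight :: "real^'p \<Rightarrow> 'a \<Rightarrow> real" where
  "weight \<theta> x = exp (\<Sum>i\<in>UNIV. \<theta> $ i * \<xi> i x)"

text \<open>Unnormalised moments: the partial derivatives of the partition function.\<close>

definition raw :: "'p list \<Rightarrow> real^'p \<Rightarrow> real" where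
  "raw is \<theta> = (\<integral>x. (\<Prod>i\<leftarrow>is. \<xi> i x) * weight \<theta> x \<partial>\<mu>)"

definition size_xi :: "'a \<Rightarrow> real" where
  "size_xi x = (\<Sum>i\<in>UNIV. \<bar>\<xi> i x\<bar>)"

abbreviation \<Psi> :: "real^'p \<Rightarrow> real" where
  "\<Psi> \<equiv> log_partition \<mu> \<xi>"

lemma weight_pos: "0 < weight \<theta> x"
  by (simp add: weight_def)

lemma weight_measurable[measurable]: "weight \<theta> \<in> borel_measurable \<mu>"
  unfolding weight_def[abs_def] by measurable

lemma prod_xi_measurable[measurable]: "(\<lambda>x. \<Prod>i\<leftarrow>is. \<xi> i x) \<in> borel_measurable \<mu>"
  by (induction "is") auto

lemma size_xi_measurable[measurable]: "size_xi \<in> borel_measurable \<mu>"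
  unfolding size_xi_def[abs_def] by measurable

lemma size_xi_nonneg: "0 \<le> size_xi x"
  by (simp add: size_xi_def sum_nonneg)

lemma expfam_weight: "expfam \<mu> \<xi> \<theta> x = weight \<theta> x * exp (- \<Psi> \<theta>)"
  by (simp add: expfam_def weight_def mult_exp_exp)

lemma expfam_pos: "0 < expfam \<mu> \<xi> \<theta> x"
  by (simp add: expfam_def)

lemma expfam_measurable[measurable]: "expfam \<mu> \<xi> \<theta> \<in> borel_measurable \<mu>"
  unfolding expfam_weight[abs_def] by measurable

lemma expfam_integral:
  assumes "\<theta> \<in> \<Theta>"
  shows "integrable \<mu> (expfam \<mu> \<xi> \<theta>)" "(\<integral>x. expfam \<mu> \<xi> \<theta> x \<partial>\<mu>) = 1"
proof -
  interpret P: prob_space "density \<mu> (\<lambda>x. ennreal (expfam \<mu> \<xi> \<theta> x))"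
    using density[OF assms] by (simp add: prob_density_def)
  have "(\<integral>\<^sup>+x. ennreal (expfam \<mu> \<xi> \<theta> x) \<partial>\<mu>) = ennreal 1"
    using P.emeasure_space_1 by (simp add: emeasure_density)
  then have "has_bochner_integral \<mu> (expfam \<mu> \<xi> \<theta>) 1"
    by (intro has_bochner_integral_nn_integral) (auto simp: expfam_pos less_imp_le)
  then show "integrable \<mu> (expfam \<mu> \<xi> \<theta>)" "(\<integral>x. expfam \<mu> \<xi> \<theta> x \<partial>\<mu>) = 1"
    by (auto simp: has_bochner_integral_iff)
qed

lemma weight_integrable: "\<theta> \<in> \<Theta> \<Longrightarrow> integrable \<mu> (weight \<theta>)"
  using integrable_mult_left[of "exp (\<Psi> \<theta>)" \<mu> "expfam \<mu> \<xi> \<theta>"] expfam_integral(1)[of \<theta>]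
  by (simp add: expfam_weight mult_exp_exp mult.assoc)

lemma raw_Nil: "\<theta> \<in> \<Theta> \<Longrightarrow> raw [] \<theta> = exp (\<Psi> \<theta>)"
  using expfam_integral(2)[of \<theta>] weight_integrable[of \<theta>]
  by (simp add: raw_def expfam_weight exp_minus field_simps)

lemma prod_xi_bound: "\<bar>\<Prod>i\<leftarrow>is. \<xi> i x\<bar> \<le> size_xi x ^ length is"
proof (induction "is")
  case (Cons i "is")
  have "\<bar>\<xi> i x\<bar> \<le> size_xi x"
    unfolding size_xi_def by (rule member_le_sum) auto
  with Cons show ?case
    by (auto simp: abs_mult size_xi_nonneg intro!: mult_mono)
qed simp

lemma inner_xi_bound: "\<bar>\<Sum>i\<in>UNIV. h $ i * \<xi> i x\<bar> \<le> norm h * size_xi x"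
  unfolding size_xi_def sum_distrib_left
  by (rule order.trans[OF sum_abs]) (auto simp: abs_mult intro!: sum_mono mult_right_mono component_le_norm_cart)

text \<open>An exponential moment of the sum of the absolute values is dominated by the
  exponential tilts along the coordinate axes, which stay in the open parameter set.\<close>

lemma exp_size_xi_integrable:
  assumes "\<theta> \<in> \<Theta>"
  obtains \<epsilon> where "\<epsilon> > 0" "integrable \<mu> (\<lambda>x. exp (\<epsilon> * size_xi x) * weight \<theta> x)"
proof -
  obtain \<delta> where \<delta>: "\<delta> > 0" "cball \<theta> \<delta> \<subseteq> \<Theta>"
    using assms open_Theta open_contains_cball by blast
  define p where "p = real (CARD('p))"
  have p: "p > 0" by (simp add: p_def)
  define V where "V x = (\<Sum>i\<in>UNIV. weight (\<theta> + \<delta> *\<^sub>R axis i 1) x + weight (\<theta> - \<delta> *\<^sub>R axis i 1) x)" for x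
  have in_Theta: "\<theta> + \<delta> *\<^sub>R axis i 1 \<in> \<Theta>" "\<theta> - \<delta> *\<^sub>R axis i 1 \<in> \<Theta>" for i
    using \<delta> by (auto intro!: subsetD[OF \<delta>(2)] simp: dist_norm)
  have V_int: "integrable \<mu> V"
    unfolding V_def by (intro Bochner_Integration.integrable_sum Bochner_Integration.integrable_add weight_integrable in_Theta)
  have axis_sum: "(\<Sum>j\<in>UNIV. (\<theta> + s *\<^sub>R axis i 1) $ j * \<xi> j x) = (\<Sum>j\<in>UNIV. \<theta> $ j * \<xi> j x) + s * \<xi> i x" for s i x
    by (simp add: algebra_simps sum.distrib axis_def if_distrib[of "\<lambda>y. _ * y"] cong: if_cong)
  have bound: "exp (\<delta> / p * size_xi x) * weight \<theta> x \<le> V x" for x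
  proof -
    obtain i where i: "\<And>j. \<bar>\<xi> j x\<bar> \<le> \<bar>\<xi> i x\<bar>"
      using finite_index_max[of "\<lambda>j. \<bar>\<xi> j x\<bar>"] by blast
    have "size_xi x \<le> p * \<bar>\<xi> i x\<bar>"
      using sum_bounded_above[of UNIV "\<lambda>j. \<bar>\<xi> j x\<bar>" "\<bar>\<xi> i x\<bar>"] i by (simp add: size_xi_def p_def)
    then have "\<delta> / p * size_xi x \<le> \<delta> / p * (p * \<bar>\<xi> i x\<bar>)"
      using \<delta>(1) p by (intro mult_left_mono) auto
    also have "\<dots> = \<delta> * \<bar>\<xi> i x\<bar>" using p by simp
    finally have "exp (\<delta> / p * size_xi x) * weight \<theta> x \<le> exp (\<delta> * \<bar>\<xi> i x\<bar>) * weight \<theta> x"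
      using weight_pos[of \<theta> x] by (intro mult_right_mono) auto
    also have "\<dots> \<le> weight (\<theta> + \<delta> *\<^sub>R axis i 1) x + weight (\<theta> - \<delta> *\<^sub>R axis i 1) x"
    proof -
      have "weight (\<theta> + s *\<^sub>R axis i 1) x = exp (s * \<xi> i x) * weight \<theta> x" for s
        unfolding weight_def axis_sum by (simp add: exp_add)
      from this[of \<delta>] this[of "-\<delta>"] show ?thesis
        using weight_pos[of \<theta> x] by (cases "\<xi> i x \<ge> 0") auto
    qed
    also have "\<dots> \<le> V x"
      unfolding V_def by (rule member_le_sum[of i UNIV "\<lambda>i. weight (\<theta> + \<delta> *\<^sub>R axis i 1) x + weight (\<theta> - \<delta> *\<^sub>R axis i 1) x"])
        (auto simp: less_imp_le[OF weight_pos] intro: add_nonneg_nonneg)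
    finally show ?thesis .
  qed
  have "integrable \<mu> (\<lambda>x. exp (\<delta> / p * size_xi x) * weight \<theta> x)"
    by (rule Bochner_Integration.integrable_bound[OF V_int])
      (auto intro!: AE_I2 order.trans[OF _ abs_ge_self] order.trans[OF _ bound] simp: abs_mult less_imp_le[OF weight_pos])
  then show ?thesis using \<delta>(1) p by (intro that[of "\<delta> / p"]) auto
qed

lemma size_xi_exp_integrable:
  assumes "\<theta> \<in> \<Theta>"
  obtains \<epsilon> where "\<epsilon> > 0" "\<And>k. integrable \<mu> (\<lambda>x. size_xi x ^ k * exp (\<epsilon> * size_xi x) * weight \<theta> x)"
proof -
  obtain \<epsilon> where \<epsilon>: "\<epsilon> > 0" "integrable \<mu> (\<lambda>x. exp (\<epsilon> * size_xi x) * weight \<theta> x)"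
    using exp_size_xi_integrable[OF assms] .
  have "integrable \<mu> (\<lambda>x. size_xi x ^ k * exp (\<epsilon>/2 * size_xi x) * weight \<theta> x)" for k
  proof (rule Bochner_Integration.integrable_bound)
    define C where "C = (real (Suc k) / (\<epsilon>/2)) ^ k"
    show "integrable \<mu> (\<lambda>x. C * (exp (\<epsilon> * size_xi x) * weight \<theta> x))"
      using \<epsilon>(2) by simp
    have "size_xi x ^ k * exp (\<epsilon>/2 * size_xi x) * weight \<theta> x \<le> C * (exp (\<epsilon> * size_xi x) * weight \<theta> x)" for x
    proof -
      have "size_xi x ^ k \<le> C * exp (\<epsilon>/2 * size_xi x)"
        unfolding C_def using \<epsilon>(1) by (intro power_le_exp size_xi_nonneg) auto
      then have "size_xi x ^ k * (exp (\<epsilon>/2 * size_xi x) * weight \<theta> x)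
          \<le> C * exp (\<epsilon>/2 * size_xi x) * (exp (\<epsilon>/2 * size_xi x) * weight \<theta> x)"
        using weight_pos[of \<theta> x] by (intro mult_right_mono) auto
      also have "\<dots> = C * (exp (\<epsilon>/2 * size_xi x + \<epsilon>/2 * size_xi x) * weight \<theta> x)"
        by (simp only: exp_add mult_ac)
      finally show ?thesis by (simp add: mult_ac)
    qed
    moreover have "0 \<le> C" using \<epsilon>(1) by (simp add: C_def)
    ultimately show "AE x in \<mu>. norm (size_xi x ^ k * exp (\<epsilon>/2 * size_xi x) * weight \<theta> x)
        \<le> norm (C * (exp (\<epsilon> * size_xi x) * weight \<theta> x))"
      by (intro AE_I2) (auto simp: abs_mult size_xi_nonneg less_imp_le[OF weight_pos])
  qed measurable
  then show ?thesis using \<epsilon>(1) by (intro that[of "\<epsilon>/2"]) auto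
qed

lemma raw_integrable:
  assumes "\<theta> \<in> \<Theta>"
  shows "integrable \<mu> (\<lambda>x. (\<Prod>i\<leftarrow>is. \<xi> i x) * weight \<theta> x)"
proof -
  obtain \<epsilon> where \<epsilon>: "\<epsilon> > 0" "\<And>k. integrable \<mu> (\<lambda>x. size_xi x ^ k * exp (\<epsilon> * size_xi x) * weight \<theta> x)"
    using size_xi_exp_integrable[OF assms] by blast
  have "\<bar>\<Prod>i\<leftarrow>is. \<xi> i x\<bar> * weight \<theta> x \<le> size_xi x ^ length is * exp (\<epsilon> * size_xi x) * weight \<theta> x" for x
  proof -
    have "\<bar>\<Prod>i\<leftarrow>is. \<xi> i x\<bar> * 1 \<le> size_xi x ^ length is * exp (\<epsilon> * size_xi x)"
      using \<epsilon>(1) by (intro mult_mono prod_xi_bound) (auto simp: size_xi_nonneg)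
    then show ?thesis using weight_pos[of \<theta> x] by simp
  qed
  then show ?thesis
    by (intro Bochner_Integration.integrable_bound[OF \<epsilon>(2)[of "length is"]])
      (auto simp: abs_mult size_xi_nonneg less_imp_le[OF weight_pos])
qed

text \<open>The exponential minus its linear part is quadratic in the shift, with a constant that is
  integrable by the exponential moment bound; the error of the linear approximation of the integral
  is therefore quadratic as well, and no limit has to be exchanged with the integral.\<close>

lemma raw_has_partials:
  assumes \<theta>: "\<theta> \<in> \<Theta>"
  shows "has_partials (raw is) (\<lambda>j. raw (j # is) \<theta>) \<theta>"
proof -
  obtain \<epsilon> where \<epsilon>: "\<epsilon> > 0" "\<And>k. integrable \<mu> (\<lambda>x. size_xi x ^ k * exp (\<epsilon> * size_xi x) * weight \<theta> x)"
    using size_xi_exp_integrable[OF \<theta>] by blast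
  obtain \<delta> where \<delta>: "\<delta> > 0" "ball \<theta> \<delta> \<subseteq> \<Theta>"
    using \<theta> open_Theta open_contains_ball by blast
  define V where "V x = size_xi x ^ (length is + 2) * exp (\<epsilon> * size_xi x) * weight \<theta> x" for x
  define W where "W = (\<integral>x. V x \<partial>\<mu>)"
  have V_int: "integrable \<mu> V" unfolding V_def by (rule \<epsilon>(2))
  have key: "\<bar>raw is (\<theta> + h) - raw is \<theta> - (\<Sum>j\<in>UNIV. h $ j * raw (j # is) \<theta>)\<bar> \<le> W * norm h ^ 2"
    if h: "norm h < min \<epsilon> \<delta>" for h
  proof -
    have h_in: "\<theta> + h \<in> \<Theta>" using h \<delta>(2) by (auto simp: dist_norm)
    define u where "u x = (\<Sum>i\<in>UNIV. h $ i * \<xi> i x)" for x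
    define R where "R x = (\<Prod>i\<leftarrow>is. \<xi> i x) * (exp (u x) - 1 - u x) * weight \<theta> x" for x
    have weight_h: "weight (\<theta> + h) x = exp (u x) * weight \<theta> x" for x
      by (simp add: weight_def u_def algebra_simps sum.distrib exp_add)
    have lin: "(\<Sum>j\<in>UNIV. h $ j * raw (j # is) \<theta>) = (\<integral>x. (\<Prod>i\<leftarrow>is. \<xi> i x) * u x * weight \<theta> x \<partial>\<mu>)"
      and lin_int: "integrable \<mu> (\<lambda>x. (\<Prod>i\<leftarrow>is. \<xi> i x) * u x * weight \<theta> x)"
    proof -
      have eq: "(\<Prod>i\<leftarrow>is. \<xi> i x) * u x * weight \<theta> x =
          (\<Sum>j\<in>UNIV. h $ j * ((\<Prod>i\<leftarrow>j # is. \<xi> i x) * weight \<theta> x))" for x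
        by (simp add: u_def sum_distrib_left sum_distrib_right mult_ac)
      show "integrable \<mu> (\<lambda>x. (\<Prod>i\<leftarrow>is. \<xi> i x) * u x * weight \<theta> x)"
        unfolding eq by (intro Bochner_Integration.integrable_sum integrable_mult_right raw_integrable \<theta>)
      show "(\<Sum>j\<in>UNIV. h $ j * raw (j # is) \<theta>) = (\<integral>x. (\<Prod>i\<leftarrow>is. \<xi> i x) * u x * weight \<theta> x \<partial>\<mu>)"
      proof -
        have "(\<integral>x. (\<Prod>i\<leftarrow>is. \<xi> i x) * u x * weight \<theta> x \<partial>\<mu>)
            = (\<Sum>j\<in>UNIV. \<integral>x. h $ j * ((\<Prod>i\<leftarrow>j # is. \<xi> i x) * weight \<theta> x) \<partial>\<mu>)"
          unfolding eq
          by (intro Bochner_Integration.integral_sum integrable_mult_right raw_integrable \<theta>)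
        then show ?thesis by (simp only: integral_mult_right_zero raw_def)
      qed
    qed
    have R_eq: "R x = (\<Prod>i\<leftarrow>is. \<xi> i x) * weight (\<theta> + h) x - (\<Prod>i\<leftarrow>is. \<xi> i x) * weight \<theta> x
        - (\<Prod>i\<leftarrow>is. \<xi> i x) * u x * weight \<theta> x" for x
      by (simp add: R_def weight_h algebra_simps)
    have R_int: "integrable \<mu> R"
      unfolding R_eq by (intro Bochner_Integration.integrable_diff raw_integrable \<theta> h_in lin_int)
    have "raw is (\<theta> + h) - raw is \<theta> - (\<Sum>j\<in>UNIV. h $ j * raw (j # is) \<theta>) = (\<integral>x. R x \<partial>\<mu>)"
      unfolding R_eq lin unfolding raw_def
      by (simp add: raw_integrable \<theta> h_in lin_int)
    moreover have "\<bar>\<integral>x. R x \<partial>\<mu>\<bar> \<le> (\<integral>x. norm h ^ 2 * V x \<partial>\<mu>)"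
    proof (rule order.trans[OF integral_abs_bound], rule integral_mono)
      show "integrable \<mu> (\<lambda>x. norm h ^ 2 * V x)" using V_int by simp
      fix x
      have u: "\<bar>u x\<bar> \<le> norm h * size_xi x"
        unfolding u_def by (rule inner_xi_bound)
      have "exp \<bar>u x\<bar> \<le> exp (\<epsilon> * size_xi x)"
        using u h mult_right_mono[of "norm h" \<epsilon> "size_xi x"] size_xi_nonneg[of x] by simp
      moreover have "(u x)\<^sup>2 \<le> (norm h * size_xi x)\<^sup>2"
        using power_mono[OF u, of 2] by simp
      ultimately have "\<bar>exp (u x) - 1 - u x\<bar> \<le> (norm h * size_xi x)\<^sup>2 * exp (\<epsilon> * size_xi x)"
        by (intro order.trans[OF exp_remainder_bound] mult_mono) auto
      then have "\<bar>\<Prod>i\<leftarrow>is. \<xi> i x\<bar> * \<bar>exp (u x) - 1 - u x\<bar>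
          \<le> size_xi x ^ length is * ((norm h * size_xi x)\<^sup>2 * exp (\<epsilon> * size_xi x))"
        by (intro mult_mono prod_xi_bound) (auto simp: size_xi_nonneg)
      then have "\<bar>R x\<bar> \<le> size_xi x ^ length is * ((norm h * size_xi x)\<^sup>2 * exp (\<epsilon> * size_xi x)) * weight \<theta> x"
        unfolding R_def abs_mult using weight_pos[of \<theta> x] by (simp add: mult_right_mono)
      also have "\<dots> = norm h ^ 2 * V x"
        by (simp add: V_def power_add power2_eq_square mult_ac)
      finally show "\<bar>R x\<bar> \<le> norm h ^ 2 * V x" .
    qed (use R_int in auto)
    ultimately show ?thesis by (simp add: W_def mult.commute)
  qed
  show ?thesis
    unfolding has_partials_def
  proof (rule has_derivativeI_sandwich[where e = "min \<epsilon> \<delta>" and H = "\<lambda>y. W * norm (y - \<theta>)"])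
    show "bounded_linear (\<lambda>h. \<Sum>j\<in>UNIV. h $ j * raw (j # is) \<theta>)"
      by (intro bounded_linear_sum bounded_linear_mult_const bounded_linear_vec_nth)
    show "norm (raw is y - raw is \<theta> - (\<Sum>j\<in>UNIV. (y - \<theta>) $ j * raw (j # is) \<theta>)) / norm (y - \<theta>)
        \<le> W * norm (y - \<theta>)" if "y \<noteq> \<theta>" "dist y \<theta> < min \<epsilon> \<delta>" for y
      using key[of "y - \<theta>"] that by (simp add: dist_norm divide_le_eq power2_eq_square mult_ac)
    show "((\<lambda>y. W * norm (y - \<theta>)) \<longlongrightarrow> 0) (at \<theta>)"
      by (auto intro!: tendsto_eq_intros)
  qed (use \<epsilon> \<delta> in auto)
qed

end

lemma has_partials_const: "has_partials (\<lambda>_. c) (\<lambda>_. 0) \<theta>"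
  by (simp add: has_partials_def)

lemma has_partials_add:
  "has_partials f d \<theta> \<Longrightarrow> has_partials g e \<theta> \<Longrightarrow> has_partials (\<lambda>\<theta>. f \<theta> + g \<theta>) (\<lambda>j. d j + e j) \<theta>"
  unfolding has_partials_def
  by (rule has_derivative_eq_rhs[OF has_derivative_add]) (auto simp: sum.distrib algebra_simps)

lemma has_partials_mult:
  "has_partials f d \<theta> \<Longrightarrow> has_partials g e \<theta> \<Longrightarrow>
    has_partials (\<lambda>\<theta>. f \<theta> * g \<theta>) (\<lambda>j. d j * g \<theta> + f \<theta> * e j) \<theta>"
  unfolding has_partials_def
  by (rule has_derivative_eq_rhs[OF has_derivative_mult])
    (auto simp: sum.distrib algebra_simps sum_distrib_left)

lemma has_partials_cmult:
  "has_partials f d \<theta> \<Longrightarrow> has_partials (\<lambda>\<theta>. c * f \<theta>) (\<lambda>j. c * d j) \<theta>"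
  using has_partials_mult[OF has_partials_const] by fastforce

lemma has_partials_diff:
  "has_partials f d \<theta> \<Longrightarrow> has_partials g e \<theta> \<Longrightarrow> has_partials (\<lambda>\<theta>. f \<theta> - g \<theta>) (\<lambda>j. d j - e j) \<theta>"
  using has_partials_add[of f d \<theta> "\<lambda>\<theta>. (-1) * g \<theta>" "\<lambda>j. (-1) * e j"] has_partials_cmult[of g e \<theta> "-1"]
  by simp

lemma has_partials_real_compose:
  "has_partials f d \<theta> \<Longrightarrow> (\<phi> has_field_derivative c) (at (f \<theta>)) \<Longrightarrow>
    has_partials (\<lambda>\<theta>. \<phi> (f \<theta>)) (\<lambda>j. c * d j) \<theta>"
  unfolding has_partials_def has_field_derivative_def
  by (drule (1) has_derivative_compose) (simp add: sum_distrib_left mult_ac)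

context exp_family
begin

definition mean :: "'p list \<Rightarrow> real^'p \<Rightarrow> real" where
  "mean is \<theta> = raw is \<theta> / raw [] \<theta>"

lemma raw_Nil_pos: "\<theta> \<in> \<Theta> \<Longrightarrow> 0 < raw [] \<theta>"
  by (simp add: raw_Nil)

lemma raw_permute: "mset is = mset js \<Longrightarrow> raw is = raw js"
  unfolding raw_def[abs_def] by (simp add: prod_mset_prod_list[symmetric])

lemma mean_permute: "mset is = mset js \<Longrightarrow> mean is = mean js"
  unfolding mean_def[abs_def] by (drule raw_permute) (simp only:)

lemma mean_has_partials:
  assumes "\<theta> \<in> \<Theta>"
  shows "has_partials (mean is) (\<lambda>j. mean (j # is) \<theta> - mean is \<theta> * mean [j] \<theta>) \<theta>"
proof -
  note pos = raw_Nil_pos[OF assms]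
  have inv: "has_partials (\<lambda>\<theta>. inverse (raw [] \<theta>))
      (\<lambda>j. - (inverse (raw [] \<theta>) * inverse (raw [] \<theta>)) * raw [j] \<theta>) \<theta>"
    by (rule has_partials_real_compose[OF raw_has_partials[OF assms], of inverse])
      (use pos DERIV_inverse[of "raw [] \<theta>"] in \<open>simp add: power2_eq_square\<close>)
  have "(\<lambda>j. raw (j # is) \<theta> * inverse (raw [] \<theta>)
      + raw is \<theta> * (- (inverse (raw [] \<theta>) * inverse (raw [] \<theta>)) * raw [j] \<theta>))
      = (\<lambda>j. mean (j # is) \<theta> - mean is \<theta> * mean [j] \<theta>)"
    by (simp add: fun_eq_iff mean_def divide_inverse)
  with has_partials_mult[OF raw_has_partials[OF assms, of "is"] inv] show ?thesis
    unfolding mean_def[abs_def] divide_inverse by simp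
qed

lemma log_partition_has_partials:
  assumes "\<theta> \<in> \<Theta>"
  shows "has_partials \<Psi> (\<lambda>j. mean [j] \<theta>) \<theta>"
proof -
  have "has_partials (\<lambda>\<theta>. ln (raw [] \<theta>)) (\<lambda>j. inverse (raw [] \<theta>) * raw [j] \<theta>) \<theta>"
    by (rule has_partials_real_compose[OF raw_has_partials[OF assms], of ln])
      (rule DERIV_ln[OF raw_Nil_pos[OF assms]])
  moreover have "(\<lambda>\<theta>. ln (raw [] \<theta>)) = \<Psi>"
    by (simp add: raw_def log_partition_def weight_def fun_eq_iff)
  ultimately show ?thesis by (simp add: mean_def divide_inverse mult.commute)
qed

text \<open>The derivative of a normalised moment is a polynomial in normalised moments, so polynomials in
  them are closed under differentiation. All derivatives of the log partition function lie in this
  algebra, which proves smoothness of every order at once.\<close>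

inductive mean_polynomial :: "(real^'p \<Rightarrow> real) \<Rightarrow> bool" where
  const: "mean_polynomial (\<lambda>_. c)"
| mean: "mean_polynomial (mean is)"
| add: "mean_polynomial f \<Longrightarrow> mean_polynomial g \<Longrightarrow> mean_polynomial (\<lambda>\<theta>. f \<theta> + g \<theta>)"
| mult: "mean_polynomial f \<Longrightarrow> mean_polynomial g \<Longrightarrow> mean_polynomial (\<lambda>\<theta>. f \<theta> * g \<theta>)"

lemma mean_polynomial_has_partials:
  "mean_polynomial f \<Longrightarrow>
    \<exists>d. (\<forall>j. mean_polynomial (d j)) \<and> (\<forall>\<theta>\<in>\<Theta>. has_partials f (\<lambda>j. d j \<theta>) \<theta>)"
proof (induction rule: mean_polynomial.induct)
  case (const c)
  show ?case
    by (intro exI[of _ "\<lambda>_ _. 0"]) (auto intro: has_partials_const mean_polynomial.const)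
next
  case (mean "is")
  have "mean_polynomial (\<lambda>\<theta>. mean (j # is) \<theta> + (-1) * (mean is \<theta> * mean [j] \<theta>))" for j
    by (intro mean_polynomial.intros)
  then show ?case
    by (intro exI[of _ "\<lambda>j \<theta>. mean (j # is) \<theta> - mean is \<theta> * mean [j] \<theta>"]) (auto intro: mean_has_partials)
next
  case (add f g)
  then obtain d e where "\<forall>j. mean_polynomial (d j)" "\<forall>\<theta>\<in>\<Theta>. has_partials f (\<lambda>j. d j \<theta>) \<theta>"
    "\<forall>j. mean_polynomial (e j)" "\<forall>\<theta>\<in>\<Theta>. has_partials g (\<lambda>j. e j \<theta>) \<theta>"
    by blast
  then show ?case
    by (intro exI[of _ "\<lambda>j \<theta>. d j \<theta> + e j \<theta>"]) (auto intro: has_partials_add mean_polynomial.add)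
next
  case (mult f g)
  then obtain d e where "\<forall>j. mean_polynomial (d j)" "\<forall>\<theta>\<in>\<Theta>. has_partials f (\<lambda>j. d j \<theta>) \<theta>"
    "\<forall>j. mean_polynomial (e j)" "\<forall>\<theta>\<in>\<Theta>. has_partials g (\<lambda>j. e j \<theta>) \<theta>"
    by blast
  then show ?case using mult.hyps
    by (intro exI[of _ "\<lambda>j \<theta>. d j \<theta> * g \<theta> + f \<theta> * e j \<theta>"])
      (auto intro!: has_partials_mult mean_polynomial.add mean_polynomial.mult)
qed

lemma has_partials_cong_Theta:
  assumes "\<And>\<theta>. \<theta> \<in> \<Theta> \<Longrightarrow> f \<theta> = g \<theta>" "\<theta> \<in> \<Theta>" "has_partials f d \<theta>"
  shows "has_partials g d \<theta>"
  using has_partials_cong_open[OF open_Theta assms(2,1,3)] .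

lemma partial_deriv_cong_Theta:
  assumes "\<And>\<theta>. \<theta> \<in> \<Theta> \<Longrightarrow> f \<theta> = g \<theta>" "\<theta> \<in> \<Theta>" "has_partials f d \<theta>"
  shows "partial_deriv j g \<theta> = d j"
  using has_partials_partial_deriv[OF has_partials_cong_Theta[OF assms]] .

lemma partial_derivs_mean_polynomial:
  "is \<noteq> [] \<Longrightarrow> \<exists>f. mean_polynomial f \<and> (\<forall>\<theta>\<in>\<Theta>. partial_derivs is \<Psi> \<theta> = f \<theta>)"
proof (induction "is")
  case (Cons i "is")
  show ?case
  proof (cases "is = []")
    case True
    then have "partial_derivs (i # is) \<Psi> \<theta> = mean [i] \<theta>" if "\<theta> \<in> \<Theta>" for \<theta>
      by (simp add: has_partials_partial_deriv[OF log_partition_has_partials[OF that]])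
    then show ?thesis using mean_polynomial.mean by blast
  next
    case False
    then obtain f where f: "mean_polynomial f" "\<forall>\<theta>\<in>\<Theta>. partial_derivs is \<Psi> \<theta> = f \<theta>"
      using Cons.IH by blast
    have eq: "f \<theta> = partial_derivs is \<Psi> \<theta>" if "\<theta> \<in> \<Theta>" for \<theta>
      using f(2) that by simp
    obtain d where d: "\<forall>j. mean_polynomial (d j)" "\<forall>\<theta>\<in>\<Theta>. has_partials f (\<lambda>j. d j \<theta>) \<theta>"
      using mean_polynomial_has_partials[OF f(1)] by blast
    have "partial_derivs (i # is) \<Psi> \<theta> = d i \<theta>" if "\<theta> \<in> \<Theta>" for \<theta>
      unfolding partial_derivs.simps
      by (rule partial_deriv_cong_Theta[OF eq that, where d = "\<lambda>j. d j \<theta>"]) (use d(2) that in auto)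
    then show ?thesis using d(1) by blast
  qed
qed simp

lemma log_partition_smooth: "smooth_on \<Theta> \<Psi>"
  unfolding smooth_on_def
proof (intro allI ballI)
  fix "is" \<theta> assume \<theta>: "\<theta> \<in> \<Theta>"
  have "\<exists>d. has_partials (partial_derivs is \<Psi>) d \<theta>"
  proof (cases "is = []")
    case True
    then show ?thesis using log_partition_has_partials[OF \<theta>] by auto
  next
    case False
    then obtain f where f: "mean_polynomial f" "\<forall>\<theta>\<in>\<Theta>. partial_derivs is \<Psi> \<theta> = f \<theta>"
      using partial_derivs_mean_polynomial by blast
    have eq: "f \<theta> = partial_derivs is \<Psi> \<theta>" if "\<theta> \<in> \<Theta>" for \<theta>
      using f(2) that by simp
    obtain d where "has_partials f d \<theta>"
      using mean_polynomial_has_partials[OF f(1)] \<theta> by blast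
    then have "has_partials (partial_derivs is \<Psi>) d \<theta>"
      by (rule has_partials_cong_Theta[of f, rotated 2]) (use eq \<theta> in auto)
    then show ?thesis by blast
  qed
  then obtain d where d: "has_partials (partial_derivs is \<Psi>) d \<theta>" by blast
  moreover have "d = (\<lambda>j. partial_derivs (j # is) \<Psi> \<theta>)"
    using has_partials_partial_deriv[OF d] by auto
  ultimately show "has_partials (partial_derivs is \<Psi>) (\<lambda>j. partial_derivs (j # is) \<Psi> \<theta>) \<theta>"
    by simp
qed

lemma partial_derivs_1: "\<theta> \<in> \<Theta> \<Longrightarrow> partial_derivs [i] \<Psi> \<theta> = mean [i] \<theta>"
  using has_partials_partial_deriv[OF log_partition_has_partials] by simp

lemma partial_derivs_2:
  "\<theta> \<in> \<Theta> \<Longrightarrow> partial_derivs [i, j] \<Psi> \<theta> = mean [i, j] \<theta> - mean [i] \<theta> * mean [j] \<theta>"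
  using partial_deriv_cong_Theta[of "mean [j]" "partial_derivs [j] \<Psi>", OF _ _ mean_has_partials]
  by (simp add: partial_derivs_1[simplified])

lemma partial_derivs_3:
  assumes "\<theta> \<in> \<Theta>"
  shows "partial_derivs [i, j, k] \<Psi> \<theta> = mean [i, j, k] \<theta> - mean [j, k] \<theta> * mean [i] \<theta>
     - mean [i, j] \<theta> * mean [k] \<theta> - mean [i, k] \<theta> * mean [j] \<theta> + 2 * mean [i] \<theta> * mean [j] \<theta> * mean [k] \<theta>"
proof -
  note p = has_partials_diff[OF mean_has_partials[OF assms, of "[j, k]"]
      has_partials_mult[OF mean_has_partials[OF assms, of "[j]"] mean_has_partials[OF assms, of "[k]"]]]
  have "partial_deriv i (partial_derivs [j, k] \<Psi>) \<theta> = mean [i, j, k] \<theta> - mean [j, k] \<theta> * mean [i] \<theta>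
    - ((mean [i, j] \<theta> - mean [j] \<theta> * mean [i] \<theta>) * mean [k] \<theta>
      + mean [j] \<theta> * (mean [i, k] \<theta> - mean [k] \<theta> * mean [i] \<theta>))"
    by (rule partial_deriv_cong_Theta[OF _ assms p]) (simp only: partial_derivs_2)
  then show ?thesis by (simp add: algebra_simps)
qed

lemma expect_expfam:
  assumes "\<theta> \<in> \<Theta>"
  shows "expect \<mu> (expfam \<mu> \<xi> \<theta>) (\<lambda>x. \<Prod>i\<leftarrow>is. \<xi> i x) = mean is \<theta>"
    and "integrable (density \<mu> (\<lambda>x. ennreal (expfam \<mu> \<xi> \<theta> x))) (\<lambda>x. \<Prod>i\<leftarrow>is. \<xi> i x)"
proof -
  have eq: "expfam \<mu> \<xi> \<theta> x * y = exp (- \<Psi> \<theta>) * (y * weight \<theta> x)" for x y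
    by (simp add: expfam_weight mult_ac)
  have "expect \<mu> (expfam \<mu> \<xi> \<theta>) (\<lambda>x. \<Prod>i\<leftarrow>is. \<xi> i x) = (\<integral>x. expfam \<mu> \<xi> \<theta> x * (\<Prod>i\<leftarrow>is. \<xi> i x) \<partial>\<mu>)"
    unfolding expect_def by (subst integral_density) (auto simp: expfam_pos less_imp_le)
  also have "\<dots> = mean is \<theta>"
    unfolding eq integral_mult_right_zero raw_def[symmetric]
    by (simp add: mean_def raw_Nil assms exp_minus divide_inverse mult.commute)
  finally show "expect \<mu> (expfam \<mu> \<xi> \<theta>) (\<lambda>x. \<Prod>i\<leftarrow>is. \<xi> i x) = mean is \<theta>" .
  show "integrable (density \<mu> (\<lambda>x. ennreal (expfam \<mu> \<xi> \<theta> x))) (\<lambda>x. \<Prod>i\<leftarrow>is. \<xi> i x)"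
    by (subst integrable_density) (auto simp: expfam_pos less_imp_le eq intro!: integrable_mult_right raw_integrable assms)
qed

lemma eta_star_mean: "\<theta> \<in> \<Theta> \<Longrightarrow> eta_star \<mu> \<xi> \<theta> i = mean [i] \<theta>"
  using partial_derivs_1[of \<theta> i] by (simp add: eta_star_def)

text \<open>Both sides are the third cumulant: the expectation is expanded into normalised moments.\<close>

lemma kappa3_star_partial_derivs:
  assumes \<theta>: "\<theta> \<in> \<Theta>"
  shows "kappa3_star \<mu> \<xi> \<theta> i j k = partial_derivs [i, j, k] \<Psi> \<theta>"
proof -
  let ?P = "density \<mu> (\<lambda>x. ennreal (expfam \<mu> \<xi> \<theta> x))"
  let ?m = "\<lambda>i. mean [i] \<theta>"
  note int = expect_expfam(2)[OF \<theta>]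
  note ev = expect_expfam(1)[OF \<theta>, unfolded expect_def]
  have one: "(\<integral>x. (1::real) \<partial>?P) = 1"
    using ev[of "[]"] raw_Nil_pos[OF \<theta>] by (simp add: mean_def)
  have int1: "integrable ?P (\<lambda>x. 1::real)" using int[of "[]"] by simp
  have "kappa3_star \<mu> \<xi> \<theta> i j k = (\<integral>x. (\<Prod>i\<leftarrow>[i,j,k]. \<xi> i x) - ?m i * (\<Prod>i\<leftarrow>[j,k]. \<xi> i x)
      - ?m j * (\<Prod>i\<leftarrow>[i,k]. \<xi> i x) - ?m k * (\<Prod>i\<leftarrow>[i,j]. \<xi> i x)
      + ?m i * ?m j * (\<Prod>i\<leftarrow>[k]. \<xi> i x) + ?m i * ?m k * (\<Prod>i\<leftarrow>[j]. \<xi> i x) + ?m j * ?m k * (\<Prod>i\<leftarrow>[i]. \<xi> i x)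
      - ?m i * ?m j * ?m k * 1 \<partial>?P)"
    unfolding kappa3_star_def kappa3_def expect_def eta_star_mean[OF \<theta>]
    by (intro Bochner_Integration.integral_cong refl) (simp add: algebra_simps)
  also have "\<dots> = mean [i,j,k] \<theta> - ?m i * mean [j,k] \<theta> - ?m j * mean [i,k] \<theta> - ?m k * mean [i,j] \<theta>
      + ?m i * ?m j * ?m k + ?m i * ?m k * ?m j + ?m j * ?m k * ?m i - ?m i * ?m j * ?m k * 1"
    by (simp only: Bochner_Integration.integral_diff Bochner_Integration.integral_add
      Bochner_Integration.integrable_diff Bochner_Integration.integrable_add
      integrable_mult_right integral_mult_right_zero int int1 ev one)
  also have "\<dots> = partial_derivs [i, j, k] \<Psi> \<theta>"
    by (simp add: partial_derivs_3[OF \<theta>] algebra_simps del: partial_derivs.simps)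
  finally show ?thesis .
qed

text \<open>The log density ratio is affine in the statistics, so the divergence is the gap between the log
  partition function and its tangent plane.\<close>

lemma KL_div_expfam:
  assumes "\<theta> \<in> \<Theta>" "\<theta>' \<in> \<Theta>"
  shows "KL_div \<mu> (expfam \<mu> \<xi> \<theta>) (expfam \<mu> \<xi> \<theta>') =
      \<Psi> \<theta>' - \<Psi> \<theta> - (\<Sum>i\<in>UNIV. (\<theta>' - \<theta>) $ i * mean [i] \<theta>)"
    and "0 \<le> KL_div \<mu> (expfam \<mu> \<xi> \<theta>) (expfam \<mu> \<xi> \<theta>')"
proof -
  let ?f = "expfam \<mu> \<xi> \<theta>" and ?g = "expfam \<mu> \<xi> \<theta>'"
  have ln: "ln (?f x / ?g x) = (\<Psi> \<theta>' - \<Psi> \<theta>) - (\<Sum>i\<in>UNIV. (\<theta>' - \<theta>) $ i * \<xi> i x)" for x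
    by (simp add: ln_div expfam_pos) (simp add: expfam_def algebra_simps sum_subtractf)
  have int: "integrable \<mu> (\<lambda>x. ?f x * \<xi> i x)" "(\<integral>x. ?f x * \<xi> i x \<partial>\<mu>) = mean [i] \<theta>" for i
    using expect_expfam[OF assms(1), of "[i]"] unfolding expect_def
    by (auto simp: integrable_density integral_density expfam_pos less_imp_le)
  have eq: "?f x * ln (?f x / ?g x) = (\<Psi> \<theta>' - \<Psi> \<theta>) * ?f x - (\<Sum>i\<in>UNIV. (\<theta>' - \<theta>) $ i * (?f x * \<xi> i x))" for x
    unfolding ln by (simp add: algebra_simps sum_distrib_left)
  have KL_int: "integrable \<mu> (\<lambda>x. ?f x * ln (?f x / ?g x))"
    unfolding eq
    by (intro Bochner_Integration.integrable_diff Bochner_Integration.integrable_sum integrable_mult_right int expfam_integral assms)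
  show "KL_div \<mu> ?f ?g = \<Psi> \<theta>' - \<Psi> \<theta> - (\<Sum>i\<in>UNIV. (\<theta>' - \<theta>) $ i * mean [i] \<theta>)"
    unfolding KL_div_def eq
    by (subst Bochner_Integration.integral_diff)
      (auto simp: int expfam_integral assms intro!: Bochner_Integration.integrable_sum integrable_mult_right)
  have "0 = (\<integral>x. ?f x - ?g x \<partial>\<mu>)"
    using expfam_integral[OF assms(1)] expfam_integral[OF assms(2)] by simp
  also have "\<dots> \<le> KL_div \<mu> ?f ?g"
    unfolding KL_div_def
  proof (rule integral_mono[OF _ KL_int])
    show "integrable \<mu> (\<lambda>x. ?f x - ?g x)"
      using expfam_integral assms by (intro Bochner_Integration.integrable_diff) auto
    fix x
    have "ln (?g x / ?f x) \<le> ?g x / ?f x - 1"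
      by (rule ln_le_minus_one) (simp add: expfam_pos)
    then have "1 - ?g x / ?f x \<le> ln (?f x / ?g x)"
      using expfam_pos[of \<theta> x] expfam_pos[of \<theta>' x] by (simp add: ln_div)
    then have "?f x * (1 - ?g x / ?f x) \<le> ?f x * ln (?f x / ?g x)"
      using expfam_pos[of \<theta> x] by (intro mult_left_mono) auto
    then show "?f x - ?g x \<le> ?f x * ln (?f x / ?g x)"
      using expfam_pos[of \<theta> x] by (simp add: algebra_simps)
  qed
  finally show "0 \<le> KL_div \<mu> ?f ?g" .
qed

end

section \<open>The global comparison of the divergence with its main part\<close>

lemma smooth_on_taylor_graded:
  fixes f :: "real^'p::finite \<Rightarrow> real"
  assumes "open S" "\<theta> \<in> S" "smooth_on S f"
  shows "graded n (\<lambda>h. f (\<theta> + h) -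
    (\<Sum>k<n. (\<Sum>is | length is = k. partial_derivs is f \<theta> * (\<Prod>i\<leftarrow>is. h $ i)) / fact k))"
proof -
  define T where "T k h = (\<Sum>is | length is = k. partial_derivs is f \<theta> * (\<Prod>i\<leftarrow>is. h $ i)) / fact k"
    for k and h :: "real^'p"
  have "vanishing (Suc n) (\<lambda>h. f (\<theta> + h) - (\<Sum>k<Suc n. T k h))"
    unfolding T_def using assms by (intro smooth_on_taylor) auto
  moreover have "homogeneous n (T n)"
  proof -
    have "homogeneous n (\<lambda>h. 1 / fact n *
        (\<Sum>is | length is = n. partial_derivs is f \<theta> * (\<Prod>i\<leftarrow>is. h $ i)))"
      by (rule homogeneous_cmult, rule homogeneous_sum) (use homogeneous.monomial in blast)
    then show ?thesis by (simp add: T_def[abs_def])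
  qed
  ultimately have "graded n (\<lambda>h. (f (\<theta> + h) - (\<Sum>k<Suc n. T k h)) + T n h)"
    by (intro graded_add vanishing_graded homogeneous_graded)
  then show ?thesis by (simp add: T_def)
qed

lemmas taylor_sum_simps = sum_lists_length_0 sum_lists_length_Suc lessThan_Suc eval_nat_numeral

context exp_family
begin

text \<open>At the maximum likelihood estimate the shift of the gradient is the mean score, and the Bregman
  gap is the divergence.\<close>

definition score_shift :: "real^'p \<Rightarrow> real^'p \<Rightarrow> real^'p" where
  "score_shift \<theta> h = (\<chi> i. partial_derivs [i] \<Psi> (\<theta> + h) - partial_derivs [i] \<Psi> \<theta>)"

definition bregman :: "real^'p \<Rightarrow> real^'p \<Rightarrow> real" where
  "bregman \<theta> h = \<Psi> (\<theta> + h) - \<Psi> \<theta> - (\<Sum>i\<in>UNIV. h $ i * partial_derivs [i] \<Psi> \<theta>)"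

lemma score_shift_graded:
  assumes "\<theta> \<in> \<Theta>"
  shows "graded 4 (\<lambda>h. score_shift \<theta> h $ i -
    ((\<Sum>j\<in>UNIV. partial_derivs [j, i] \<Psi> \<theta> * h $ j)
     + 1/2 * (\<Sum>j\<in>UNIV. \<Sum>k\<in>UNIV. partial_derivs [j, k, i] \<Psi> \<theta> * (h $ j * h $ k))
     + 1/6 * (\<Sum>j\<in>UNIV. \<Sum>k\<in>UNIV. \<Sum>l\<in>UNIV. partial_derivs [j, k, l, i] \<Psi> \<theta> * (h $ j * h $ k * h $ l))))"
  using smooth_on_taylor_graded[OF open_Theta assms smooth_on_partial_derivs[OF log_partition_smooth, of "[i]"], of 4]
  by (simp add: taylor_sum_simps score_shift_def algebra_simps)

lemma bregman_graded:
  assumes "\<theta> \<in> \<Theta>"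
  shows "graded 5 (\<lambda>h. bregman \<theta> h -
    (1/2 * (\<Sum>i\<in>UNIV. \<Sum>j\<in>UNIV. partial_derivs [i, j] \<Psi> \<theta> * (h $ i * h $ j))
     + 1/6 * (\<Sum>i\<in>UNIV. \<Sum>j\<in>UNIV. \<Sum>k\<in>UNIV. partial_derivs [i, j, k] \<Psi> \<theta> * (h $ i * h $ j * h $ k))
     + 1/24 * (\<Sum>i\<in>UNIV. \<Sum>j\<in>UNIV. \<Sum>k\<in>UNIV. \<Sum>l\<in>UNIV.
         partial_derivs [i, j, k, l] \<Psi> \<theta> * (h $ i * h $ j * h $ k * h $ l))))"
  using smooth_on_taylor_graded[OF open_Theta assms log_partition_smooth, of 5]
  by (simp add: taylor_sum_simps bregman_def algebra_simps)

end

lemma (in divergence_expansion) main_part_bound: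
  "\<exists>B\<ge>0. \<forall>y. \<bar>main_part y\<bar> \<le> B * (norm y ^ 2 + norm y ^ 3 + norm y ^ 4)"
proof -
  have h2: "homogeneous 2 (\<lambda>y. form2 y y)"
    unfolding form2_def by (intro homogeneous_sum homogeneous_cmult homogeneous_coord_products)
  have h3: "homogeneous 3 (\<lambda>y. form3 y y y)"
    unfolding form3_def by (intro homogeneous_sum homogeneous_cmult homogeneous_coord_products)
  have h4: "homogeneous 4 (\<lambda>y. 3/8 * grad3_sq y + (-1/8) * form4 y)"
    by (intro homogeneous.add homogeneous_cmult grad3_sq_homogeneous form4_homogeneous)
  obtain B2 where B2: "B2 \<ge> 0" "\<And>y. \<bar>1/2 * form2 y y\<bar> \<le> B2 * norm y ^ 2"
    using homogeneous_bound[OF homogeneous_cmult[OF h2, of "1/2"]] by blast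
  obtain B3 where B3: "B3 \<ge> 0" "\<And>y. \<bar>(-1/3) * form3 y y y\<bar> \<le> B3 * norm y ^ 3"
    using homogeneous_bound[OF homogeneous_cmult[OF h3, of "-1/3"]] by blast
  obtain B4 where B4: "B4 \<ge> 0" "\<And>y. \<bar>3/8 * grad3_sq y + (-1/8) * form4 y\<bar> \<le> B4 * norm y ^ 4"
    using homogeneous_bound[OF h4] by blast
  show ?thesis
  proof (intro exI[of _ "B2 + B3 + B4"] conjI allI)
    fix y
    have "\<bar>main_part y\<bar> \<le> \<bar>1/2 * form2 y y\<bar> + \<bar>(-1/3) * form3 y y y\<bar> + \<bar>3/8 * grad3_sq y + (-1/8) * form4 y\<bar>"
      unfolding main_part_def by linarith
    also have "\<dots> \<le> B2 * norm y ^ 2 + B3 * norm y ^ 3 + B4 * norm y ^ 4"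
      by (intro add_mono B2 B3 B4)
    also have "\<dots> \<le> (B2 + B3 + B4) * norm y ^ 2 + (B2 + B3 + B4) * norm y ^ 3 + (B2 + B3 + B4) * norm y ^ 4"
      using B2 B3 B4 by (intro add_mono mult_right_mono) auto
    finally show "\<bar>main_part y\<bar> \<le> (B2 + B3 + B4) * (norm y ^ 2 + norm y ^ 3 + norm y ^ 4)"
      by (simp add: algebra_simps)
  qed (use B2 B3 B4 in auto)
qed

text \<open>Away from the origin, missing powers can be supplied by the first variable.\<close>

lemma lower_power_le_sixth:
  fixes a b \<delta> :: real
  assumes "0 < \<delta>" "\<delta> \<le> a" "0 \<le> b" "k \<le> 6" "j \<le> k"
  shows "a ^ j * b ^ (k - j) \<le> (1 / \<delta>) ^ (6 - k) * (a ^ 6 + b ^ 6)"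
proof -
  define m where "m = max a b"
  have a: "a > 0" using assms by simp
  have "a ^ j * b ^ (k - j) * \<delta> ^ (6 - k) \<le> m ^ j * m ^ (k - j) * m ^ (6 - k)"
    using assms a by (intro mult_mono power_mono) (auto simp: m_def)
  also have "\<dots> = m ^ 6"
    using assms by (simp add: power_add[symmetric])
  also have "\<dots> \<le> a ^ 6 + b ^ 6"
    using assms a by (auto simp: m_def max_def)
  finally show ?thesis using assms by (simp add: field_simps power_divide)
qed

text \<open>Near the origin this is the local expansion. Where the parameter error \<open>h\<close> is not small, only
  \<open>0 \<le> D h \<le> h \<bullet> z h\<close> is known, but then each term is bounded by sixth powers because \<open>h\<close> is
  bounded below there.\<close>

theorem (in divergence_expansion) global_remainder:
  fixes z :: "real^'p \<Rightarrow> real^'p" and D :: "real^'p \<Rightarrow> real"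
  assumes z: "\<And>i. graded 4 (\<lambda>h. z h $ i - ((G *v h) $ i + 1/2 * grad3 h $ i + 1/6 * grad4 h $ i))"
    and D: "graded 5 (\<lambda>h. D h - (1/2 * form2 h h + 1/6 * form3 h h h + 1/24 * form4 h))"
  shows "\<exists>r C. homogeneous 5 r \<and> (\<forall>h. 0 \<le> D h \<longrightarrow> D h \<le> h \<bullet> z h \<longrightarrow>
    \<bar>D h - main_part (H *v z h) - r (H *v z h)\<bar> \<le> C * (norm h ^ 6 + norm (H *v z h) ^ 6))"
proof -
  define y where "y h = H *v z h" for h
  define R where "R h = D h - main_part (y h)" for h
  obtain r where r: "homogeneous 5 r" "vanishing (Suc 5) (\<lambda>h. R h - r h)"
    using main_part_expansion(2)[OF z D] unfolding graded_def R_def y_def by blast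
  have "graded (Suc 5) (\<lambda>h. r (y h) - r h)"
    by (rule homogeneous_perturb[OF _ r(1)]) (simp add: y_def main_part_expansion(1)[OF z D])
  from sum_in_bigo(2)[OF r(2) graded_vanishing[OF this]]
  have "vanishing 6 (\<lambda>h. R h - r (y h))" by simp
  then obtain C1 where "\<forall>\<^sub>F h in nhds 0. \<bar>R h - r (y h)\<bar> \<le> C1 * norm h ^ 6"
    by (auto elim!: landau_o.bigE)
  then obtain \<delta> where \<delta>: "\<delta> > 0" "\<And>h. norm h < \<delta> \<Longrightarrow> \<bar>R h - r (y h)\<bar> \<le> C1 * norm h ^ 6"
    by (auto simp: eventually_nhds_metric dist_norm)
  obtain B where B: "B \<ge> 0" "\<And>y. \<bar>main_part y\<bar> \<le> B * (norm y ^ 2 + norm y ^ 3 + norm y ^ 4)"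
    using main_part_bound by blast
  obtain B5 where B5: "B5 \<ge> 0" "\<And>y. \<bar>r y\<bar> \<le> B5 * norm y ^ 5"
    using homogeneous_bound[OF r(1)] by blast
  obtain BG where BG: "BG > 0" "\<And>v. norm (G *v v) \<le> norm v * BG"
    using bounded_linear.pos_bounded[OF matrix_vector_mul_bounded_linear[of G]] by blast
  define q where "q k = (1 / \<delta>) ^ (6 - k)" for k :: nat
  have q: "q k \<ge> 0" for k using \<delta>(1) by (simp add: q_def)
  define C2 where "C2 = BG * q 2 + B * (q 2 + q 3 + q 4) + B5 * q 5"
  have C2: "C2 \<ge> 0" using BG B B5 q by (simp add: C2_def)
  show ?thesis
  proof (intro exI[of _ r] exI[of _ "\<bar>C1\<bar> + C2"] conjI r(1) allI impI)
    fix h assume Dh: "0 \<le> D h" "D h \<le> h \<bullet> z h"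
    let ?s = "norm h ^ 6 + norm (y h) ^ 6"
    have s: "?s \<ge> 0" by simp
    have "\<bar>R h - r (y h)\<bar> \<le> (\<bar>C1\<bar> + C2) * ?s"
    proof (cases "norm h < \<delta>")
      case True
      have "\<bar>R h - r (y h)\<bar> \<le> C1 * norm h ^ 6" using \<delta>(2)[OF True] .
      also have "\<dots> \<le> (\<bar>C1\<bar> + C2) * ?s"
        using C2 by (intro mult_mono) auto
      finally show ?thesis .
    next
      case False
      then have far: "\<delta> \<le> norm h" by simp
      have low: "norm h ^ j * norm (y h) ^ (k - j) \<le> q k * ?s" if "k \<le> 6" "j \<le> k" for j k
        unfolding q_def using lower_power_le_sixth[OF \<delta>(1) far norm_ge_zero that] .
      have z_y: "z h = G *v y h"
        by (simp add: y_def matrix_vector_mul_assoc GH)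
      have "\<bar>D h\<bar> \<le> norm h * norm (z h)"
        using Dh Cauchy_Schwarz_ineq2[of h "z h"] by simp
      also have "\<dots> \<le> norm h * (norm (y h) * BG)"
        unfolding z_y by (intro mult_left_mono BG) auto
      also have "\<dots> = BG * (norm h ^ 1 * norm (y h) ^ (2 - 1))" by simp
      also have "\<dots> \<le> BG * (q 2 * ?s)"
        using BG(1) by (intro mult_left_mono low) auto
      finally have D_le: "\<bar>D h\<bar> \<le> BG * (q 2 * ?s)" .
      have "\<bar>main_part (y h)\<bar> \<le> B * (norm (y h) ^ 2 + norm (y h) ^ 3 + norm (y h) ^ 4)"
        by (rule B)
      also have "\<dots> \<le> B * (q 2 * ?s + q 3 * ?s + q 4 * ?s)"
        using low[of 2 0] low[of 3 0] low[of 4 0] B(1) by (intro mult_left_mono add_mono) simp_all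
      finally have P_le: "\<bar>main_part (y h)\<bar> \<le> B * (q 2 * ?s + q 3 * ?s + q 4 * ?s)" .
      have "\<bar>r (y h)\<bar> \<le> B5 * (q 5 * ?s)"
        by (rule order.trans[OF B5(2)]) (use mult_left_mono[OF low[of 5 0] B5(1)] in simp)
      then have "\<bar>R h - r (y h)\<bar> \<le> C2 * ?s"
        unfolding R_def C2_def using D_le P_le by (simp add: algebra_simps)
      also have "\<dots> \<le> (\<bar>C1\<bar> + C2) * ?s"
        by (intro mult_right_mono s) simp
      finally show ?thesis .
    qed
    then show "\<bar>D h - main_part (H *v z h) - r (H *v z h)\<bar> \<le> (\<bar>C1\<bar> + C2) * (norm h ^ 6 + norm (H *v z h) ^ 6)"
      by (simp add: R_def y_def)
  qed
qed

lemma norm_power6_le_sum: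
  fixes v :: "real^'p::finite"
  shows "norm v ^ 6 \<le> real CARD('p) ^ 6 * (\<Sum>i\<in>UNIV. (v $ i) ^ 6)"
proof -
  obtain i where i: "\<And>j. \<bar>v $ j\<bar> \<le> \<bar>v $ i\<bar>"
    using finite_index_max[of "\<lambda>j. \<bar>v $ j\<bar>"] by blast
  have "norm v \<le> (\<Sum>j\<in>UNIV. \<bar>v $ j\<bar>)" by (rule norm_le_l1_cart)
  also have "\<dots> \<le> real CARD('p) * \<bar>v $ i\<bar>"
    using sum_bounded_above[of UNIV "\<lambda>j. \<bar>v $ j\<bar>" "\<bar>v $ i\<bar>"] i by simp
  finally have "norm v ^ 6 \<le> (real CARD('p) * \<bar>v $ i\<bar>) ^ 6"
    by (intro power_mono) auto
  also have "\<dots> = real CARD('p) ^ 6 * (v $ i) ^ 6"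
    by (simp add: power_mult_distrib)
  also have "(v $ i) ^ 6 \<le> (\<Sum>i\<in>UNIV. (v $ i) ^ 6)"
    by (rule member_le_sum) auto
  finally show ?thesis by (simp add: mult_left_mono)
qed

section \<open>Joint moments of sums of independent centred variables\<close>

locale iid_centred = prob_space M for M :: "'w measure" +
  fixes N :: "'a measure" and X :: "nat \<Rightarrow> 'w \<Rightarrow> 'a" and f :: "'i \<Rightarrow> 'a \<Rightarrow> real"
    and \<nu> :: "'i list \<Rightarrow> real"
  assumes indep: "indep_vars (\<lambda>_. N) X UNIV"
    and f_measurable: "f i \<in> borel_measurable N"
    and summand_integrable: "length is \<le> 5 \<Longrightarrow> integrable M (\<lambda>\<omega>. \<Prod>i\<leftarrow>is. f i (X a \<omega>))"
    and summand_moment: "length is \<le> 5 \<Longrightarrow> expectation (\<lambda>\<omega>. \<Prod>i\<leftarrow>is. f i (X a \<omega>)) = \<nu> is"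
    and centred: "\<nu> [i] = 0"
begin

definition partial_sum :: "nat \<Rightarrow> 'i \<Rightarrow> 'w \<Rightarrow> real" where
  "partial_sum n i \<omega> = (\<Sum>a<n. f i (X a \<omega>))"

definition sum_moment :: "nat \<Rightarrow> 'i list \<Rightarrow> real" where
  "sum_moment n is = expectation (\<lambda>\<omega>. \<Prod>i\<leftarrow>is. partial_sum n i \<omega>)"

text \<open>Intermediate stage of multiplying out \<open>\<Prod>(S\<^sub>n + Z\<^sub>n)\<close>, where
  \<open>S\<^sub>n\<close> is the partial sum and \<open>Z\<^sub>n\<close> the next summand: the factors listed in \<open>bs\<close> have been
  assigned to \<open>S\<^sub>n\<close>, those in \<open>cs\<close> to \<open>Z\<^sub>n\<close>, and those in \<open>is\<close> are still undecided.\<close>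

definition split_prod :: "nat \<Rightarrow> 'i list \<Rightarrow> 'i list \<Rightarrow> 'i list \<Rightarrow> 'w \<Rightarrow> real" where
  "split_prod n bs cs is \<omega> =
     (\<Prod>i\<leftarrow>bs. partial_sum n i \<omega>) * (\<Prod>i\<leftarrow>cs. f i (X n \<omega>)) * (\<Prod>i\<leftarrow>is. partial_sum (Suc n) i \<omega>)"

lemma split_prod_Cons:
  "split_prod n bs cs (i # is) \<omega> = split_prod n (bs @ [i]) cs is \<omega> + split_prod n bs (cs @ [i]) is \<omega>"
  by (simp add: split_prod_def partial_sum_def algebra_simps)

text \<open>Joint moments of the partial sums are computed by adding one observation at a time. This rests
  on the independence of the next observation from the sums of all previous ones, jointly over the
  coordinates.\<close>

lemma indep_past_present:
  "indep_var borel (\<lambda>\<omega>. \<Prod>i\<leftarrow>bs. partial_sum n i \<omega>) borel (\<lambda>\<omega>. \<Prod>i\<leftarrow>cs. f i (X n \<omega>))"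
proof -
  have 1: "(\<lambda>x. \<Prod>i\<leftarrow>bs. \<Sum>a<n. f i (x a)) \<in> borel_measurable (PiM {..<n} (\<lambda>_. N))"
  proof (induction bs)
    case (Cons i bs)
    have "(\<lambda>x. \<Sum>a<n. f i (x a)) \<in> borel_measurable (PiM {..<n} (\<lambda>_. N))"
      by (intro borel_measurable_sum measurable_compose[OF _ f_measurable] measurable_component_singleton) auto
    with Cons show ?case by simp
  qed simp
  have 2: "(\<lambda>x. \<Prod>i\<leftarrow>cs. f i (x n)) \<in> borel_measurable (PiM {n} (\<lambda>_. N))"
  proof (induction cs)
    case (Cons i cs)
    have "(\<lambda>x. f i (x n)) \<in> borel_measurable (PiM {n} (\<lambda>_. N))"
      by (intro measurable_compose[OF _ f_measurable] measurable_component_singleton) auto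
    with Cons show ?case by simp
  qed simp
  have "indep_var borel ((\<lambda>x. \<Prod>i\<leftarrow>bs. \<Sum>a<n. f i (x a)) \<circ> (\<lambda>\<omega>. restrict (\<lambda>a. X a \<omega>) {..<n}))
      borel ((\<lambda>x. \<Prod>i\<leftarrow>cs. f i (x n)) \<circ> (\<lambda>\<omega>. restrict (\<lambda>a. X a \<omega>) {n}))"
    by (rule indep_var_compose[OF indep_var_restrict[OF indep] 1 2]) auto
  then show ?thesis
    by (simp add: comp_def partial_sum_def)
qed

lemma split_prod_integrable:
  assumes "\<And>is. length is \<le> 5 \<Longrightarrow> integrable M (\<lambda>\<omega>. \<Prod>i\<leftarrow>is. partial_sum n i \<omega>)"
    and "length bs + length cs + length is \<le> 5"
  shows "integrable M (split_prod n bs cs is)"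
  using assms(2)
proof (induction "is" arbitrary: bs cs)
  case Nil
  have "integrable M (\<lambda>\<omega>. (\<Prod>i\<leftarrow>bs. partial_sum n i \<omega>) * (\<Prod>i\<leftarrow>cs. f i (X n \<omega>)))"
    using Nil by (intro indep_var_integrable indep_past_present assms(1) summand_integrable) auto
  then show ?case by (simp add: split_prod_def[abs_def])
next
  case (Cons i "is")
  have "integrable M (\<lambda>\<omega>. split_prod n (bs @ [i]) cs is \<omega> + split_prod n bs (cs @ [i]) is \<omega>)"
    using Cons.prems by (intro Bochner_Integration.integrable_add Cons.IH) auto
  then show ?case by (simp add: split_prod_Cons[abs_def])
qed

lemma partial_sum_integrable:
  "length is \<le> 5 \<Longrightarrow> integrable M (\<lambda>\<omega>. \<Prod>i\<leftarrow>is. partial_sum n i \<omega>)"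
proof (induction n arbitrary: "is")
  case 0
  have "(\<lambda>\<omega>. \<Prod>i\<leftarrow>is. partial_sum 0 i \<omega>) = (\<lambda>\<omega>. \<Prod>i\<leftarrow>is. 0)"
    by (simp add: partial_sum_def)
  then show ?case by simp
next
  case (Suc n)
  have "integrable M (split_prod n [] [] is)"
    using Suc by (intro split_prod_integrable) auto
  then show ?case by (simp add: split_prod_def[abs_def])
qed

lemma expectation_split_prod_Cons:
  assumes "length bs + length cs + length is < 5"
  shows "expectation (split_prod n bs cs (i # is)) =
    expectation (split_prod n (bs @ [i]) cs is) + expectation (split_prod n bs (cs @ [i]) is)"
  using assms unfolding split_prod_Cons[abs_def]
  by (intro Bochner_Integration.integral_add split_prod_integrable partial_sum_integrable) auto

lemma expectation_split_prod_Nil: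
  assumes "length bs + length cs \<le> 5"
  shows "expectation (split_prod n bs cs []) = sum_moment n bs * \<nu> cs"
proof -
  have "expectation (\<lambda>\<omega>. (\<Prod>i\<leftarrow>bs. partial_sum n i \<omega>) * (\<Prod>i\<leftarrow>cs. f i (X n \<omega>)))
      = sum_moment n bs * expectation (\<lambda>\<omega>. \<Prod>i\<leftarrow>cs. f i (X n \<omega>))"
    unfolding sum_moment_def using assms
    by (intro indep_var_lebesgue_integral indep_past_present partial_sum_integrable summand_integrable) auto
  then show ?thesis using assms by (simp add: split_prod_def[abs_def] summand_moment)
qed

lemma sum_moment_Suc: "sum_moment (Suc n) is = expectation (split_prod n [] [] is)"
  by (simp add: sum_moment_def split_prod_def[abs_def])

lemma sum_moment_Nil: "sum_moment n [] = 1" "\<nu> [] = 1"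
  using summand_moment[of "[]"] by (simp_all add: sum_moment_def prob_space)

lemma sum_moment_0: "sum_moment 0 (i # is) = 0"
  by (simp add: sum_moment_def partial_sum_def)

lemmas moment_step = sum_moment_Suc expectation_split_prod_Cons expectation_split_prod_Nil
  sum_moment_Nil centred

lemma sum_moment_1: "sum_moment n [i] = 0"
  by (induction n) (simp_all add: sum_moment_0 moment_step)

lemma sum_moment_2: "sum_moment n [i, j] = real n * \<nu> [i, j]"
  by (induction n) (simp_all add: sum_moment_0 moment_step sum_moment_1 algebra_simps)

lemma sum_moment_3: "sum_moment n [i, j, k] = real n * \<nu> [i, j, k]"
  by (induction n) (simp_all add: sum_moment_0 moment_step sum_moment_1 sum_moment_2 algebra_simps)

text \<open>The increment from \<open>n\<close> to \<open>n + 1\<close> is the fourth moment of one summand plus six products of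
  a second moment of the sum and one of the summand; each of the three pairings occurs twice, and
  summation gives the factor \<open>n (n - 1)\<close>.\<close>

lemma sum_moment_4:
  "sum_moment n [i, j, k, l] = real n * \<nu> [i, j, k, l] + real n * (real n - 1) *
     (\<nu> [i, j] * \<nu> [k, l] + \<nu> [i, k] * \<nu> [j, l] + \<nu> [i, l] * \<nu> [j, k])"
  by (induction n)
    (simp_all add: sum_moment_0 moment_step sum_moment_1 sum_moment_2 sum_moment_3 algebra_simps)

text \<open>A product of five centred factors can only survive if the summands group into a pair and a
  triple or all coincide, so the fifth moment grows quadratically rather than with the power
  \<open>5/2\<close>. This is why terms of degree five contribute only at third order to the risk.\<close>

lemma sum_moment_5:
  "\<exists>A. \<forall>n. sum_moment n [i, j, k, l, m] = real n * \<nu> [i, j, k, l, m] + real n * (real n - 1) * A"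
proof -
  obtain A where step: "\<And>n. sum_moment (Suc n) [i, j, k, l, m] =
      sum_moment n [i, j, k, l, m] + \<nu> [i, j, k, l, m] + 2 * real n * A"
  proof
    fix n
    show "sum_moment (Suc n) [i, j, k, l, m] =
      sum_moment n [i, j, k, l, m] + \<nu> [i, j, k, l, m] + 2 * real n *
      (\<nu> [i,j,k] * \<nu> [l,m] + \<nu> [i,j,l] * \<nu> [k,m] + \<nu> [i,j,m] * \<nu> [k,l] + \<nu> [i,k,l] * \<nu> [j,m] +
       \<nu> [i,k,m] * \<nu> [j,l] + \<nu> [i,l,m] * \<nu> [j,k] + \<nu> [j,k,l] * \<nu> [i,m] + \<nu> [j,k,m] * \<nu> [i,l] +
       \<nu> [j,l,m] * \<nu> [i,k] + \<nu> [k,l,m] * \<nu> [i,j])"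
      by (simp add: moment_step sum_moment_1 sum_moment_2 sum_moment_3 algebra_simps)
  qed
  have "sum_moment n [i, j, k, l, m] = real n * \<nu> [i, j, k, l, m] + real n * (real n - 1) * A" for n
    by (induction n) (simp_all add: sum_moment_0 step algebra_simps)
  then show ?thesis by blast
qed

end

section \<open>Consequences of the estimation setting\<close>

context exp_family
begin

lemma ln_expfam: "ln (expfam \<mu> \<xi> \<theta> x) = (\<Sum>i\<in>UNIV. \<theta> $ i * \<xi> i x) - \<Psi> \<theta>"
  by (simp add: expfam_def)

lemma linear_has_partials: "has_partials (\<lambda>\<theta>. \<Sum>i\<in>UNIV. \<theta> $ i * m i) m \<theta>"
  unfolding has_partials_def
  by (intro bounded_linear_imp_has_derivative bounded_linear_sum bounded_linear_mult_const bounded_linear_vec_nth)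

text \<open>Used twice: for the likelihood, with \<open>m\<close> the sample mean of the statistics, and for the
  divergence from the true density, with \<open>m\<close> their expectation.\<close>

lemma tilted_maximum_gradient:
  assumes "\<theta> \<in> \<Theta>"
    and max: "\<And>\<theta>'. \<theta>' \<in> \<Theta> \<Longrightarrow>
      (\<Sum>i\<in>UNIV. \<theta>' $ i * m i) - \<Psi> \<theta>' \<le> (\<Sum>i\<in>UNIV. \<theta> $ i * m i) - \<Psi> \<theta>"
  shows "partial_derivs [i] \<Psi> \<theta> = m i"
proof -
  have "has_partials (\<lambda>\<theta>. (\<Sum>i\<in>UNIV. \<theta> $ i * m i) - \<Psi> \<theta>) (\<lambda>j. m j - mean [j] \<theta>) \<theta>"
    by (intro has_partials_diff linear_has_partials log_partition_has_partials assms(1))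
  then have "(\<lambda>h. \<Sum>j\<in>UNIV. h $ j * (m j - mean [j] \<theta>)) = (\<lambda>v. 0)"
    unfolding has_partials_def using max
    by (intro differential_zero_maxmin[OF assms(1) open_Theta]) auto
  then have "(\<Sum>j\<in>UNIV. axis i 1 $ j * (m j - mean [j] \<theta>)) = 0" by metis
  then show ?thesis
    using partial_derivs_1[OF assms(1), of i]
    by (simp add: axis_def if_distrib[of "\<lambda>x. x * _"] cong: if_cong)
qed

lemma mean_score_eq:
  assumes "\<theta> \<in> \<Theta>"
  shows "mean_score \<mu> \<xi> n x i \<theta> = (\<Sum>a<n. \<xi> i (x a) - eta_star \<mu> \<xi> \<theta> i) / real n"
proof -
  have "partial_deriv i (\<lambda>\<theta>'. ln (expfam \<mu> \<xi> \<theta>' y)) \<theta> = \<xi> i y - mean [i] \<theta>" for y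
    unfolding ln_expfam
    by (rule has_partials_partial_deriv, intro has_partials_diff linear_has_partials
      log_partition_has_partials assms)
  then show ?thesis by (simp add: mean_score_def eta_star_mean assms)
qed

text \<open>The first equation is the likelihood equation. The inequality compares the likelihood at the
  estimate with that at the projection; it is the global bound on the divergence.\<close>

lemma mle_score:
  assumes mle: "is_mle \<mu> \<xi> \<Theta> n x \<theta>" and \<theta>s: "\<theta>\<^sub>s \<in> \<Theta>" and n: "0 < n"
  shows "score_shift \<theta>\<^sub>s (\<theta> - \<theta>\<^sub>s) = (\<chi> i. mean_score \<mu> \<xi> n x i \<theta>\<^sub>s)"
    and "bregman \<theta>\<^sub>s (\<theta> - \<theta>\<^sub>s) \<le> (\<theta> - \<theta>\<^sub>s) \<bullet> (\<chi> i. mean_score \<mu> \<xi> n x i \<theta>\<^sub>s)"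
proof -
  define m where "m i = (\<Sum>a<n. \<xi> i (x a)) / real n" for i
  have lik: "(\<Sum>a<n. ln (expfam \<mu> \<xi> \<theta>' (x a))) = real n * ((\<Sum>i\<in>UNIV. \<theta>' $ i * m i) - \<Psi> \<theta>')" for \<theta>'
  proof -
    have "(\<Sum>a<n. \<Sum>i\<in>UNIV. \<theta>' $ i * \<xi> i (x a)) = (\<Sum>i\<in>UNIV. real n * (\<theta>' $ i * m i))"
      using n by (subst sum.swap) (simp add: m_def sum_distrib_left[symmetric])
    then show ?thesis
      by (simp add: ln_expfam sum_subtractf right_diff_distrib sum_distrib_left)
  qed
  have \<theta>: "\<theta> \<in> \<Theta>" using mle by (simp add: is_mle_def)
  have max: "(\<Sum>i\<in>UNIV. \<theta>' $ i * m i) - \<Psi> \<theta>' \<le> (\<Sum>i\<in>UNIV. \<theta> $ i * m i) - \<Psi> \<theta>" if "\<theta>' \<in> \<Theta>" for \<theta>'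
    using mle that n unfolding is_mle_def lik by simp
  have ms: "mean_score \<mu> \<xi> n x i \<theta>\<^sub>s = m i - partial_derivs [i] \<Psi> \<theta>\<^sub>s" for i
    using n by (simp add: mean_score_eq[OF \<theta>s] m_def sum_subtractf diff_divide_distrib eta_star_def)
  show "score_shift \<theta>\<^sub>s (\<theta> - \<theta>\<^sub>s) = (\<chi> i. mean_score \<mu> \<xi> n x i \<theta>\<^sub>s)"
    using tilted_maximum_gradient[OF \<theta> max] by (simp add: score_shift_def ms vec_eq_iff)
  show "bregman \<theta>\<^sub>s (\<theta> - \<theta>\<^sub>s) \<le> (\<theta> - \<theta>\<^sub>s) \<bullet> (\<chi> i. mean_score \<mu> \<xi> n x i \<theta>\<^sub>s)"
    using max[OF \<theta>s] by (simp add: bregman_def ms inner_vec_def algebra_simps sum_subtractf sum.distrib)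
qed

lemma KL_div_bregman:
  assumes "\<theta> \<in> \<Theta>" "\<theta>' \<in> \<Theta>"
  shows "KL_div \<mu> (expfam \<mu> \<xi> \<theta>) (expfam \<mu> \<xi> \<theta>') = bregman \<theta> (\<theta>' - \<theta>)"
  by (simp add: KL_div_expfam[OF assms] bregman_def partial_derivs_1[OF assms(1), simplified])

text \<open>Up to a constant, the divergence from \<open>g\<close> is the log partition function minus a linear
  functional given by the expected statistics.\<close>

lemma information_projection_mean:
  assumes proj: "information_projection \<mu> \<xi> \<Theta> g \<theta>\<^sub>s" and g: "prob_density \<mu> g"
    and int: "\<And>i. integrable (density \<mu> (\<lambda>x. ennreal (g x))) (\<xi> i)"
  shows "expect \<mu> g (\<xi> i) = eta_star \<mu> \<xi> \<theta>\<^sub>s i"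
proof -
  let ?P = "density \<mu> (\<lambda>x. ennreal (g x))"
  interpret P: prob_space ?P using g by (simp add: prob_density_def)
  have g_meas[measurable]: "g \<in> borel_measurable \<mu>" and g_nonneg: "AE x in \<mu>. 0 \<le> g x"
    using g by (auto simp: prob_density_def)
  have \<theta>s: "\<theta>\<^sub>s \<in> \<Theta>" using proj by (simp add: information_projection_def)
  have "(\<Sum>i\<in>UNIV. \<theta> $ i * expect \<mu> g (\<xi> i)) - \<Psi> \<theta> \<le> (\<Sum>i\<in>UNIV. \<theta>\<^sub>s $ i * expect \<mu> g (\<xi> i)) - \<Psi> \<theta>\<^sub>s"
    if \<theta>: "\<theta> \<in> \<Theta>" for \<theta>
  proof -
    let ?d = "\<lambda>x. (\<Psi> \<theta> - \<Psi> \<theta>\<^sub>s) - (\<Sum>i\<in>UNIV. (\<theta> - \<theta>\<^sub>s) $ i * \<xi> i x)"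
    have d_meas: "?d \<in> borel_measurable \<mu>" by measurable
    have "KL_div \<mu> g (expfam \<mu> \<xi> \<theta>) - KL_div \<mu> g (expfam \<mu> \<xi> \<theta>\<^sub>s)
       = (\<integral>x. g x * ln (g x / expfam \<mu> \<xi> \<theta> x) - g x * ln (g x / expfam \<mu> \<xi> \<theta>\<^sub>s x) \<partial>\<mu>)"
      using proj \<theta> \<theta>s unfolding KL_div_def information_projection_def
      by (intro Bochner_Integration.integral_diff[symmetric]) auto
    also have "\<dots> = (\<integral>x. g x * ?d x \<partial>\<mu>)"
    proof (rule Bochner_Integration.integral_cong[OF refl])
      fix x assume "x \<in> space \<mu>"
      then have "0 \<le> g x" using g by (simp add: prob_density_def)
      then consider "g x = 0" | "0 < g x" by linarith
      then show "g x * ln (g x / expfam \<mu> \<xi> \<theta> x) - g x * ln (g x / expfam \<mu> \<xi> \<theta>\<^sub>s x) = g x * ?d x"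
        using expfam_pos[of \<theta> x] expfam_pos[of \<theta>\<^sub>s x]
        by cases (simp_all add: ln_div ln_expfam algebra_simps sum_subtractf)
    qed
    also have "\<dots> = (\<integral>x. ?d x \<partial>?P)"
      using integral_density[OF d_meas g_meas g_nonneg] by (simp only: real_scaleR_def)
    also have "\<dots> = (\<Psi> \<theta> - \<Psi> \<theta>\<^sub>s) - (\<Sum>i\<in>UNIV. (\<theta> - \<theta>\<^sub>s) $ i * expect \<mu> g (\<xi> i))"
      using int by (subst Bochner_Integration.integral_diff) (use P.prob_space in \<open>auto simp: expect_def\<close>)
    finally have "KL_div \<mu> g (expfam \<mu> \<xi> \<theta>) - KL_div \<mu> g (expfam \<mu> \<xi> \<theta>\<^sub>s)
        = (\<Psi> \<theta> - \<Psi> \<theta>\<^sub>s) - (\<Sum>i\<in>UNIV. (\<theta> - \<theta>\<^sub>s) $ i * expect \<mu> g (\<xi> i))" .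
    moreover have "KL_div \<mu> g (expfam \<mu> \<xi> \<theta>\<^sub>s) \<le> KL_div \<mu> g (expfam \<mu> \<xi> \<theta>)"
      using proj \<theta> by (simp add: information_projection_def)
    ultimately show ?thesis by (simp add: algebra_simps sum_subtractf)
  qed
  from tilted_maximum_gradient[OF \<theta>s this] show ?thesis by (simp add: eta_star_def)
qed

end

lemma power6_diff_le: "(a - b) ^ 6 \<le> 64 * (a ^ 6 + b ^ 6)" for a b :: real
proof -
  define m where "m = max \<bar>a\<bar> \<bar>b\<bar>"
  have "(a - b) ^ 6 = \<bar>a - b\<bar> ^ 6" by simp
  also have "\<dots> \<le> (2 * m) ^ 6" by (intro power_mono) (auto simp: m_def)
  also have "\<dots> = 64 * m ^ 6" by (simp add: power_mult_distrib)
  also have "m ^ 6 \<le> a ^ 6 + b ^ 6" by (auto simp: m_def max_def)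
  finally show ?thesis by simp
qed

lemma prod_list_le_power6:
  fixes a :: "'p::finite \<Rightarrow> real"
  assumes "length is \<le> 6"
  shows "\<bar>\<Prod>i\<leftarrow>is. a i\<bar> \<le> 1 + (\<Sum>i\<in>UNIV. a i ^ 6)"
proof -
  \<comment> \<open>\<open>s\<close> is at least 1 and bounds every factor.\<close>
  define s where "s = root 6 (1 + (\<Sum>i\<in>UNIV. a i ^ 6))"
  have nonneg: "0 \<le> (\<Sum>i\<in>UNIV. a i ^ 6)" by (intro sum_nonneg) simp
  then have s6: "s ^ 6 = 1 + (\<Sum>i\<in>UNIV. a i ^ 6)" and s1: "1 \<le> s"
    by (simp_all add: s_def real_root_pow_pos2)
  have a: "\<bar>a i\<bar> \<le> s" for i
  proof -
    have "a i ^ 6 \<le> (\<Sum>i\<in>UNIV. a i ^ 6)" by (rule member_le_sum) auto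
    also have "\<dots> \<le> s ^ Suc 5" by (simp add: s6)
    finally have "\<bar>a i\<bar> ^ Suc 5 \<le> s ^ Suc 5" by simp
    then show ?thesis by (rule power_le_imp_le_base) (use s1 in simp)
  qed
  have "\<bar>\<Prod>i\<leftarrow>is. a i\<bar> \<le> s ^ length is"
    using s1 by (induction "is") (auto simp: abs_mult intro!: mult_mono a)
  also have "\<dots> \<le> s ^ 6" using s1 assms by (intro power_increasing) auto
  finally show ?thesis by (simp add: s6)
qed

locale estimation =
  fixes \<mu> :: "'a measure" and \<xi> :: "'p::finite \<Rightarrow> 'a \<Rightarrow> real" and \<Theta> g \<theta>\<^sub>s
    and M :: "'w measure" and X \<theta>\<^sub>h \<theta>\<^sub>t
  assumes setting: "estimation_setting \<mu> \<xi> \<Theta> g \<theta>\<^sub>s M X \<theta>\<^sub>h"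
    and moments: "moment_condition 6 \<mu> \<xi> \<theta>\<^sub>s M X \<theta>\<^sub>h \<theta>\<^sub>t"
begin

sublocale exp_family \<mu> \<xi> \<Theta>
  using setting by unfold_locales (simp add: estimation_setting_def)

sublocale prob_space M
  using setting by (simp add: estimation_setting_def)

lemma theta_s: "\<theta>\<^sub>s \<in> \<Theta>"
  using setting by (simp add: estimation_setting_def information_projection_def)

lemma X_indep: "indep_vars (\<lambda>_. \<mu>) X UNIV"
  and X_distributed: "distributed M \<mu> (X a) (\<lambda>x. ennreal (g x))"
  using setting by (auto simp: estimation_setting_def)

lemma X_measurable[measurable]: "X a \<in> M \<rightarrow>\<^sub>M \<mu>"
  using X_distributed by (rule distributed_measurable)

abbreviation G :: "real^'p^'p" where "G \<equiv> cov_model \<mu> \<xi> \<theta>\<^sub>s"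
abbreviation H :: "real^'p^'p" where "H \<equiv> matrix_inv G"

lemma H_inverse: "H ** G = mat 1" "G ** H = mat 1"
proof -
  have "v = 0" if "G *v v = 0" for v
    using setting that unfolding estimation_setting_def by (metis inner_zero_right less_irrefl)
  then have "invertible G"
    by (simp add: invertible_left_inverse matrix_left_invertible_ker)
  then have "G ** H = mat 1 \<and> H ** G = mat 1"
    unfolding invertible_def matrix_inv_def by (rule someI_ex)
  then show "H ** G = mat 1" "G ** H = mat 1" by auto
qed

sublocale divergence_expansion G H "\<lambda>i j k. partial_derivs [i, j, k] \<Psi> \<theta>\<^sub>s"
    "\<lambda>i j k l. partial_derivs [i, j, k, l] \<Psi> \<theta>\<^sub>s"
proof
  show "G $ i $ j = G $ j $ i" for i j
    using mean_permute[of "[i, j]" "[j, i]"]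
    by (simp add: cov_model_def partial_derivs_2[OF theta_s] del: partial_derivs.simps)
  show "partial_derivs [i, j, k] \<Psi> \<theta>\<^sub>s = partial_derivs [j, i, k] \<Psi> \<theta>\<^sub>s" for i j k
    by (simp add: kappa3_star_partial_derivs[OF theta_s, symmetric] kappa3_star_def kappa3_def mult_ac
      del: partial_derivs.simps)
  show "partial_derivs [i, j, k] \<Psi> \<theta>\<^sub>s = partial_derivs [i, k, j] \<Psi> \<theta>\<^sub>s" for i j k
    by (simp add: kappa3_star_partial_derivs[OF theta_s, symmetric] kappa3_star_def kappa3_def mult_ac
      del: partial_derivs.simps)
qed (fact H_inverse)+

definition err :: "nat \<Rightarrow> 'w \<Rightarrow> real^'p" where
  "err n \<omega> = \<theta>\<^sub>h n \<omega> - \<theta>\<^sub>s"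

definition score :: "nat \<Rightarrow> 'w \<Rightarrow> real^'p" where
  "score n \<omega> = (\<chi> i. mean_score \<mu> \<xi> n (\<lambda>a. X a \<omega>) i \<theta>\<^sub>s)"

definition centred_stat :: "'p \<Rightarrow> 'a \<Rightarrow> real" where
  "centred_stat i x = \<xi> i x - eta_star \<mu> \<xi> \<theta>\<^sub>s i"

lemma score_eq: "score n \<omega> $ i = (\<Sum>a<n. centred_stat i (X a \<omega>)) / real n"
  by (simp add: score_def mean_score_eq[OF theta_s] centred_stat_def)

lemma centred_stat_measurable[measurable]: "centred_stat i \<in> borel_measurable \<mu>"
  unfolding centred_stat_def[abs_def] by measurable

lemma score_measurable[measurable]: "(\<lambda>\<omega>. score n \<omega> $ i) \<in> borel_measurable M"
  unfolding score_eq by measurable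

text \<open>The moment condition for six equal variables.\<close>

lemma sixth_moments:
  obtains C where "\<forall>\<^sub>F n in sequentially. \<forall>s.
      integrable M (\<lambda>\<omega>. (err n \<omega> $ s) ^ 6) \<and> expectation (\<lambda>\<omega>. (err n \<omega> $ s) ^ 6) \<le> C / real n ^ 3 \<and>
      integrable M (\<lambda>\<omega>. ((H *v score n \<omega>) $ s) ^ 6) \<and>
      expectation (\<lambda>\<omega>. ((H *v score n \<omega>) $ s) ^ 6) \<le> C / real n ^ 3"
proof -
  have one: "\<exists>C. \<forall>\<^sub>F n in sequentially. integrable M (\<lambda>\<omega>. V n \<omega> ^ 6) \<and> expectation (\<lambda>\<omega>. V n \<omega> ^ 6) \<le> C / real n ^ 3"
    if V: "\<And>n \<omega>. moment_var \<mu> \<xi> \<theta>\<^sub>s n (\<lambda>a. X a \<omega>) (\<theta>\<^sub>h n \<omega>) (\<theta>\<^sub>t n \<omega>) v = sqrt (real n) * V n \<omega>" for v V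
  proof -
    have sqrt6: "sqrt (real n) ^ 6 = real n ^ 3" for n
      using power_mult[of "sqrt (real n)" 2 3] by simp
    have prod: "(\<Prod>v\<leftarrow>replicate 6 v. moment_var \<mu> \<xi> \<theta>\<^sub>s n (\<lambda>a. X a \<omega>) (\<theta>\<^sub>h n \<omega>) (\<theta>\<^sub>t n \<omega>) v)
        = real n ^ 3 * V n \<omega> ^ 6" for n \<omega>
      by (simp only: map_replicate prod_list_replicate V power_mult_distrib sqrt6)
    note bound = conjunct2[OF moments[unfolded moment_condition_def], rule_format, of "replicate 6 v"]
    obtain C where C: "\<forall>\<^sub>F n in sequentially. integrable M (\<lambda>\<omega>. real n ^ 3 * V n \<omega> ^ 6) \<and>
        \<bar>expectation (\<lambda>\<omega>. real n ^ 3 * V n \<omega> ^ 6)\<bar> \<le> C"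
      using bound unfolding prod length_replicate by (meson order_refl)
    have "\<forall>\<^sub>F n in sequentially. integrable M (\<lambda>\<omega>. V n \<omega> ^ 6) \<and> expectation (\<lambda>\<omega>. V n \<omega> ^ 6) \<le> C / real n ^ 3"
      using C eventually_gt_at_top[of 0]
    proof eventually_elim
      case (elim n)
      then have "integrable M (\<lambda>\<omega>. V n \<omega> ^ 6)" by simp
      moreover have "real n ^ 3 * expectation (\<lambda>\<omega>. V n \<omega> ^ 6) \<le> C"
        using elim by simp
      ultimately show ?case using elim by (simp add: field_simps)
    qed
    then show ?thesis by blast
  qed
  have "\<forall>s. \<exists>C. \<forall>\<^sub>F n in sequentially. integrable M (\<lambda>\<omega>. (err n \<omega> $ s) ^ 6) \<and>
      expectation (\<lambda>\<omega>. (err n \<omega> $ s) ^ 6) \<le> C / real n ^ 3"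
  proof
    fix s
    show "\<exists>C. \<forall>\<^sub>F n in sequentially. integrable M (\<lambda>\<omega>. (err n \<omega> $ s) ^ 6) \<and>
      expectation (\<lambda>\<omega>. (err n \<omega> $ s) ^ 6) \<le> C / real n ^ 3"
      by (rule one[of "Par s" "\<lambda>n \<omega>. err n \<omega> $ s"]) (simp add: err_def)
  qed
  from choice[OF this] obtain C1 where C1: "\<And>s. \<forall>\<^sub>F n in sequentially. integrable M (\<lambda>\<omega>. (err n \<omega> $ s) ^ 6) \<and>
      expectation (\<lambda>\<omega>. (err n \<omega> $ s) ^ 6) \<le> C1 s / real n ^ 3" by blast
  have "\<forall>s. \<exists>C. \<forall>\<^sub>F n in sequentially. integrable M (\<lambda>\<omega>. ((H *v score n \<omega>) $ s) ^ 6) \<and>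
      expectation (\<lambda>\<omega>. ((H *v score n \<omega>) $ s) ^ 6) \<le> C / real n ^ 3"
  proof
    fix s
    show "\<exists>C. \<forall>\<^sub>F n in sequentially. integrable M (\<lambda>\<omega>. ((H *v score n \<omega>) $ s) ^ 6) \<and>
      expectation (\<lambda>\<omega>. ((H *v score n \<omega>) $ s) ^ 6) \<le> C / real n ^ 3"
      by (rule one[of "Score s" "\<lambda>n \<omega>. (H *v score n \<omega>) $ s"])
        (simp add: score_def matrix_vector_mult_def)
  qed
  from choice[OF this] obtain C2 where C2: "\<And>s. \<forall>\<^sub>F n in sequentially. integrable M (\<lambda>\<omega>. ((H *v score n \<omega>) $ s) ^ 6) \<and>
      expectation (\<lambda>\<omega>. ((H *v score n \<omega>) $ s) ^ 6) \<le> C2 s / real n ^ 3" by blast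
  define C where "C = (\<Sum>s\<in>UNIV. \<bar>C1 s\<bar> + \<bar>C2 s\<bar>)"
  have C: "C1 s \<le> C" "C2 s \<le> C" for s
  proof -
    have "\<bar>C1 s\<bar> + \<bar>C2 s\<bar> \<le> C"
      unfolding C_def by (rule member_le_sum) auto
    then show "C1 s \<le> C" "C2 s \<le> C" by linarith+
  qed
  show ?thesis
  proof (rule that[of C], rule eventually_all_finite)
    fix s
    show "\<forall>\<^sub>F n in sequentially.
      integrable M (\<lambda>\<omega>. (err n \<omega> $ s) ^ 6) \<and> expectation (\<lambda>\<omega>. (err n \<omega> $ s) ^ 6) \<le> C / real n ^ 3 \<and>
      integrable M (\<lambda>\<omega>. ((H *v score n \<omega>) $ s) ^ 6) \<and>
      expectation (\<lambda>\<omega>. ((H *v score n \<omega>) $ s) ^ 6) \<le> C / real n ^ 3"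
      using C1[of s] C2[of s]
    proof eventually_elim
      case (elim n)
      have "C1 s / real n ^ 3 \<le> C / real n ^ 3" "C2 s / real n ^ 3 \<le> C / real n ^ 3"
        using C by (auto intro: divide_right_mono)
      with elim show ?case by auto
    qed
  qed
qed

text \<open>The moment condition only speaks of averages. Consecutive sums differ by one observation,
  so a single observation inherits the sixth moment.\<close>

lemma centred_stat_power6_integrable:
  "integrable (density \<mu> (\<lambda>x. ennreal (g x))) (\<lambda>x. centred_stat i x ^ 6)"
proof -
  obtain N where N: "\<And>n s. n \<ge> N \<Longrightarrow> integrable M (\<lambda>\<omega>. ((H *v score n \<omega>) $ s) ^ 6)"
    using sixth_moments unfolding eventually_sequentially by metis
  obtain BG where BG: "BG > 0" "\<And>v. norm (G *v v) \<le> norm v * BG"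
    using bounded_linear.pos_bounded[OF matrix_vector_mul_bounded_linear[of G]] by blast
  have score_int: "integrable M (\<lambda>\<omega>. (score n \<omega> $ i) ^ 6)" if "n \<ge> N" for n
  proof (rule Bochner_Integration.integrable_bound)
    show "integrable M (\<lambda>\<omega>. (BG * real CARD('p)) ^ 6 * (\<Sum>s\<in>UNIV. ((H *v score n \<omega>) $ s) ^ 6))"
      using N[OF that] by (intro integrable_mult_right Bochner_Integration.integrable_sum) auto
    have "\<bar>score n \<omega> $ i\<bar> ^ 6 \<le> (BG * real CARD('p)) ^ 6 * (\<Sum>s\<in>UNIV. ((H *v score n \<omega>) $ s) ^ 6)" for \<omega>
    proof -
      let ?y = "H *v score n \<omega>"
      have "\<bar>score n \<omega> $ i\<bar> \<le> norm (score n \<omega>)" by (rule component_le_norm_cart)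
      also have "norm (score n \<omega>) = norm (G *v ?y)"
        by (simp add: matrix_vector_mul_assoc H_inverse)
      also have "\<dots> \<le> norm ?y * BG" by (rule BG)
      finally have "\<bar>score n \<omega> $ i\<bar> ^ 6 \<le> (norm ?y * BG) ^ 6" by (rule power_mono) simp
      also have "\<dots> = BG ^ 6 * norm ?y ^ 6" by (simp add: power_mult_distrib mult.commute)
      also have "\<dots> \<le> BG ^ 6 * (real CARD('p) ^ 6 * (\<Sum>s\<in>UNIV. (?y $ s) ^ 6))"
        using BG(1) by (intro mult_left_mono norm_power6_le_sum) auto
      finally show ?thesis by (simp add: power_mult_distrib mult_ac)
    qed
    then show "AE \<omega> in M. norm ((score n \<omega> $ i) ^ 6)
        \<le> norm ((BG * real CARD('p)) ^ 6 * (\<Sum>s\<in>UNIV. ((H *v score n \<omega>) $ s) ^ 6))"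
      by (intro AE_I2) (simp add: order.trans[OF _ abs_ge_self])
  qed measurable
  have "integrable M (\<lambda>\<omega>. centred_stat i (X N \<omega>) ^ 6)"
  proof (rule Bochner_Integration.integrable_bound)
    show "integrable M (\<lambda>\<omega>. 64 * (real (Suc N) ^ 6 * (score (Suc N) \<omega> $ i) ^ 6 + real N ^ 6 * (score N \<omega> $ i) ^ 6))"
      by (intro integrable_mult_right Bochner_Integration.integrable_add score_int) auto
    have "centred_stat i (X N \<omega>) ^ 6
        \<le> 64 * (real (Suc N) ^ 6 * (score (Suc N) \<omega> $ i) ^ 6 + real N ^ 6 * (score N \<omega> $ i) ^ 6)" for \<omega>
    proof -
      have "centred_stat i (X N \<omega>) = real (Suc N) * score (Suc N) \<omega> $ i - real N * score N \<omega> $ i"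
        by (cases "N = 0") (simp_all add: score_eq)
      then show ?thesis
        using power6_diff_le[of "real (Suc N) * score (Suc N) \<omega> $ i" "real N * score N \<omega> $ i"]
        by (simp only: power_mult_distrib)
    qed
    then show "AE \<omega> in M. norm (centred_stat i (X N \<omega>) ^ 6)
        \<le> norm (64 * (real (Suc N) ^ 6 * (score (Suc N) \<omega> $ i) ^ 6 + real N ^ 6 * (score N \<omega> $ i) ^ 6))"
      by (intro AE_I2) (simp add: order.trans[OF _ abs_ge_self])
  qed measurable
  then have "integrable (distr M \<mu> (X N)) (\<lambda>x. centred_stat i x ^ 6)"
    by (subst integrable_distr_eq) auto
  then show ?thesis by (simp add: distributed_distr_eq_density[OF X_distributed])
qed

lemma centred_stat_prod_integrable:
  assumes "length is \<le> 6"
  shows "integrable (density \<mu> (\<lambda>x. ennreal (g x))) (\<lambda>x. \<Prod>i\<leftarrow>is. centred_stat i x)"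
proof -
  interpret P: prob_space "density \<mu> (\<lambda>x. ennreal (g x))"
    using setting by (simp add: estimation_setting_def prob_density_def)
  have [measurable]: "(\<lambda>x. \<Prod>i\<leftarrow>is. centred_stat i x) \<in> borel_measurable \<mu>" for "is"
    by (induction "is") auto
  have "integrable (density \<mu> (\<lambda>x. ennreal (g x))) (\<lambda>x. 1 + (\<Sum>i\<in>UNIV. centred_stat i x ^ 6))"
    by (intro Bochner_Integration.integrable_add Bochner_Integration.integrable_sum
      centred_stat_power6_integrable) auto
  then show ?thesis
    by (rule Bochner_Integration.integrable_bound)
      (auto intro!: AE_I2 order.trans[OF prod_list_le_power6[OF assms] abs_ge_self])
qed

sublocale iid: iid_centred M \<mu> X centred_stat "\<lambda>is. expect \<mu> g (\<lambda>x. \<Prod>i\<leftarrow>is. centred_stat i x)"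
proof
  show "indep_vars (\<lambda>_. \<mu>) X UNIV" by (rule X_indep)
  show "centred_stat i \<in> borel_measurable \<mu>" for i by measurable
  have meas: "(\<lambda>x. \<Prod>i\<leftarrow>is. centred_stat i x) \<in> borel_measurable \<mu>" for "is"
    by (induction "is") auto
  show "integrable M (\<lambda>\<omega>. \<Prod>i\<leftarrow>is. centred_stat i (X a \<omega>))" if "length is \<le> 5" for "is" a
    using centred_stat_prod_integrable[of "is"] that
      integrable_distr_eq[OF X_measurable meas, of a "is"]
    by (simp add: distributed_distr_eq_density[OF X_distributed])
  show "expectation (\<lambda>\<omega>. \<Prod>i\<leftarrow>is. centred_stat i (X a \<omega>)) = expect \<mu> g (\<lambda>x. \<Prod>i\<leftarrow>is. centred_stat i x)"
    for "is" a
    using integral_distr[OF X_measurable meas, of a "is"]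
    by (simp add: distributed_distr_eq_density[OF X_distributed] expect_def)
  interpret P: prob_space "density \<mu> (\<lambda>x. ennreal (g x))"
    using setting by (simp add: estimation_setting_def prob_density_def)
  have c_int: "integrable (density \<mu> (\<lambda>x. ennreal (g x))) (centred_stat i)" for i
    using centred_stat_prod_integrable[of "[i]"] by simp
  have "expect \<mu> g (\<xi> i) = eta_star \<mu> \<xi> \<theta>\<^sub>s i" for i
  proof (rule information_projection_mean)
    show "information_projection \<mu> \<xi> \<Theta> g \<theta>\<^sub>s" "prob_density \<mu> g"
      using setting by (auto simp: estimation_setting_def)
    have "integrable (density \<mu> (\<lambda>x. ennreal (g x))) (\<lambda>x. centred_stat i x + eta_star \<mu> \<xi> \<theta>\<^sub>s i)" for i
      by (intro Bochner_Integration.integrable_add c_int) simp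
    then show "integrable (density \<mu> (\<lambda>x. ennreal (g x))) (\<xi> i)" for i
      by (simp add: centred_stat_def)
  qed
  moreover have "expect \<mu> g (\<xi> i) = expect \<mu> g (centred_stat i) + eta_star \<mu> \<xi> \<theta>\<^sub>s i" for i
  proof -
    have "expect \<mu> g (\<xi> i) = (\<integral>x. centred_stat i x + eta_star \<mu> \<xi> \<theta>\<^sub>s i \<partial>density \<mu> (\<lambda>x. ennreal (g x)))"
      by (simp add: centred_stat_def expect_def)
    also have "\<dots> = expect \<mu> g (centred_stat i) + eta_star \<mu> \<xi> \<theta>\<^sub>s i"
      using c_int[of i] P.prob_space by (simp add: expect_def)
    finally show ?thesis .
  qed
  ultimately show "expect \<mu> g (\<lambda>x. \<Prod>i\<leftarrow>[i]. centred_stat i x) = 0" for i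
    by simp
qed

end

section \<open>Expectation of the main part and expansion of the risk\<close>

lemma homogeneous_compose_linear:
  fixes A :: "real^'p::finite^'p"
  assumes "homogeneous k f"
  shows "homogeneous k (\<lambda>h. f (A *v h))"
  using assms
proof induction
  case (monomial "is" c)
  have coord: "homogeneous 1 (\<lambda>h. (A *v h) $ i)" for i
    unfolding matrix_vector_mult_def vec_lambda_beta by (intro homogeneous_sum homogeneous_cmult homogeneous_coord)
  have "homogeneous (length is) (\<lambda>h. \<Prod>i\<leftarrow>is. (A *v h) $ i)"
  proof (induction "is")
    case Nil
    show ?case by (simp add: homogeneous_const)
  next
    case (Cons i "is")
    show ?case using homogeneous_mult[OF coord Cons.IH] by simp
  qed
  then show ?case by (rule homogeneous_cmult)
next
  case (add k f g)
  then show ?case by (intro homogeneous.add)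
qed

lemma sum_UNIV_prod:
  fixes f :: "'x::finite \<times> 'y::finite \<Rightarrow> 'b::comm_monoid_add"
  shows "(\<Sum>x\<in>UNIV. f x) = (\<Sum>a\<in>UNIV. \<Sum>b\<in>UNIV. f (a, b))"
  by (simp add: sum.cartesian_product)

lemma prod_of_3_sums:
  fixes f g h :: "'x::finite \<Rightarrow> real"
  shows "sum f UNIV * sum g UNIV * sum h UNIV = (\<Sum>(a, b, c)\<in>UNIV. f a * g b * h c)"
  by (simp only: sum_UNIV_prod prod.case sum_distrib_left[symmetric] sum_distrib_right[symmetric])

lemma prod_of_4_sums:
  fixes f g h k :: "'x::finite \<Rightarrow> real"
  shows "sum f UNIV * sum g UNIV * sum h UNIV * sum k UNIV = (\<Sum>(a, b, c, d)\<in>UNIV. f a * g b * h c * k d)"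
  by (simp only: sum_UNIV_prod prod.case sum_distrib_left[symmetric] sum_distrib_right[symmetric])

context divergence_expansion
begin

lemma H_sym: "H $ i $ j = H $ j $ i"
proof -
  have Gt: "transpose G = G" by (simp add: transpose_def vec_eq_iff G_sym)
  have "transpose H ** G = transpose (G ** H)" by (simp add: matrix_transpose_mul Gt)
  then have "transpose H ** G = mat 1" by (simp add: GH transpose_mat)
  then have "transpose H ** G ** H = H" by simp
  then have "transpose H = H" by (simp add: matrix_mul_assoc[symmetric] GH)
  then show ?thesis by (metis transpose_def vec_lambda_beta)
qed

lemma H_vec: "(H *v v) $ a = (\<Sum>b\<in>UNIV. H $ a $ b * v $ b)"
  by (simp add: matrix_vector_mult_def)

text \<open>The next lemmas write each part of the main part as a sum over index tuples of a coefficient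
  times a product of coordinates of the score, the shape to which the moment formulas apply.\<close>

lemma form2_score: "form2 (H *v v) (H *v v) = (\<Sum>(i, j)\<in>UNIV. H $ i $ j * (\<Prod>i\<leftarrow>[i, j]. v $ i))"
proof -
  have "form2 (H *v v) (H *v v) = v \<bullet> (H *v v)"
    by (simp add: form2_inner matrix_vector_mul_assoc GH inner_commute)
  then show ?thesis
    by (simp add: inner_vec_def H_vec sum_UNIV_prod sum_distrib_left mult_ac)
qed

lemma form3_score: "form3 (H *v v) (H *v v) (H *v v) = (\<Sum>(u, k, l, s, m, t)\<in>UNIV.
    (H $ u $ k * H $ l $ s * H $ m $ t * t3 l m u) * (\<Prod>i\<leftarrow>[k, s, t]. v $ i))"
proof -
  have "form3 (H *v v) (H *v v) (H *v v) = (\<Sum>(l, m, u, s, t, k)\<in>UNIV.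
      t3 l m u * (H $ l $ s * v $ s * (H $ m $ t * v $ t) * (H $ u $ k * v $ k)))"
    unfolding form3_def H_vec prod_of_3_sums
    by (simp only: sum_distrib_left sum_UNIV_prod prod.case)
  also have "\<dots> = (\<Sum>(u, k, l, s, m, t)\<in>UNIV.
    (H $ u $ k * H $ l $ s * H $ m $ t * t3 l m u) * (\<Prod>i\<leftarrow>[k, s, t]. v $ i))"
    by (rule sum.reindex_bij_witness[of _ "\<lambda>(u, k, l, s, m, t). (l, m, u, s, t, k)"
          "\<lambda>(l, m, u, s, t, k). (u, k, l, s, m, t)"]) (auto simp: mult_ac)
  finally show ?thesis .
qed

lemma form4_score: "form4 (H *v v) = (\<Sum>(k, w, l, s, m, u, t, x)\<in>UNIV.
    (H $ k $ w * H $ l $ s * H $ m $ u * H $ t $ x * t4 l m t w) * (\<Prod>i\<leftarrow>[k, s, u, x]. v $ i))"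
proof -
  have "form4 (H *v v) = (\<Sum>(l, m, t, w, s, u, x, k)\<in>UNIV.
      t4 l m t w * (H $ l $ s * v $ s * (H $ m $ u * v $ u) * (H $ t $ x * v $ x) * (H $ w $ k * v $ k)))"
    unfolding form4_def H_vec prod_of_4_sums
    by (simp only: sum_distrib_left sum_UNIV_prod prod.case)
  also have "\<dots> = (\<Sum>(k, w, l, s, m, u, t, x)\<in>UNIV.
    (H $ k $ w * H $ l $ s * H $ m $ u * H $ t $ x * t4 l m t w) * (\<Prod>i\<leftarrow>[k, s, u, x]. v $ i))"
    by (rule sum.reindex_bij_witness[of _ "\<lambda>(k, w, l, s, m, u, t, x). (l, m, t, w, s, u, x, k)"
          "\<lambda>(l, m, t, w, s, u, x, k). (k, w, l, s, m, u, t, x)"]) (auto simp: mult_ac H_sym)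
  finally show ?thesis .
qed

lemma grad3_sq_score: "grad3_sq (H *v v) = (\<Sum>(k, q, l, u, s, x, t, w, h, m)\<in>UNIV.
    (H $ k $ q * H $ l $ u * H $ s $ x * H $ t $ w * H $ h $ m * t3 l m q * t3 s t h)
      * (\<Prod>i\<leftarrow>[k, u, x, w]. v $ i))"
proof -
  let ?y = "H *v v"
  have grad: "grad3 ?y $ i * grad3 ?y $ j = (\<Sum>l\<in>UNIV. \<Sum>q\<in>UNIV. \<Sum>s\<in>UNIV. \<Sum>t\<in>UNIV.
      t3 l q i * t3 s t j * (?y $ l * ?y $ q * ?y $ s * ?y $ t))" for i j
  proof -
    have "grad3 ?y $ i * grad3 ?y $ j = (\<Sum>l\<in>UNIV. \<Sum>q\<in>UNIV. \<Sum>s\<in>UNIV. \<Sum>t\<in>UNIV.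
      (t3 l q i * (?y $ l * ?y $ q)) * (t3 s t j * (?y $ s * ?y $ t)))"
      unfolding grad3_def vec_lambda_beta by (simp only: sum_distrib_left[symmetric] sum_distrib_right[symmetric])
    then show ?thesis by (simp only: mult_ac)
  qed
  have "grad3_sq ?y = (\<Sum>(m, h, l, q, s, t, u, k, x, w)\<in>UNIV. H $ m $ h * (t3 l q m * t3 s t h *
      (H $ l $ u * v $ u * (H $ q $ k * v $ k) * (H $ s $ x * v $ x) * (H $ t $ w * v $ w))))"
    unfolding grad3_sq_def grad H_vec prod_of_4_sums
    by (simp only: sum_distrib_left sum_UNIV_prod prod.case)
  also have "\<dots> = (\<Sum>(k, q, l, u, s, x, t, w, h, m)\<in>UNIV.
    (H $ k $ q * H $ l $ u * H $ s $ x * H $ t $ w * H $ h $ m * t3 l m q * t3 s t h)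
      * (\<Prod>i\<leftarrow>[k, u, x, w]. v $ i))"
    by (rule sum.reindex_bij_witness[of _ "\<lambda>(k, q, l, u, s, x, t, w, h, m). (m, h, l, q, s, t, u, k, x, w)"
          "\<lambda>(m, h, l, q, s, t, u, k, x, w). (k, q, l, u, s, x, t, w, h, m)"])
      (auto simp: mult_ac H_sym t3_sym(2))
  finally show ?thesis .
qed

end

context estimation
begin

abbreviation \<nu> :: "'p list \<Rightarrow> real" where
  "\<nu> is \<equiv> expect \<mu> g (\<lambda>x. \<Prod>i\<leftarrow>is. centred_stat i x)"

abbreviation pairings :: "'p \<Rightarrow> 'p \<Rightarrow> 'p \<Rightarrow> 'p \<Rightarrow> real" where
  "pairings i j k l \<equiv> \<nu> [i, j] * \<nu> [k, l] + \<nu> [i, k] * \<nu> [j, l] + \<nu> [i, l] * \<nu> [j, k]"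

lemma score_prod_eq:
  "(\<Prod>i\<leftarrow>is. score n \<omega> $ i) = (\<Prod>i\<leftarrow>is. iid.partial_sum n i \<omega>) / real n ^ length is"
  by (induction "is") (simp_all add: score_eq iid.partial_sum_def)

lemma score_prod_integrable:
  "length is \<le> 5 \<Longrightarrow> integrable M (\<lambda>\<omega>. \<Prod>i\<leftarrow>is. score n \<omega> $ i)"
  unfolding score_prod_eq by (intro integrable_divide_zero iid.partial_sum_integrable)

lemma score_prod_expectation:
  "expectation (\<lambda>\<omega>. \<Prod>i\<leftarrow>is. score n \<omega> $ i) = iid.sum_moment n is / real n ^ length is"
  unfolding score_prod_eq by (simp add: iid.sum_moment_def)

lemma weighted_score_prod:
  fixes c :: "'x::finite \<Rightarrow> real"
  assumes "\<And>x. length (idx x) \<le> 5"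
  shows "integrable M (\<lambda>\<omega>. \<Sum>x\<in>UNIV. c x * (\<Prod>i\<leftarrow>idx x. score n \<omega> $ i))"
    and "expectation (\<lambda>\<omega>. \<Sum>x\<in>UNIV. c x * (\<Prod>i\<leftarrow>idx x. score n \<omega> $ i))
      = (\<Sum>x\<in>UNIV. c x * (iid.sum_moment n (idx x) / real n ^ length (idx x)))"
proof -
  have int: "integrable M (\<lambda>\<omega>. c x * (\<Prod>i\<leftarrow>idx x. score n \<omega> $ i))" for x
    by (intro integrable_mult_right score_prod_integrable assms)
  then show "integrable M (\<lambda>\<omega>. \<Sum>x\<in>UNIV. c x * (\<Prod>i\<leftarrow>idx x. score n \<omega> $ i))"
    by (intro Bochner_Integration.integrable_sum)
  show "expectation (\<lambda>\<omega>. \<Sum>x\<in>UNIV. c x * (\<Prod>i\<leftarrow>idx x. score n \<omega> $ i))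
      = (\<Sum>x\<in>UNIV. c x * (iid.sum_moment n (idx x) / real n ^ length (idx x)))"
    by (subst Bochner_Integration.integral_sum[OF int]) (simp add: score_prod_expectation)
qed

lemma score_moment_2: "iid.sum_moment n [i, j] / real n ^ length [i, j] = \<nu> [i, j] / real n"
  unfolding iid.sum_moment_2 by (simp add: power2_eq_square)

lemma score_moment_3: "iid.sum_moment n [i, j, k] / real n ^ length [i, j, k] = \<nu> [i, j, k] / real n ^ 2"
  unfolding iid.sum_moment_3 by (cases "n = 0") (simp_all add: field_simps eval_nat_numeral)

lemma score_moment_4:
  "iid.sum_moment n [i, j, k, l] / real n ^ length [i, j, k, l] =
    pairings i j k l / real n ^ 2 + (\<nu> [i, j, k, l] - pairings i j k l) / real n ^ 3"
proof (cases "n = 0")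
  case False
  have "(real n * a + real n * (real n - 1) * b) / real n ^ 4 = b / real n ^ 2 + (a - b) / real n ^ 3" for a b
    using False by (simp add: field_simps eval_nat_numeral)
  moreover have "length [i, j, k, l] = 4" by simp
  ultimately show ?thesis unfolding iid.sum_moment_4 by (simp only:)
qed (simp add: iid.sum_moment_0)

text \<open>The fifth moments of the sum grow at most quadratically.\<close>

lemma homogeneous_5_score:
  assumes "homogeneous 5 r"
  shows "\<exists>C. \<forall>n. integrable M (\<lambda>\<omega>. r (score n \<omega>)) \<and> \<bar>expectation (\<lambda>\<omega>. r (score n \<omega>))\<bar> \<le> C / real n ^ 3"
  using assms
proof (induction "5 :: nat" r rule: homogeneous.induct)
  case (monomial "is" c)
  then obtain i j k l m where is_eq: "is = [i, j, k, l, m]"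
    by (auto simp: eval_nat_numeral length_Suc_conv)
  obtain A where A: "\<And>n. iid.sum_moment n is = real n * \<nu> is + real n * (real n - 1) * A"
    using iid.sum_moment_5 unfolding is_eq by blast
  define B where "B = \<bar>c\<bar> * (\<bar>\<nu> is\<bar> + \<bar>A\<bar>)"
  have E: "expectation (\<lambda>\<omega>. c * (\<Prod>i\<leftarrow>is. score n \<omega> $ i)) = c * (iid.sum_moment n is / real n ^ 5)" for n
    by (simp only: integral_mult_right_zero score_prod_expectation monomial[symmetric])
  have "\<bar>expectation (\<lambda>\<omega>. c * (\<Prod>i\<leftarrow>is. score n \<omega> $ i))\<bar> \<le> B / real n ^ 3" for n
  proof (cases "n = 0")
    case True
    then show ?thesis unfolding E by (simp add: is_eq iid.sum_moment_0)
  next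
    case False
    have "\<bar>iid.sum_moment n is\<bar> \<le> real n * \<bar>\<nu> is\<bar> + real n * (real n - 1) * \<bar>A\<bar>"
      unfolding A using False by (intro order.trans[OF abs_triangle_ineq] add_mono) (auto simp: abs_mult)
    also have "\<dots> \<le> real n ^ 2 * \<bar>\<nu> is\<bar> + real n ^ 2 * \<bar>A\<bar>"
      using False by (intro add_mono mult_right_mono) (auto simp: power2_eq_square)
    finally have bound: "\<bar>iid.sum_moment n is\<bar> \<le> real n ^ 2 * (\<bar>\<nu> is\<bar> + \<bar>A\<bar>)"
      by (simp add: distrib_left)
    have "\<bar>expectation (\<lambda>\<omega>. c * (\<Prod>i\<leftarrow>is. score n \<omega> $ i))\<bar> = \<bar>c\<bar> * (\<bar>iid.sum_moment n is\<bar> / real n ^ 5)"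
      unfolding E by (simp add: abs_mult)
    also have "\<dots> \<le> \<bar>c\<bar> * (real n ^ 2 * (\<bar>\<nu> is\<bar> + \<bar>A\<bar>) / real n ^ 5)"
      by (intro mult_left_mono divide_right_mono bound) auto
    also have "\<dots> = B / real n ^ 3"
      using False by (simp add: B_def field_simps eval_nat_numeral)
    finally show ?thesis .
  qed
  moreover have "integrable M (\<lambda>\<omega>. c * (\<Prod>i\<leftarrow>is. score n \<omega> $ i))" for n
    using monomial by (intro integrable_mult_right score_prod_integrable) simp
  ultimately show ?case by blast
next
  case (add f g)
  then obtain C C' where C: "\<And>n. integrable M (\<lambda>\<omega>. f (score n \<omega>))" "\<And>n. \<bar>expectation (\<lambda>\<omega>. f (score n \<omega>))\<bar> \<le> C / real n ^ 3"
    "\<And>n. integrable M (\<lambda>\<omega>. g (score n \<omega>))" "\<And>n. \<bar>expectation (\<lambda>\<omega>. g (score n \<omega>))\<bar> \<le> C' / real n ^ 3"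
    by blast
  have "\<bar>expectation (\<lambda>\<omega>. f (score n \<omega>)) + expectation (\<lambda>\<omega>. g (score n \<omega>))\<bar> \<le> (C + C') / real n ^ 3" for n
    using C(2,4)[of n] by (simp add: add_divide_distrib)
  then show ?case using C(1,3) by (intro exI[of _ "C + C'"]) simp
qed

definition risk_approximation :: "nat \<Rightarrow> real" where
  "risk_approximation n =
      1 / (2 * real n) * (\<Sum>(i, j)\<in>UNIV. H $ i $ j * \<nu> [i, j])
      + 1 / (24 * real n ^ 2) *
        (- 8 * (\<Sum>(u, k, l, s, m, t)\<in>UNIV.
            H $ u $ k * H $ l $ s * H $ m $ t * \<nu> [k, s, t] * partial_derivs [l, m, u] \<Psi> \<theta>\<^sub>s)
         + 9 * (\<Sum>(k, q, l, u, s, v, t, w, h, m)\<in>UNIV.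
            H $ k $ q * H $ l $ u * H $ s $ v * H $ t $ w * H $ h $ m *
            partial_derivs [l, m, q] \<Psi> \<theta>\<^sub>s * partial_derivs [s, t, h] \<Psi> \<theta>\<^sub>s * pairings k u v w)
         - 3 * (\<Sum>(k, w, l, s, m, u, t, v)\<in>UNIV.
            H $ k $ w * H $ l $ s * H $ m $ u * H $ t $ v * partial_derivs [l, m, t, w] \<Psi> \<theta>\<^sub>s * pairings k s u v))"

text \<open>The expansion is exact up to one term: the fourth moment of the mean equals the pairings at
  order two plus a fixed correction at order three, collected in \<open>K\<close>.\<close>

lemma main_part_expectation:
  obtains K where "\<And>n. integrable M (\<lambda>\<omega>. main_part (H *v score n \<omega>))"
    and "\<And>n. expectation (\<lambda>\<omega>. main_part (H *v score n \<omega>)) =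
      risk_approximation n + K / real n ^ 3"
proof -
  \<comment> \<open>Each sum over tuples is described by a coefficient \<open>c\<close> and the list \<open>i\<close> of score indices.\<close>
  define c2 where "c2 = (\<lambda>(i, j). H $ i $ j)"
  define i2 where "i2 = (\<lambda>(i :: 'p, j :: 'p). [i, j])"
  define c3 where "c3 = (\<lambda>(u, k, l, s, m, t). H $ u $ k * H $ l $ s * H $ m $ t * partial_derivs [l, m, u] \<Psi> \<theta>\<^sub>s)"
  define i3 where "i3 = (\<lambda>(u :: 'p, k :: 'p, l :: 'p, s :: 'p, m :: 'p, t :: 'p). [k, s, t])"
  define cq where "cq = (\<lambda>(k, q, l, u, s, v, t, w, h, m). H $ k $ q * H $ l $ u * H $ s $ v * H $ t $ w * H $ h $ m *
            partial_derivs [l, m, q] \<Psi> \<theta>\<^sub>s * partial_derivs [s, t, h] \<Psi> \<theta>\<^sub>s)"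
  define iq where "iq = (\<lambda>(k :: 'p, q :: 'p, l :: 'p, u :: 'p, s :: 'p, v :: 'p, t :: 'p, w :: 'p, h :: 'p, m :: 'p). [k, u, v, w])"
  define c4 where "c4 = (\<lambda>(k, w, l, s, m, u, t, v). H $ k $ w * H $ l $ s * H $ m $ u * H $ t $ v * partial_derivs [l, m, t, w] \<Psi> \<theta>\<^sub>s)"
  define i4 where "i4 = (\<lambda>(k :: 'p, w :: 'p, l :: 'p, s :: 'p, m :: 'p, u :: 'p, t :: 'p, v :: 'p). [k, s, u, v])"
  define P where "P is = pairings (is ! 0) (is ! 1) (is ! 2) (is ! 3)" for "is"
  have len: "length (i2 a) \<le> 5" "length (i3 b) \<le> 5" "length (iq c) \<le> 5" "length (i4 d) \<le> 5" for a b c d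
    by (simp_all add: i2_def i3_def iq_def i4_def split: prod.splits)
  let ?S = "\<lambda>c idx n \<omega>. \<Sum>x\<in>UNIV. c x * (\<Prod>i\<leftarrow>idx x. score n \<omega> $ i)"
  have main: "main_part (H *v score n \<omega>) =
      1/2 * ?S c2 i2 n \<omega> - 1/3 * ?S c3 i3 n \<omega> + 3/8 * ?S cq iq n \<omega> - 1/8 * ?S c4 i4 n \<omega>" for n \<omega>
    unfolding main_part_def form2_score form3_score grad3_sq_score form4_score
      c2_def i2_def c3_def i3_def cq_def iq_def c4_def i4_def
    by (simp only: split_def)
  note int = weighted_score_prod(1)[of i2 c2, OF len(1)] weighted_score_prod(1)[of i3 c3, OF len(2)]
    weighted_score_prod(1)[of iq cq, OF len(3)] weighted_score_prod(1)[of i4 c4, OF len(4)]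
  note ev = weighted_score_prod(2)[of i2 c2, OF len(1)] weighted_score_prod(2)[of i3 c3, OF len(2)]
    weighted_score_prod(2)[of iq cq, OF len(3)] weighted_score_prod(2)[of i4 c4, OF len(4)]
  have e2: "iid.sum_moment n (i2 x) / real n ^ length (i2 x) = \<nu> (i2 x) / real n" for n x
    unfolding i2_def by (cases x) (simp only: prod.case score_moment_2)
  have e3: "iid.sum_moment n (i3 x) / real n ^ length (i3 x) = \<nu> (i3 x) / real n ^ 2" for n x
    unfolding i3_def by (cases x) (simp only: prod.case score_moment_3)
  have nth: "P [i, j, k, l] = pairings i j k l" for i j k l
    by (simp add: P_def eval_nat_numeral)
  have eq: "iid.sum_moment n (iq x) / real n ^ length (iq x) =
      P (iq x) / real n ^ 2 + (\<nu> (iq x) - P (iq x)) / real n ^ 3" for n x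
    unfolding iq_def split_def by (simp only: score_moment_4 nth)
  have e4: "iid.sum_moment n (i4 x) / real n ^ length (i4 x) =
      P (i4 x) / real n ^ 2 + (\<nu> (i4 x) - P (i4 x)) / real n ^ 3" for n x
    unfolding i4_def split_def by (simp only: score_moment_4 nth)
  have c3_eq: "c3 x * \<nu> (i3 x) = (case x of (u, k, l, s, m, t) \<Rightarrow>
      H $ u $ k * H $ l $ s * H $ m $ t * \<nu> [k, s, t] * partial_derivs [l, m, u] \<Psi> \<theta>\<^sub>s)" for x
    by (simp only: c3_def i3_def split_def mult_ac)
  define K where "K = 3/8 * (\<Sum>x\<in>UNIV. cq x * (\<nu> (iq x) - P (iq x))) - 1/8 * (\<Sum>x\<in>UNIV. c4 x * (\<nu> (i4 x) - P (i4 x)))"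
  show ?thesis
  proof (rule that[of K])
    fix n
    show "integrable M (\<lambda>\<omega>. main_part (H *v score n \<omega>))"
      unfolding main by (intro Bochner_Integration.integrable_add Bochner_Integration.integrable_diff integrable_mult_right int)
    have "expectation (\<lambda>\<omega>. main_part (H *v score n \<omega>)) =
        1/2 * (\<Sum>x\<in>UNIV. c2 x * (\<nu> (i2 x) / real n)) - 1/3 * (\<Sum>x\<in>UNIV. c3 x * (\<nu> (i3 x) / real n ^ 2))
        + 3/8 * (\<Sum>x\<in>UNIV. cq x * (P (iq x) / real n ^ 2 + (\<nu> (iq x) - P (iq x)) / real n ^ 3))
        - 1/8 * (\<Sum>x\<in>UNIV. c4 x * (P (i4 x) / real n ^ 2 + (\<nu> (i4 x) - P (i4 x)) / real n ^ 3))"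
      unfolding main e2[symmetric] e3[symmetric] eq[symmetric] e4[symmetric]
      by (simp only: Bochner_Integration.integral_diff Bochner_Integration.integral_add
        Bochner_Integration.integrable_diff Bochner_Integration.integrable_add
        integrable_mult_right integral_mult_right_zero int ev)
    also have "\<dots> = 1 / (2 * real n) * (\<Sum>x\<in>UNIV. c2 x * \<nu> (i2 x))
      + 1 / (24 * real n ^ 2) * (- 8 * (\<Sum>x\<in>UNIV. c3 x * \<nu> (i3 x)) + 9 * (\<Sum>x\<in>UNIV. cq x * P (iq x))
         - 3 * (\<Sum>x\<in>UNIV. c4 x * P (i4 x))) + K / real n ^ 3"
    proof -
      have lin: "(\<Sum>x\<in>UNIV. c x * (a x / b)) = (\<Sum>x\<in>UNIV. c x * a x) / b" for c a :: "'x::finite \<Rightarrow> real" and b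
        by (simp add: sum_divide_distrib)
      have lin2: "(\<Sum>x\<in>UNIV. c x * (a x / b + a' x / b')) = (\<Sum>x\<in>UNIV. c x * a x) / b + (\<Sum>x\<in>UNIV. c x * a' x) / b'"
        for c a a' :: "'x::finite \<Rightarrow> real" and b b'
        by (simp add: sum_divide_distrib distrib_left sum.distrib)
      show ?thesis unfolding lin lin2 K_def by (simp add: algebra_simps add_divide_distrib diff_divide_distrib)
    qed
    finally show "expectation (\<lambda>\<omega>. main_part (H *v score n \<omega>)) =
      risk_approximation n + K / real n ^ 3"
      unfolding risk_approximation_def c3_eq c2_def i2_def cq_def iq_def c4_def i4_def
      by (simp only: split_def nth)
  qed
qed

text \<open>The divergence at the estimate equals the main part plus a polynomial of degree five plus a
  remainder bounded by sixth powers. The polynomial is negligible by its moments, the remainder by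
  the sixth moments of the error and of the score.\<close>

lemma risk_main_part:
  assumes "termwise_expansion \<mu> \<xi> \<theta>\<^sub>s M \<theta>\<^sub>h"
  shows "\<exists>C. \<forall>\<^sub>F n in sequentially.
    \<bar>risk \<mu> \<xi> \<theta>\<^sub>s M \<theta>\<^sub>h n - expectation (\<lambda>\<omega>. main_part (H *v score n \<omega>))\<bar> \<le> C / real n ^ 3"
proof -
  have z: "graded 4 (\<lambda>h. score_shift \<theta>\<^sub>s h $ i - ((G *v h) $ i + 1/2 * grad3 h $ i + 1/6 * grad4 h $ i))" for i
  proof -
    have "(G *v h) $ i = (\<Sum>j\<in>UNIV. partial_derivs [j, i] \<Psi> \<theta>\<^sub>s * h $ j)" for h
    proof -
      have "G $ i $ j = partial_derivs [j, i] \<Psi> \<theta>\<^sub>s" for j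
        by (subst G_sym) (simp add: cov_model_def)
      then show ?thesis by (simp add: matrix_vector_mult_def del: partial_derivs.simps)
    qed
    then show ?thesis
      using score_shift_graded[OF theta_s, of i] by (simp add: grad3_def grad4_def del: partial_derivs.simps)
  qed
  have D: "graded 5 (\<lambda>h. bregman \<theta>\<^sub>s h - (1/2 * form2 h h + 1/6 * form3 h h h + 1/24 * form4 h))"
  proof -
    have "G $ i $ j = partial_derivs [i, j] \<Psi> \<theta>\<^sub>s" for i j by (simp add: cov_model_def)
    then show ?thesis
      using bregman_graded[OF theta_s] by (simp only: form2_def form3_def form4_def)
  qed
  obtain r C where r: "homogeneous 5 r" and C: "\<And>h. 0 \<le> bregman \<theta>\<^sub>s h \<Longrightarrow> bregman \<theta>\<^sub>s h \<le> h \<bullet> score_shift \<theta>\<^sub>s h \<Longrightarrow>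
      \<bar>bregman \<theta>\<^sub>s h - main_part (H *v score_shift \<theta>\<^sub>s h) - r (H *v score_shift \<theta>\<^sub>s h)\<bar>
      \<le> C * (norm h ^ 6 + norm (H *v score_shift \<theta>\<^sub>s h) ^ 6)"
    using global_remainder[OF z D] by blast
  obtain C5 where C5: "\<And>n. integrable M (\<lambda>\<omega>. r (H *v score n \<omega>))"
    "\<And>n. \<bar>expectation (\<lambda>\<omega>. r (H *v score n \<omega>))\<bar> \<le> C5 / real n ^ 3"
    using homogeneous_5_score[OF homogeneous_compose_linear[OF r, of H]] by blast
  obtain C6 where C6: "\<forall>\<^sub>F n in sequentially. \<forall>s.
      integrable M (\<lambda>\<omega>. (err n \<omega> $ s) ^ 6) \<and> expectation (\<lambda>\<omega>. (err n \<omega> $ s) ^ 6) \<le> C6 / real n ^ 3 \<and>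
      integrable M (\<lambda>\<omega>. ((H *v score n \<omega>) $ s) ^ 6) \<and>
      expectation (\<lambda>\<omega>. ((H *v score n \<omega>) $ s) ^ 6) \<le> C6 / real n ^ 3"
    by (rule sixth_moments)
  define p where "p = real CARD('p)"
  define B where "B = \<bar>C\<bar> * p ^ 6"
  have B: "B \<ge> 0" by (simp add: B_def p_def)
  let ?KL = "\<lambda>n \<omega>. KL_div \<mu> (expfam \<mu> \<xi> \<theta>\<^sub>s) (expfam \<mu> \<xi> (\<theta>\<^sub>h n \<omega>))"
  have "\<forall>\<^sub>F n in sequentially. integrable M (?KL n)"
    using assms unfolding termwise_expansion_def by (auto elim: eventually_mono)
  moreover have "\<forall>\<^sub>F n in sequentially. AE \<omega> in M. is_mle \<mu> \<xi> \<Theta> n (\<lambda>a. X a \<omega>) (\<theta>\<^sub>h n \<omega>)"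
    using setting by (simp add: estimation_setting_def)
  ultimately have "\<forall>\<^sub>F n in sequentially.
      \<bar>risk \<mu> \<xi> \<theta>\<^sub>s M \<theta>\<^sub>h n - expectation (\<lambda>\<omega>. main_part (H *v score n \<omega>))\<bar>
      \<le> (C5 + B * (p * (2 * C6))) / real n ^ 3"
    using C6 eventually_gt_at_top[of 0]
  proof eventually_elim
    case (elim n)
    define R where "R \<omega> = ?KL n \<omega> - main_part (H *v score n \<omega>) - r (H *v score n \<omega>)" for \<omega>
    define W where "W \<omega> = B * (\<Sum>s\<in>UNIV. (err n \<omega> $ s) ^ 6 + ((H *v score n \<omega>) $ s) ^ 6)" for \<omega>
    have main_int: "integrable M (\<lambda>\<omega>. main_part (H *v score n \<omega>))"
      by (rule main_part_expectation) blast
    have R_int: "integrable M R"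
      unfolding R_def using elim by (intro Bochner_Integration.integrable_diff main_int C5(1)) auto
    have W_int: "integrable M W"
      unfolding W_def using elim
      by (intro integrable_mult_right Bochner_Integration.integrable_sum Bochner_Integration.integrable_add) auto
    have "AE \<omega> in M. \<bar>R \<omega>\<bar> \<le> W \<omega>"
      using elim(2)
    proof eventually_elim
      case (elim \<omega>)
      have th: "\<theta>\<^sub>h n \<omega> \<in> \<Theta>" using elim by (simp add: is_mle_def)
      have n: "0 < n" using \<open>0 < n\<close> .
      have KL: "?KL n \<omega> = bregman \<theta>\<^sub>s (err n \<omega>)"
        by (simp add: KL_div_bregman[OF theta_s th] err_def)
      have shift: "score_shift \<theta>\<^sub>s (err n \<omega>) = score n \<omega>"
        using mle_score(1)[OF elim theta_s n] by (simp add: err_def score_def)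
      have nonneg: "0 \<le> bregman \<theta>\<^sub>s (err n \<omega>)"
        using KL_div_expfam(2)[OF theta_s th] by (simp add: KL)
      have upper: "bregman \<theta>\<^sub>s (err n \<omega>) \<le> err n \<omega> \<bullet> score_shift \<theta>\<^sub>s (err n \<omega>)"
        using mle_score(2)[OF elim theta_s n] unfolding shift by (simp add: err_def score_def)
      have "\<bar>R \<omega>\<bar> \<le> C * (norm (err n \<omega>) ^ 6 + norm (H *v score n \<omega>) ^ 6)"
        using C[OF nonneg upper] by (simp add: R_def KL shift)
      also have "\<dots> \<le> \<bar>C\<bar> * (p ^ 6 * (\<Sum>s\<in>UNIV. (err n \<omega> $ s) ^ 6) + p ^ 6 * (\<Sum>s\<in>UNIV. ((H *v score n \<omega>) $ s) ^ 6))"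
        unfolding p_def by (intro mult_mono add_mono norm_power6_le_sum) auto
      also have "\<dots> = W \<omega>"
        by (simp add: W_def B_def sum.distrib distrib_left mult_ac)
      finally show ?case .
    qed
    then have "\<bar>expectation R\<bar> \<le> expectation W"
      by (intro order.trans[OF integral_abs_bound] integral_mono_AE integrable_abs R_int W_int)
    also have "expectation W = B * (\<Sum>s\<in>UNIV. expectation (\<lambda>\<omega>. (err n \<omega> $ s) ^ 6) + expectation (\<lambda>\<omega>. ((H *v score n \<omega>) $ s) ^ 6))"
      unfolding W_def using elim
      by (simp add: Bochner_Integration.integral_sum Bochner_Integration.integral_add)
    also have "\<dots> \<le> B * (\<Sum>s\<in>(UNIV :: 'p set). C6 / real n ^ 3 + C6 / real n ^ 3)"
      using elim B by (intro mult_left_mono sum_mono add_mono) auto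
    also have "\<dots> = B * (p * (2 * C6)) / real n ^ 3"
      by (simp add: p_def)
    finally have "\<bar>expectation R\<bar> \<le> B * (p * (2 * C6)) / real n ^ 3" .
    moreover have "expectation R = risk \<mu> \<xi> \<theta>\<^sub>s M \<theta>\<^sub>h n - expectation (\<lambda>\<omega>. main_part (H *v score n \<omega>))
        - expectation (\<lambda>\<omega>. r (H *v score n \<omega>))"
      unfolding R_def risk_def using elim main_int C5(1) by simp
    ultimately show ?case
      using C5(2)[of n] by (simp add: add_divide_distrib)
  qed
  then show ?thesis by blast
qed

theorem risk_expansion:
  assumes "termwise_expansion \<mu> \<xi> \<theta>\<^sub>s M \<theta>\<^sub>h"
  shows "(\<lambda>n. risk \<mu> \<xi> \<theta>\<^sub>s M \<theta>\<^sub>h n - risk_approximation n) \<in> O(\<lambda>n. 1 / real n ^ 3)"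
proof -
  obtain C where C: "\<forall>\<^sub>F n in sequentially.
    \<bar>risk \<mu> \<xi> \<theta>\<^sub>s M \<theta>\<^sub>h n - expectation (\<lambda>\<omega>. main_part (H *v score n \<omega>))\<bar> \<le> C / real n ^ 3"
    using risk_main_part[OF assms] by blast
  obtain K where K: "\<And>n. expectation (\<lambda>\<omega>. main_part (H *v score n \<omega>)) = risk_approximation n + K / real n ^ 3"
    by (rule main_part_expectation) (rule that)
  show ?thesis
  proof (rule bigoI[of _ "C + \<bar>K\<bar>"])
    show "\<forall>\<^sub>F n in sequentially. norm (risk \<mu> \<xi> \<theta>\<^sub>s M \<theta>\<^sub>h n - risk_approximation n) \<le> (C + \<bar>K\<bar>) * norm (1 / real n ^ 3)"
      using C
    proof eventually_elim
      case (elim n)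
      have T: "risk_approximation n = expectation (\<lambda>\<omega>. main_part (H *v score n \<omega>)) - K / real n ^ 3"
        using K[of n] by linarith
      have "\<bar>risk \<mu> \<xi> \<theta>\<^sub>s M \<theta>\<^sub>h n - risk_approximation n\<bar> \<le> C / real n ^ 3 + \<bar>K / real n ^ 3\<bar>"
        unfolding T using elim by linarith
      then show ?case by (simp add: abs_divide add_divide_distrib)
    qed
  qed
qed

end

theorem corollary1:
  shows "\<exists>K. \<forall>(\<mu> :: 'a measure) (\<xi> :: 'p::finite \<Rightarrow> 'a \<Rightarrow> real) \<Theta> g \<theta>\<^sub>s (M :: 'w measure) X \<theta>\<^sub>h \<theta>\<^sub>t.
    estimation_setting \<mu> \<xi> \<Theta> g \<theta>\<^sub>s M X \<theta>\<^sub>h \<longrightarrow>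
    termwise_expansion \<mu> \<xi> \<theta>\<^sub>s M \<theta>\<^sub>h \<longrightarrow>
    moment_condition K \<mu> \<xi> \<theta>\<^sub>s M X \<theta>\<^sub>h \<theta>\<^sub>t \<longrightarrow>
    (let G = cov_true \<mu> \<xi> g \<theta>\<^sub>s;
         H = matrix_inv (cov_model \<mu> \<xi> \<theta>\<^sub>s);
         \<kappa> = kappa3 \<mu> \<xi> g \<theta>\<^sub>s;
         \<kappa>3 = kappa3_star \<mu> \<xi> \<theta>\<^sub>s;
         \<kappa>4 = kappa4_star \<mu> \<xi> \<theta>\<^sub>s
     in (\<lambda>n. risk \<mu> \<xi> \<theta>\<^sub>s M \<theta>\<^sub>h n -
          (1 / (2 * real n) * trace (H ** G)
           + 1 / (24 * real n ^ 2) *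
             (- 8 * (\<Sum>(u, k, l, s, m, t)\<in>UNIV.
                  H $ u $ k * H $ l $ s * H $ m $ t * \<kappa> k s t * \<kappa>3 l m u)
              + 9 * (\<Sum>(k, q, l, u, s, v, t, w, h, m)\<in>UNIV.
                  H $ k $ q * H $ l $ u * H $ s $ v * H $ t $ w * H $ h $ m *
                  \<kappa>3 l m q * \<kappa>3 s t h *
                  (G $ k $ u * G $ v $ w + G $ k $ v * G $ u $ w + G $ k $ w * G $ u $ v))
              - 3 * (\<Sum>(k, w, l, s, m, u, t, v)\<in>UNIV.
                  H $ k $ w * H $ l $ s * H $ m $ u * H $ t $ v * \<kappa>4 l m t w *
                  (G $ k $ s * G $ u $ v + G $ k $ u * G $ s $ v + G $ k $ v * G $ s $ u)))))
        \<in> O(\<lambda>n. 1 / real n ^ 3))"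
proof (intro exI[of _ 6] allI impI)
  \<comment> \<open>Six, because the remainder is controlled by sixth powers of the error and of the score.\<close>
  fix \<mu> :: "'a measure" and \<xi> :: "'p \<Rightarrow> 'a \<Rightarrow> real" and \<Theta> g \<theta>\<^sub>s and M :: "'w measure" and X \<theta>\<^sub>h \<theta>\<^sub>t
  assume setting: "estimation_setting \<mu> \<xi> \<Theta> g \<theta>\<^sub>s M X \<theta>\<^sub>h"
    and termwise: "termwise_expansion \<mu> \<xi> \<theta>\<^sub>s M \<theta>\<^sub>h"
    and moments: "moment_condition 6 \<mu> \<xi> \<theta>\<^sub>s M X \<theta>\<^sub>h \<theta>\<^sub>t"
  interpret estimation \<mu> \<xi> \<Theta> g \<theta>\<^sub>s M X \<theta>\<^sub>h \<theta>\<^sub>t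
    using setting moments by unfold_locales
  have cov: "cov_true \<mu> \<xi> g \<theta>\<^sub>s $ i $ j = expect \<mu> g (\<lambda>x. \<Prod>i\<leftarrow>[i, j]. centred_stat i x)" for i j
    by (simp add: cov_true_def centred_stat_def)
  have k3: "kappa3 \<mu> \<xi> g \<theta>\<^sub>s i j k = expect \<mu> g (\<lambda>x. \<Prod>i\<leftarrow>[i, j, k]. centred_stat i x)" for i j k
    by (simp add: kappa3_def centred_stat_def mult.assoc)
  have tr: "trace (matrix_inv (cov_model \<mu> \<xi> \<theta>\<^sub>s) ** cov_true \<mu> \<xi> g \<theta>\<^sub>s) =
      (\<Sum>(i, j)\<in>UNIV. matrix_inv (cov_model \<mu> \<xi> \<theta>\<^sub>s) $ i $ j *
        expect \<mu> g (\<lambda>x. \<Prod>i\<leftarrow>[i, j]. centred_stat i x))"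
  proof -
    have "cov_true \<mu> \<xi> g \<theta>\<^sub>s $ j $ i = cov_true \<mu> \<xi> g \<theta>\<^sub>s $ i $ j" for i j
      by (simp add: cov_true_def mult.commute)
    then show ?thesis
      unfolding cov[symmetric] sum_UNIV_prod prod.case trace_def matrix_matrix_mult_def by simp
  qed
  show "let G = cov_true \<mu> \<xi> g \<theta>\<^sub>s;
         H = matrix_inv (cov_model \<mu> \<xi> \<theta>\<^sub>s);
         \<kappa> = kappa3 \<mu> \<xi> g \<theta>\<^sub>s;
         \<kappa>3 = kappa3_star \<mu> \<xi> \<theta>\<^sub>s;
         \<kappa>4 = kappa4_star \<mu> \<xi> \<theta>\<^sub>s
     in (\<lambda>n. risk \<mu> \<xi> \<theta>\<^sub>s M \<theta>\<^sub>h n -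
          (1 / (2 * real n) * trace (H ** G)
           + 1 / (24 * real n ^ 2) *
             (- 8 * (\<Sum>(u, k, l, s, m, t)\<in>UNIV.
                  H $ u $ k * H $ l $ s * H $ m $ t * \<kappa> k s t * \<kappa>3 l m u)
              + 9 * (\<Sum>(k, q, l, u, s, v, t, w, h, m)\<in>UNIV.
                  H $ k $ q * H $ l $ u * H $ s $ v * H $ t $ w * H $ h $ m *
                  \<kappa>3 l m q * \<kappa>3 s t h *
                  (G $ k $ u * G $ v $ w + G $ k $ v * G $ u $ w + G $ k $ w * G $ u $ v))
              - 3 * (\<Sum>(k, w, l, s, m, u, t, v)\<in>UNIV.
                  H $ k $ w * H $ l $ s * H $ m $ u * H $ t $ v * \<kappa>4 l m t w *
                  (G $ k $ s * G $ u $ v + G $ k $ u * G $ s $ v + G $ k $ v * G $ s $ u)))))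
        \<in> O(\<lambda>n. 1 / real n ^ 3)"
    unfolding Let_def tr cov k3 kappa3_star_partial_derivs[OF theta_s] kappa4_star_def
    by (rule risk_expansion[OF termwise, unfolded risk_approximation_def])
qed

end
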